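(* Let $A \in \mathbb{R}^{n\times n}$, $b \in \mathbb{R}^n$, let $k \ge 1$ and $m \ge 1$ be integers, $m<n$, and let $V_m = [v_1,\ldots,v_m] \in \mathbb{R}^{n\times m}$ and the upper Hessenberg matrix $H_m \in \mathbb{R}^{m\times m}$ be produced from $A$, $b$ by the truncated orthogonalization procedure with truncation parameter $k$ (described in the context). Assume that $f$ is holomorphic on a domain in $\mathbb{C}$ containing $W(V_m^{\dagger} A V_m)$ and $W(H_m)$. Then $$\|f(V_m^{\dagger} A V_m)e_1 - f(H_m)e_1\|_2 \le (2 + 2\sqrt{2}) \min_{p \in \Pi_{m-1}} \|f-p\|_{W(V_m^{\dagger} A V_m) \cup W(H_m)}.$$
   Context: Notation: $V^\dagger$ is the Moore–Penrose pseudoinverse; $e_1$ and $e_m$ are the first and $m$th canonical basis vectors of $\mathbb{R}^m$. For a square matrix $C$ of size $d$, $W(C) = \{z^*Cz : z \in \mathbb{C}^d, \|z\|_2 = 1\}$ is its numerical range. $\Pi_{m-1}$ is the vector space of (complex) polynomials of degree at most $m-1$. For a set $S\subseteq\mathbb{C}$, $\|g\|_S = \sup\{|g(z)| : z\in S\}$. For a square matrix $C$ and $g$ analytic on the closure of a domain $\mathbb{D}$ containing the eigenvalues of $C$, $g(C) = \frac{1}{2\pi i}\int_{\partial\mathbb{D}} g(z)(zI-C)^{-1}\,dz$ (the usual holomorphic matrix function). Standing assumption: the Krylov subspace $\mathcal{K}_m(A,b) = \mathrm{span}\{b, Ab, \ldots, A^{m-1}b\}$ has dimension $m$. Truncated orthogonalization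 procedure (input $A$, $b$, $m$, $k$): set $v_1 = b/\|b\|_2$. For $i = 2,\ldots,m+1$: set $w_i = A v_{i-1}$; for $j = \max\{1,i-k\},\ldots,i-1$ (in this order) set $h_{j,i-1} = v_j^T w_i$ and then replace $w_i$ by $w_i - h_{j,i-1} v_j$; finally set $h_{i,i-1} = \|w_i\|_2$ and $v_i = w_i/\|w_i\|_2$. It is assumed that all normalizations are well defined, i.e. $w_i\neq 0$ at each normalization. All entries $h_{j,i}$ not assigned are zero. Let $V_m = [v_1,\ldots,v_m]$ and $H_m = (h_{j,i})_{1\le j,i\le m}$. The columns of $V_m$ form a basis of $\mathcal{K}_m(A,b)$ (in general not orthonormal), $H_m$ is upper Hessenberg, and the Arnoldi-like decomposition $A V_m = V_m H_m + h_{m+1,m} v_{m+1} e_m^T$ holds. *)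

theory Defs
  imports
    "HOL-Complex_Analysis.Complex_Analysis"
    "Jordan_Normal_Form.Spectral_Radius"
    "Jordan_Normal_Form.VS_Connect"
begin

hide_type (open) Finite_Cartesian_Product.vec
hide_const (open) Finite_Cartesian_Product.vec Finite_Cartesian_Product.mat
unbundle no vec_syntax and no inner_syntax

definition vec_norm2 :: "'a::real_normed_vector vec \<Rightarrow> real" where
  "vec_norm2 v = L2_set (\<lambda>i. norm (v $ i)) {..<dim_vec v}"

definition sup_norm_on :: "complex set \<Rightarrow> (complex \<Rightarrow> complex) \<Rightarrow> real" where
  "sup_norm_on S g = (SUP z\<in>S. norm (g z))"

text \<open>Since \<open>x \<bullet>c y\<close> conjugates its second argument, \<open>(C z) \<bullet>c z\<close> is \<open>z* C z\<close>.\<close>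

definition numerical_range :: "complex mat \<Rightarrow> complex set" where
  "numerical_range C =
     {(C *\<^sub>v z) \<bullet>c z | z. z \<in> carrier_vec (dim_row C) \<and> vec_norm2 z = 1}"

text \<open>The Moore--Penrose pseudoinverse of a real matrix, as the unique solution of the four
  Penrose equations.\<close>

definition pinv :: "real mat \<Rightarrow> real mat" where
  "pinv V = (THE X. X \<in> carrier_mat (dim_col V) (dim_row V) \<and>
     V * X * V = V \<and> X * V * X = X \<and>
     transpose_mat (V * X) = V * X \<and> transpose_mat (X * V) = X * V)"

definition krylov_space :: "real mat \<Rightarrow> real vec \<Rightarrow> nat \<Rightarrow> real vec set" where
  "krylov_space A b m =
     LinearCombinations.module.span class_ring (module_vec TYPE(real) (dim_row A))
       {(A ^\<^sub>m i) *\<^sub>v b | i. i < m}"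

definition subspace_dim :: "nat \<Rightarrow> real vec set \<Rightarrow> nat" where
  "subspace_dim n U = vectorspace.dim class_ring (module_vec TYPE(real) n\<lparr>carrier := U\<rparr>)"

text \<open>The contours over which \<open>g(C)\<close> may be computed: \<open>\<gamma>\<close> is the positively oriented
  boundary of the Jordan domain \<open>inside (path_image \<gamma>)\<close>, which contains the eigenvalues of
  \<open>C\<close> and on whose closure \<open>g\<close> is analytic. By Cauchy's theorem all of them give the same
  integral.\<close>

definition cauchy_contour :: "(complex \<Rightarrow> complex) \<Rightarrow> complex mat \<Rightarrow> (real \<Rightarrow> complex) \<Rightarrow> bool" where
  "cauchy_contour g C \<gamma> \<longleftrightarrow>
     valid_path \<gamma> \<and> simple_path \<gamma> \<and> pathfinish \<gamma> = pathstart \<gamma> \<and>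
     (\<forall>z \<in> inside (path_image \<gamma>). winding_number \<gamma> z = 1) \<and>
     spectrum C \<subseteq> inside (path_image \<gamma>) \<and>
     g analytic_on closure (inside (path_image \<gamma>))"

definition resolvent :: "complex mat \<Rightarrow> complex \<Rightarrow> complex mat" where
  "resolvent C z = the (mat_inverse (z \<cdot>\<^sub>m 1\<^sub>m (dim_row C) - C))"

definition mat_fun :: "(complex \<Rightarrow> complex) \<Rightarrow> complex mat \<Rightarrow> complex mat" where
  "mat_fun g C = (let \<gamma> = (SOME \<gamma>. cauchy_contour g C \<gamma>) in
     mat (dim_row C) (dim_row C) (\<lambda>(i, j).
       1 / (2 * of_real pi * \<i>) * contour_integral \<gamma> (\<lambda>z. g z * resolvent C z $$ (i, j))))"

text \<open>Indices of \<open>v\<close> and \<open>h\<close> start at 1. The vector \<open>w i j\<close> is the value of the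
  program variable \<open>w\<^sub>i\<close> on entering the \<open>j\<close>-th pass of the inner loop, and \<open>w i i\<close> its
  value after the loop. The truncated difference makes \<open>max 1 (i - k)\<close> correct for
  \<open>i \<le> k\<close> as well.\<close>

definition truncated_orthogonalization ::
  "real mat \<Rightarrow> real vec \<Rightarrow> nat \<Rightarrow> nat \<Rightarrow> (nat \<Rightarrow> real vec) \<Rightarrow> (nat \<Rightarrow> nat \<Rightarrow> real) \<Rightarrow> bool" where
  "truncated_orthogonalization A b m k v h \<longleftrightarrow>
     b \<noteq> 0\<^sub>v (dim_vec b) \<and>
     v 1 = (1 / vec_norm2 b) \<cdot>\<^sub>v b \<and>
     (\<exists>w :: nat \<Rightarrow> nat \<Rightarrow> real vec. \<forall>i \<in> {2..m + 1}.
        w i (max 1 (i - k)) = A *\<^sub>v v (i - 1) \<and>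
        (\<forall>j \<in> {max 1 (i - k)..i - 1}.
           h j (i - 1) = v j \<bullet> w i j \<and>
           w i (j + 1) = w i j - h j (i - 1) \<cdot>\<^sub>v v j) \<and>
        w i i \<noteq> 0\<^sub>v (dim_row A) \<and>
        h i (i - 1) = vec_norm2 (w i i) \<and>
        v i = (1 / vec_norm2 (w i i)) \<cdot>\<^sub>v w i i) \<and>
     (\<forall>j c. \<not> (\<exists>i \<in> {2..m + 1}. c = i - 1 \<and> max 1 (i - k) \<le> j \<and> j \<le> i) \<longrightarrow> h j c = 0)"

definition basis_mat :: "nat \<Rightarrow> nat \<Rightarrow> (nat \<Rightarrow> real vec) \<Rightarrow> real mat" where
  "basis_mat n m v = mat_of_cols n (map v [1..<m + 1])"

definition hessenberg_mat :: "nat \<Rightarrow> (nat \<Rightarrow> nat \<Rightarrow> real) \<Rightarrow> real mat" where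
  "hessenberg_mat m h = mat m m (\<lambda>(i, j). h (i + 1) (j + 1))"

end

theory Submission
  imports Defs
begin

text \<open>
  Let \<open>B\<close> be the projected matrix \<open>V\<^sup>\<dagger> A V\<close> and \<open>C\<close> the Hessenberg matrix \<open>H\<close>. The columns of \<open>V\<close> form
  a basis of the Krylov space, so \<open>V\<^sup>\<dagger> V = I\<close>, and multiplying the Arnoldi-like relation
  \<open>A V = V H + h\<^sub>m\<^sub>+\<^sub>1\<^sub>,\<^sub>m v\<^sub>m\<^sub>+\<^sub>1 e\<^sub>m\<^sup>T\<close> by \<open>V\<^sup>\<dagger>\<close> shows that \<open>B\<close> and \<open>C\<close> differ only in their last columns
  (\<open>pinv_left_inverse\<close>, \<open>basis_mat_column_relation\<close>). Since \<open>C\<close> is Hessenberg, \<open>p(C) e\<^sub>1\<close> can be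
  computed for \<open>degree p < m\<close> without that column, hence \<open>p(B) e\<^sub>1 = p(C) e\<^sub>1\<close>
  (\<open>poly_at_mat_first_column_eq\<close>). For a best approximation \<open>p\<close> (\<open>best_approximation_exists\<close>) the
  error is therefore \<open>(f - p)(B) e\<^sub>1 - (f - p)(C) e\<^sub>1\<close>, and the constant \<open>2 + 2 \<surd>2\<close> is twice the
  constant in the theorem of Crouzeix and Palencia:
  \<open>\<parallel>g(A)\<parallel> \<le> (1 + \<surd>2) sup \<bar>g\<bar>\<close>, the supremum being over the numerical range of \<open>A\<close>
  (\<open>crouzeix_palencia\<close>).

  The proof of that theorem is the one of Ransford and Schwenninger. Let \<open>K\<close> be a convex compact
  neighbourhood of the numerical range and \<open>k\<close> the least constant with \<open>\<parallel>\<phi>(A)\<parallel> \<le> k\<close> for all \<open>\<phi>\<close>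
  that are holomorphic and bounded by 1 near \<open>K\<close>. Enclose \<open>K\<close> by a smooth convex curve
  (\<open>convex_curve_exists\<close>) on which such a \<open>\<phi>\<close> is still bounded by 1, and let \<open>g\<close> be the Cauchy
  transform along the curve of the complex conjugate of \<open>\<phi>\<close>. Two facts enter.

  \<^item> \<open>\<parallel>\<phi>(A) + g(A)\<^sup>*\<parallel> \<le> 2\<close> (\<open>double_layer_bound\<close>). This operator is the integral of \<open>\<phi>\<close> against the
    double layer kernel, whose values are positive semidefinite because the numerical range lies in
    the inner half plane of each tangent, and whose total mass is twice the identity.

  \<^item> \<open>\<bar>g\<bar> \<le> 1\<close> inside the curve (\<open>cauchy_transform_cnj_bound\<close>). In the scalar case half of the mass 2
    of the kernel concentrates at the boundary point that is approached; it reproduces the boundary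
    value of \<open>\<phi>\<close>, and the remaining half gives the conjugate of \<open>g\<close>.

  By the second fact the product \<open>\<phi> g \<phi>\<close> belongs to the same class as \<open>\<phi>\<close>, so its value at \<open>A\<close> is
  bounded by \<open>k\<close>; by the first, \<open>\<phi>(A)\<close> is controlled by \<open>g(A)\<close>. Together they give
  \<open>k\<^sup>4 \<le> 2 k\<^sup>3 + k\<^sup>2\<close>, whence \<open>k \<le> 1 + \<surd>2\<close>.

  Matrix functions are handled by interpolation. If \<open>\<chi>(A) = 0\<close> and \<open>\<phi> = q + \<chi> r\<close> near the
  zeros of the polynomial \<open>\<chi>\<close>, then \<open>\<phi>(A) = q(A)\<close>. For a Cauchy transform the interpolant \<open>q\<close> is explicit, and
  the contour integral of the resolvent yields the same matrix (\<open>function_value_cauchy_transform\<close>,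
  \<open>integral_functional_resolvent_poly\<close>, \<open>function_value_mat_fun\<close>).
\<close>

section \<open>Cauchy transforms and Newton interpolation\<close>

definition cauchy_transform :: "(real \<Rightarrow> complex) \<Rightarrow> (complex \<Rightarrow> complex) \<Rightarrow> complex \<Rightarrow> complex" where
  "cauchy_transform \<gamma> \<psi> z = 1 / (2 * pi * \<i>) * contour_integral \<gamma> (\<lambda>w. \<psi> w / (w - z))"

lemma C1_valid_path: "\<gamma> C1_differentiable_on {0..1} \<Longrightarrow> valid_path \<gamma>"
  unfolding valid_path_def by (rule C1_differentiable_imp_piecewise)

lemma C1_contour_integrable:
  assumes \<gamma>: "\<gamma> C1_differentiable_on {0..1}" and F: "continuous_on (path_image \<gamma>) F"
  shows "F contour_integrable_on \<gamma>"
proof -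
  have "continuous_on {0..1} \<gamma>" using C1_valid_path[OF \<gamma>] valid_path_imp_path path_def by blast
  then have "continuous_on {0..1} (\<lambda>t. F (\<gamma> t) * vector_derivative \<gamma> (at t))"
    using \<gamma> by (intro continuous_on_mult continuous_on_compose2[OF F]) (auto simp: path_image_def C1_differentiable_on_eq)
  then show ?thesis unfolding contour_integrable_on by (rule integrable_continuous_real)
qed

lemma cauchy_transform_holomorphic:
  assumes \<gamma>: "\<gamma> C1_differentiable_on {0..1}" and \<psi>: "continuous_on (path_image \<gamma>) \<psi>"
  shows "cauchy_transform \<gamma> \<psi> holomorphic_on - path_image \<gamma>"
proof -
  have *: "((\<lambda>u. \<psi> u / (u - w) ^ 1) has_contour_integral contour_integral \<gamma> (\<lambda>u. \<psi> u / (u - w))) \<gamma>"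
    if "w \<in> - path_image \<gamma> - path_image \<gamma>" for w
    unfolding power_one_right
    by (intro has_contour_integral_integral C1_contour_integrable \<gamma> continuous_intros \<psi>) (use that in auto)
  have "continuous_on {0..1} (\<lambda>t. vector_derivative \<gamma> (at t))"
    using \<gamma> by (simp add: C1_differentiable_on_eq)
  then obtain B where B: "\<forall>t\<in>{0..1}. norm (vector_derivative \<gamma> (at t)) \<le> B"
    using compact_imp_bounded[OF compact_continuous_image[OF _ compact_Icc]] by (force simp: bounded_iff)
  have op: "open (- path_image \<gamma>)"
    using closed_valid_path_image C1_valid_path[OF \<gamma>] by blast
  have "((\<lambda>w. contour_integral \<gamma> (\<lambda>u. \<psi> u / (u - w))) has_field_derivative
      (of_nat 1 * contour_integral \<gamma> (\<lambda>u. \<psi> u / (u - w) ^ Suc 1))) (at w)" if "w \<in> - path_image \<gamma>" for w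
    by (rule Cauchy_next_derivative(2)[OF \<psi> bspec[OF B] * _ op C1_valid_path[OF \<gamma>]]) (use that in auto)
  then have "(\<lambda>w. contour_integral \<gamma> (\<lambda>u. \<psi> u / (u - w))) holomorphic_on - path_image \<gamma>"
    using op by (auto simp: holomorphic_on_open)
  then show ?thesis unfolding cauchy_transform_def by (intro holomorphic_intros)
qed

text \<open>The scalar side of a functional calculus. Below, the list \<open>as\<close> consists of the zeros, with
  multiplicity, of a polynomial that annihilates a matrix \<open>A\<close>. The recursions over \<open>as\<close> express the
  resolvent and the matrix functions of \<open>A\<close> by polynomials in \<open>A\<close>, so that contour integrals of
  matrices reduce to contour integrals of scalar functions.\<close>

definition roots_poly :: "complex list \<Rightarrow> complex poly" where
  "roots_poly as = (\<Prod>a\<leftarrow>as. [:- a, 1:])"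

lemma roots_poly_simps [simp]: "roots_poly [] = 1" "roots_poly (a # as) = [:- a, 1:] * roots_poly as"
  by (simp_all add: roots_poly_def)

lemma poly_roots_poly_eq_0: "poly (roots_poly as) z = 0 \<longleftrightarrow> z \<in> set as"
  by (induction as) auto

text \<open>The quotient \<open>(1 - \<chi>(w) / \<chi>(z)) / (z - w)\<close> as a polynomial in \<open>w\<close>, where \<open>\<chi>\<close> is the polynomial with
  zeros \<open>as\<close>. If \<open>\<chi>(A) = 0\<close>, substituting \<open>A\<close> for \<open>w\<close> gives the resolvent of \<open>A\<close> at \<open>z\<close>.\<close>

primrec resolvent_poly :: "complex list \<Rightarrow> complex \<Rightarrow> complex poly" where
  "resolvent_poly [] z = 0"
| "resolvent_poly (a # as) z = Polynomial.smult (1 / (z - a)) (1 + [:- a, 1:] * resolvent_poly as z)"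

lemma resolvent_poly_identity:
  assumes "z \<notin> set as"
  shows "[:z, -1:] * resolvent_poly as z = 1 - Polynomial.smult (1 / poly (roots_poly as) z) (roots_poly as)"
proof -
  have "(z - w) * poly (resolvent_poly as z) w = 1 - poly (roots_poly as) w / poly (roots_poly as) z" for w
    using assms
  proof (induction as)
    case (Cons a as)
    then have IH: "(z - w) * poly (resolvent_poly as z) w = 1 - poly (roots_poly as) w / poly (roots_poly as) z"
      and nz: "z - a \<noteq> 0" "poly (roots_poly as) z \<noteq> 0" by (auto simp: poly_roots_poly_eq_0)
    define u where "u = 1 / (z - a)"
    have "(z - w) * poly (resolvent_poly (a # as) z) w = (z - w) * (u * (1 + (w - a) * poly (resolvent_poly as z) w))"
      unfolding resolvent_poly.simps poly_smult poly_add poly_mult poly_1 u_def by simp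
    also have "\<dots> = u * ((z - w) + (w - a) * ((z - w) * poly (resolvent_poly as z) w))"
      by (simp add: algebra_simps)
    also have "\<dots> = 1 - poly (roots_poly (a # as)) w / poly (roots_poly (a # as)) z"
      unfolding IH u_def using nz by (simp add: field_simps)
    finally show ?case .
  qed simp
  then have "poly ([:z, -1:] * resolvent_poly as z) = poly (1 - Polynomial.smult (1 / poly (roots_poly as) z) (roots_poly as))"
    by (intro ext) (simp add: algebra_simps)
  then show ?thesis by (simp only: poly_eq_poly_eq_iff)
qed

text \<open>The Newton form of the Hermite interpolant at \<open>as\<close> of the Cauchy transform of \<open>\<psi>\<close>: dividing \<open>\<psi>\<close> by \<open>z
  - a\<close> under the integral is taking a divided difference of the transform at \<open>a\<close>.\<close>

primrec newton_interpolant :: "(real \<Rightarrow> complex) \<Rightarrow> complex list \<Rightarrow> (complex \<Rightarrow> complex) \<Rightarrow> complex poly" where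
  "newton_interpolant \<gamma> [] \<psi> = 0"
| "newton_interpolant \<gamma> (a # as) \<psi> =
     [:cauchy_transform \<gamma> \<psi> a:] + [:- a, 1:] * newton_interpolant \<gamma> as (\<lambda>z. \<psi> z / (z - a))"

text \<open>The error of the interpolant is again a Cauchy transform times the nodal polynomial. So Cauchy
  transforms of arbitrary continuous functions, which need not be restrictions of holomorphic
  functions, have an explicit value at a matrix annihilated by that polynomial.\<close>

lemma cauchy_transform_newton:
  assumes \<gamma>: "\<gamma> C1_differentiable_on {0..1}" and "continuous_on (path_image \<gamma>) \<psi>"
    and "set as \<inter> path_image \<gamma> = {}" and w: "w \<notin> path_image \<gamma>"
  shows "cauchy_transform \<gamma> \<psi> w = poly (newton_interpolant \<gamma> as \<psi>) w
     + poly (roots_poly as) w * cauchy_transform \<gamma> (\<lambda>z. \<psi> z / poly (roots_poly as) z) w"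
  using assms(2,3)
proof (induction as arbitrary: \<psi>)
  case (Cons a as)
  have a: "a \<notin> path_image \<gamma>" and as: "set as \<inter> path_image \<gamma> = {}" using Cons.prems by auto
  have c: "continuous_on (path_image \<gamma>) (\<lambda>z. \<psi> z / (z - a))"
    by (intro continuous_intros Cons.prems) (use a in auto)
  have i: "(\<lambda>z. \<psi> z / (z - w)) contour_integrable_on \<gamma>" "(\<lambda>z. \<psi> z / (z - a)) contour_integrable_on \<gamma>"
    by (rule C1_contour_integrable[OF \<gamma>]; intro continuous_intros Cons.prems; use a w in auto)+
  have "cauchy_transform \<gamma> \<psi> w - cauchy_transform \<gamma> \<psi> a
      = 1 / (2 * pi * \<i>) * contour_integral \<gamma> (\<lambda>z. \<psi> z / (z - w) - \<psi> z / (z - a))"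
    unfolding cauchy_transform_def using i by (simp add: contour_integral_diff right_diff_distrib)
  also have "contour_integral \<gamma> (\<lambda>z. \<psi> z / (z - w) - \<psi> z / (z - a))
      = contour_integral \<gamma> (\<lambda>z. (w - a) * (\<psi> z / (z - a) / (z - w)))"
    by (rule contour_integral_eq) (use a w in \<open>auto simp: divide_simps; simp add: algebra_simps\<close>)
  also have "\<dots> = (w - a) * contour_integral \<gamma> (\<lambda>z. \<psi> z / (z - a) / (z - w))"
    by (intro contour_integral_lmul C1_contour_integrable[OF \<gamma>] continuous_intros c) (use w in auto)
  finally have "cauchy_transform \<gamma> \<psi> w - cauchy_transform \<gamma> \<psi> a
      = (w - a) * cauchy_transform \<gamma> (\<lambda>z. \<psi> z / (z - a)) w"
    by (simp add: cauchy_transform_def)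
  then have "cauchy_transform \<gamma> \<psi> w = cauchy_transform \<gamma> \<psi> a + (w - a) * cauchy_transform \<gamma> (\<lambda>z. \<psi> z / (z - a)) w"
    by (metis add.commute diff_eq_eq)
  then show ?case using Cons.IH[OF c as] by (simp add: algebra_simps)
qed simp

text \<open>Linear functionals on polynomials. In the applications \<open>L p\<close> is an entry of \<open>p(A)\<close>, or \<open>\<langle>p(A)u, w\<rangle>\<close>.\<close>

definition poly_functional :: "(complex poly \<Rightarrow> complex) \<Rightarrow> bool" where
  "poly_functional L \<longleftrightarrow> (\<forall>p q. L (p + q) = L p + L q) \<and> (\<forall>c p. L (Polynomial.smult c p) = c * L p)"

lemma poly_functional_shift: "poly_functional L \<Longrightarrow> poly_functional (\<lambda>p. L (q * p))"
  by (simp add: poly_functional_def algebra_simps)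

lemma holomorphic_functional_resolvent_poly:
  assumes "poly_functional L" "set as \<inter> X = {}"
  shows "(\<lambda>z. L (resolvent_poly as z)) holomorphic_on X"
  using assms
proof (induction as arbitrary: L)
  case Nil
  have "L 0 = 0" using Nil(1) unfolding poly_functional_def by (metis mult_zero_left Polynomial.smult_0_left)
  then show ?case by simp
next
  case (Cons a as)
  have eq: "L (resolvent_poly (a # as) z) = 1 / (z - a) * (L 1 + L ([:- a, 1:] * resolvent_poly as z))" for z
    using Cons.prems(1) unfolding poly_functional_def resolvent_poly.simps by metis
  have "(\<lambda>z. L ([:- a, 1:] * resolvent_poly as z)) holomorphic_on X"
    by (rule Cons.IH[OF poly_functional_shift[OF Cons.prems(1)]]) (use Cons.prems in auto)
  then show ?case unfolding eq using Cons.prems(2) by (intro holomorphic_intros) auto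
qed

text \<open>Integrating \<open>\<psi>\<close> against the resolvent gives the Newton interpolant, evaluated at the matrix.
  Both sides satisfy the same recursion in \<open>as\<close>. This is the link between the contour integrals
  that define matrix functions and polynomials in the matrix.\<close>

lemma integral_functional_resolvent_poly:
  assumes \<gamma>: "\<gamma> C1_differentiable_on {0..1}" and "continuous_on (path_image \<gamma>) \<psi>"
    and "set as \<inter> path_image \<gamma> = {}" and "poly_functional L"
  shows "((\<lambda>z. \<psi> z * L (resolvent_poly as z)) has_contour_integral
    (2 * pi * \<i> * L (newton_interpolant \<gamma> as \<psi>))) \<gamma>"
  using assms(2-)
proof (induction as arbitrary: \<psi> L)
  case Nil
  have "L 0 = 0" using Nil(3) unfolding poly_functional_def by (metis mult_zero_left Polynomial.smult_0_left)
  then show ?case by (simp add: has_contour_integral_0)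
next
  case (Cons a as)
  note L = Cons.prems(3)
  have a: "a \<notin> path_image \<gamma>" and as: "set as \<inter> path_image \<gamma> = {}" using Cons.prems by auto
  have c: "continuous_on (path_image \<gamma>) (\<lambda>z. \<psi> z / (z - a))"
    by (intro continuous_intros Cons.prems) (use a in auto)
  have eq: "\<psi> z * L (resolvent_poly (a # as) z)
      = L 1 * (\<psi> z / (z - a)) + \<psi> z / (z - a) * L ([:- a, 1:] * resolvent_poly as z)" for z
  proof -
    have "L (resolvent_poly (a # as) z) = 1 / (z - a) * (L 1 + L ([:- a, 1:] * resolvent_poly as z))"
      using L unfolding poly_functional_def resolvent_poly.simps by metis
    then show ?thesis by (simp add: algebra_simps add_divide_distrib)
  qed
  have "L (newton_interpolant \<gamma> (a # as) \<psi>)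
      = cauchy_transform \<gamma> \<psi> a * L 1 + L ([:- a, 1:] * newton_interpolant \<gamma> as (\<lambda>z. \<psi> z / (z - a)))"
  proof -
    have "[:cauchy_transform \<gamma> \<psi> a:] = Polynomial.smult (cauchy_transform \<gamma> \<psi> a) 1" by simp
    then show ?thesis using L unfolding poly_functional_def newton_interpolant.simps by metis
  qed
  then have v: "2 * pi * \<i> * L (newton_interpolant \<gamma> (a # as) \<psi>)
      = L 1 * contour_integral \<gamma> (\<lambda>z. \<psi> z / (z - a))
        + 2 * pi * \<i> * L ([:- a, 1:] * newton_interpolant \<gamma> as (\<lambda>z. \<psi> z / (z - a)))"
    by (simp add: cauchy_transform_def algebra_simps)
  show ?case unfolding eq v
    by (intro has_contour_integral_add has_contour_integral_lmul has_contour_integral_integral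
        C1_contour_integrable[OF \<gamma> c] Cons.IH c as poly_functional_shift L)
qed

text \<open>Continuity of the cofactor \<open>r\<close> is what accounts for multiple zeros: after cancelling one factor
  \<open>z - a\<close> the identity extends to \<open>a\<close> by a limit.\<close>

lemma roots_poly_dvd_of_factor:
  assumes "open U" "set as \<subseteq> U" "continuous_on U r" "\<And>z. z \<in> U \<Longrightarrow> poly p z = poly (roots_poly as) z * r z"
  shows "roots_poly as dvd p"
  using assms(2-)
proof (induction as arbitrary: p)
  case (Cons a as)
  have a: "a \<in> U" using Cons.prems by auto
  then have "poly p a = 0" using Cons.prems(3)[of a] by simp
  then obtain p' where p': "p = [:- a, 1:] * p'" by (auto simp: poly_eq_0_iff_dvd elim: dvdE)
  have ne: "poly p' z = poly (roots_poly as) z * r z" if "z \<in> U" "z \<noteq> a" for z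
  proof -
    have "(z - a) * poly p' z = (z - a) * (poly (roots_poly as) z * r z)"
      using Cons.prems(3)[OF that(1)] by (simp add: p' algebra_simps)
    then show ?thesis using that(2) by simp
  qed
  have "poly p' a = poly (roots_poly as) a * r a"
  proof (rule LIM_unique)
    show "(poly p' \<longlongrightarrow> poly p' a) (at a)" by (simp add: isCont_def[symmetric])
    have "isCont (\<lambda>z. poly (roots_poly as) z * r z) a"
      using Cons.prems(2) a \<open>open U\<close> by (intro continuous_intros) (simp add: continuous_on_eq_continuous_at)
    then have lim: "((\<lambda>z. poly (roots_poly as) z * r z) \<longlongrightarrow> poly (roots_poly as) a * r a) (at a)" by (simp add: isCont_def)
    have "\<forall>\<^sub>F z in at a. poly (roots_poly as) z * r z = poly p' z"
      unfolding eventually_at_topological using \<open>open U\<close> a ne by (intro exI[of _ U]) auto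
    with lim show "(poly p' \<longlongrightarrow> poly (roots_poly as) a * r a) (at a)" by (rule Lim_transform_eventually)
  qed
  with ne have "\<And>z. z \<in> U \<Longrightarrow> poly p' z = poly (roots_poly as) z * r z" by (case_tac "z = a") auto
  then have "roots_poly as dvd p'" using Cons by auto
  then show ?case unfolding p' roots_poly_simps by (rule mult_dvd_mono[OF dvd_refl])
qed simp

text \<open>Cauchy transforms are taken along \<open>C\<^sup>1\<close> curves, whereas a contour for a matrix function is only
  piecewise \<open>C\<^sup>1\<close>. A polynomial loop close to the contour has the same integrals of functions that
  are holomorphic near it.\<close>

lemma C1_approximating_loop:
  assumes T: "open T" and \<gamma>: "valid_path \<gamma>" "path_image \<gamma> \<subseteq> T" "pathfinish \<gamma> = pathstart \<gamma>"
  obtains p where "p C1_differentiable_on {0..1}" "path_image p \<subseteq> T" "pathfinish p = pathstart p"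
    "\<And>F. F holomorphic_on T \<Longrightarrow> contour_integral p F = contour_integral \<gamma> F"
proof -
  have path: "path \<gamma>" using \<gamma> by (blast intro: valid_path_imp_path)
  obtain d where "d>0"
    and d: "\<And>g h. \<lbrakk>valid_path g; valid_path h; \<forall>t\<in>{0..1}. cmod (g t - \<gamma> t) < d \<and> cmod (h t - \<gamma> t) < d;
                     pathstart h = pathstart g \<and> pathfinish h = pathfinish g\<rbrakk>
                     \<Longrightarrow> path_image h \<subseteq> T \<and> (\<forall>f. f holomorphic_on T \<longrightarrow> contour_integral h f = contour_integral g f)"
    using contour_integral_nearby_ends [OF T path \<gamma>(2)] by metis
  obtain p where polyp: "polynomial_function p"
    and ps: "pathstart p = pathstart \<gamma>" and pf: "pathfinish p = pathfinish \<gamma>" and led: "\<forall>t\<in>{0..1}. cmod (p t - \<gamma> t) < d"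
    using path_approx_polynomial_function [OF path \<open>d > 0\<close>] by metis
  have vp: "valid_path p" using polyp valid_path_polynomial_function by blast
  have C1: "p C1_differentiable_on {0..1}"
    using has_vector_derivative_polynomial_function[OF polyp] unfolding C1_differentiable_on_def
    by (metis continuous_on_polymonial_function)
  show ?thesis
    using that[OF C1] d[OF \<gamma>(1) vp] led ps pf \<gamma>(3) \<open>d > 0\<close> by auto
qed

section \<open>Smooth convex curves\<close>

lemma periodic_integral:
  fixes F :: "real \<Rightarrow> 'a::euclidean_space"
  assumes cont: "\<And>A. continuous_on A F" and per: "\<And>t. F (t + 1) = F t" and s: "s \<in> {0..1}"
  shows "integral {s..s+1} F = integral {0..1} F"
proof -
  have int: "F integrable_on {a..b}" for a b by (rule integrable_continuous_real[OF cont])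
  have "integral {1..s+1} F = integral {0..s} F"
    using integral_shift_Icc_real[of 0 s F 1] per by (simp add: o_def add.commute)
  then show ?thesis
    using Henstock_Kurzweil_Integration.integral_combine[OF _ _ int, of s 1 "s + 1"] Henstock_Kurzweil_Integration.integral_combine[OF _ _ int, of 0 s 1] s
    by (simp add: add.commute)
qed

text \<open>If the argument of \<open>w\<close> deviated further from 0, then \<open>Re w = \<bar>w\<bar> cos (arg w)\<close> would be below \<open>- \<delta>
  sin \<eta>\<close>.\<close>

lemma abs_Im_Ln_bound:
  assumes "cmod w \<ge> \<delta>" "Re w \<ge> - \<delta> * sin \<eta>" "0 < \<delta>" "0 < \<eta>" "\<eta> < pi/2"
  shows "\<bar>Im (Ln w)\<bar> \<le> pi/2 + \<eta>"
proof (rule ccontr)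
  assume n: "\<not> ?thesis"
  have w0: "w \<noteq> 0" using assms by auto
  have b: "\<bar>Im (Ln w)\<bar> \<le> pi" using mpi_less_Im_Ln[OF w0] Im_Ln_le_pi[OF w0] by auto
  have "cos (Im (Ln w)) = cos \<bar>Im (Ln w)\<bar>" by simp
  also have "\<dots> < cos (pi/2 + \<eta>)" using n b assms by (intro cos_monotone_0_pi) auto
  also have "\<dots> = - sin \<eta>" by (simp add: cos_add)
  finally have c: "cos (Im (Ln w)) < - sin \<eta>" .
  have "w = exp (Ln w)" using w0 by simp
  then have "Re w = cmod w * cos (Im (Ln w))"
    by (metis Re_exp norm_exp_eq_Re)
  also have "\<dots> < cmod w * (- sin \<eta>)" using c w0 by (intro mult_strict_left_mono) auto
  also have "\<dots> \<le> - (\<delta> * sin \<eta>)"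
    using assms sin_gt_zero[of \<eta>] pi_gt_zero by (auto intro!: mult_right_mono)
  finally show False using assms(2) by simp
qed

text \<open>Smooth closed convex curves, parametrised by the direction of the outer normal: the normal at
  \<open>\<gamma>(t)\<close> is \<open>cis (2 \<pi> t)\<close> and \<open>\<rho>\<close> is a positive multiple of the radius of curvature. In this
  parametrisation convexity and simplicity follow from the sign of a sine.\<close>

locale convex_curve =
  fixes \<gamma> :: "real \<Rightarrow> complex" and \<rho> :: "real \<Rightarrow> real"
  assumes speed_cont: "continuous_on UNIV \<rho>"
    and speed_pos: "\<And>t. \<rho> t > 0"
    and curve_deriv: "\<And>t. (\<gamma> has_vector_derivative of_real (\<rho> t) * \<i> * cis (2 * pi * t)) (at t)"
    and periodic: "\<And>t. \<gamma> (t + 1) = \<gamma> t"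
begin

text \<open>The signed distance from \<open>z\<close> to the tangent at \<open>\<gamma>(t)\<close>, positive on the inner side. The enclosed
  region is the intersection of the inner half planes.\<close>

definition depth :: "real \<Rightarrow> complex \<Rightarrow> real" where
  "depth t z = Re (cnj (cis (2 * pi * t)) * (\<gamma> t - z))"

definition region :: "complex set" where "region = {z. \<forall>t. depth t z > 0}"

definition closed_region :: "complex set" where "closed_region = {z. \<forall>t. depth t z \<ge> 0}"

abbreviation velocity :: "real \<Rightarrow> complex" where
  "velocity t \<equiv> of_real (\<rho> t) * \<i> * cis (2 * pi * t)"

lemma curve_cont: "continuous_on A \<gamma>"
  by (meson continuous_at_imp_continuous_on curve_deriv has_vector_derivative_continuous)

lemma curve_vector_derivative: "vector_derivative \<gamma> (at t) = velocity t"
  using curve_deriv vector_derivative_at by blast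

lemma periodic_nat: "\<gamma> (t + of_nat n) = \<gamma> t"
proof (induction n)
  case (Suc n)
  have "\<gamma> (t + of_nat (Suc n)) = \<gamma> ((t + of_nat n) + 1)" by (simp add: add_ac)
  then show ?case using Suc periodic by simp
qed auto

lemma periodic_int: "\<gamma> (t + of_int k) = \<gamma> t"
proof (cases "k \<ge> 0")
  case True
  then show ?thesis using periodic_nat[of t "nat k"] by simp
next
  case False
  then show ?thesis using periodic_nat[of "t + of_int k" "nat (- k)"] by simp
qed

lemma speed_periodic: "\<rho> (t + 1) = \<rho> t"
proof -
  have "((\<lambda>x. \<gamma> (x + 1)) has_vector_derivative velocity (t + 1)) (at t)"
    using vector_diff_chain_at[of "\<lambda>x. x + 1" 1 t \<gamma> "velocity (t + 1)", OF _ curve_deriv]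
    by (simp add: o_def has_vector_derivative_add_const)
  then have "(\<gamma> has_vector_derivative velocity (t + 1)) (at t)"
    by (simp add: periodic)
  then have "velocity (t + 1) = velocity t"
    using curve_deriv[of t] vector_derivative_unique_at by blast
  moreover have "cis (2 * pi * (t + 1)) = cis (2 * pi * t)"
    by (simp add: distrib_left flip: cis_mult)
  ultimately show ?thesis by simp
qed

lemma cis_periodic: "cis (2 * pi * (t + of_int k)) = cis (2 * pi * t)"
  by (simp add: distrib_left cis_multiple_2pi flip: cis_mult)

lemma depth_periodic: "depth (t + of_int k) z = depth t z"
  by (simp only: depth_def periodic_int cis_periodic)

lemma reduce_01: fixes t :: real obtains k :: int where "t + of_int k \<in> {0..<1}"
proof
  show "t + of_int (- \<lfloor>t\<rfloor>) \<in> {0..<1}" by (auto; linarith)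
qed

text \<open>Along the curve the distance to the tangent at \<open>\<gamma>(s)\<close> has derivative \<open>\<rho>(t) sin (2 \<pi> (t - s))\<close>. It
  therefore increases from 0 for half a period and decreases back to 0.\<close>

lemma below_tangent:
  assumes "s < t" "t < s + 1"
  shows "depth s (\<gamma> t) > 0"
proof -
  define \<phi> where "\<phi> t = depth s (\<gamma> t)" for t
  have der: "(\<phi> has_real_derivative (\<rho> t * sin (2 * pi * (t - s)))) (at t)" for t
  proof -
    have "((\<lambda>t. cnj (cis (2 * pi * s)) * (\<gamma> s - \<gamma> t)) has_vector_derivative
        cnj (cis (2 * pi * s)) * (0 - velocity t)) (at t)"
      by (intro derivative_intros curve_deriv)
    from bounded_linear.has_vector_derivative[OF bounded_linear_Re this]
    have "((\<lambda>t. Re (cnj (cis (2 * pi * s)) * (\<gamma> s - \<gamma> t))) has_real_derivative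
        Re (cnj (cis (2 * pi * s)) * (0 - velocity t))) (at t)"
      by (simp add: has_real_derivative_iff_has_vector_derivative)
    moreover have "Re (cnj (cis (2 * pi * s)) * (0 - velocity t)) = \<rho> t * sin (2 * pi * (t - s))"
      by (simp add: sin_diff algebra_simps)
    ultimately show ?thesis unfolding \<phi>_def depth_def by simp
  qed
  have sinpos: "sin (2 * pi * (x - s)) > 0" if "s < x" "x < s + 1/2" for x
  proof (rule sin_gt_zero)
    show "0 < 2 * pi * (x - s)" using that by simp
    show "2 * pi * (x - s) < pi" using mult_strict_left_mono[of "2 * (x - s)" 1 pi] that by (simp add: algebra_simps)
  qed
  have sinneg: "sin (2 * pi * (x - s)) < 0" if "s + 1/2 < x" "x < s + 1" for x
  proof (rule sin_lt_zero)
    show "pi < 2 * pi * (x - s)" using mult_strict_left_mono[of 1 "2 * (x - s)" pi] that by (simp add: algebra_simps)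
    show "2 * pi * (x - s) < 2 * pi" using that by simp
  qed
  have cont: "continuous_on A \<phi>" for A
    using der DERIV_isCont continuous_at_imp_continuous_on by blast
  have "\<phi> s = 0" by (simp add: \<phi>_def depth_def)
  moreover have "\<phi> (s + 1) = 0" by (simp add: \<phi>_def depth_def periodic)
  moreover have "\<phi> s < \<phi> t" if "t \<le> s + 1/2"
    by (rule DERIV_pos_imp_increasing_open[OF \<open>s < t\<close> _ cont])
      (use der sinpos speed_pos that in \<open>force intro!: exI mult_pos_pos\<close>)
  moreover have "\<phi> t > \<phi> (s + 1)" if "t \<ge> s + 1/2"
    by (rule DERIV_neg_imp_decreasing_open[OF \<open>t < s + 1\<close> _ cont])
      (use der sinneg speed_pos that in \<open>force intro!: exI mult_pos_neg\<close>)
  ultimately show ?thesis unfolding \<phi>_def by linarith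
qed

lemma curve_in_closed_region: "\<gamma> t \<in> closed_region"
  unfolding closed_region_def
proof safe
  fix s
  \<comment> \<open>Shift the parameter into the period that starts at \<open>s\<close>.\<close>
  define k :: int where "k = - \<lfloor>t - s\<rfloor>"
  have k: "t + of_int k - s \<in> {0..<1}" unfolding k_def by (auto; linarith)
  have "depth s (\<gamma> (t + of_int k)) \<ge> 0"
  proof (cases "t + of_int k = s")
    case True
    then show ?thesis by (simp add: depth_def)
  next
    case False
    then show ?thesis using below_tangent[of s "t + of_int k"] k by auto
  qed
  then show "depth s (\<gamma> t) \<ge> 0" by (simp add: periodic_int)
qed

lemma region_avoids_curve: "z \<in> region \<Longrightarrow> \<gamma> t \<noteq> z"
  unfolding region_def depth_def by (auto dest: spec[of _ t])

lemma region_subset_closed_region: "region \<subseteq> closed_region"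
  unfolding region_def closed_region_def by (auto intro: less_imp_le)

lemma depth_halfspace: "{z. depth t z \<ge> c} = {z. inner (cis (2 * pi * t)) z \<le> inner (cis (2 * pi * t)) (\<gamma> t) - c}"
  by (auto simp: depth_def inner_complex_def algebra_simps)

lemma parallel_set_Inter: "{z. \<forall>t. depth t z \<ge> c} = (\<Inter>t. {z. depth t z \<ge> c})"
  by auto

lemma convex_parallel_set: "convex {z. \<forall>t. depth t z \<ge> c}" and closed_parallel_set: "closed {z. \<forall>t. depth t z \<ge> c}"
  unfolding parallel_set_Inter depth_halfspace
  by (auto intro!: convex_INT convex_halfspace_le closed_INT closed_halfspace_le)

lemma convex_closed_region: "convex closed_region" and closed_closed_region: "closed closed_region"
  using convex_parallel_set[of 0] closed_parallel_set[of 0] unfolding closed_region_def by auto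

lemma depth_cont: "continuous_on A (\<lambda>(t, z). depth t z)"
  unfolding depth_def case_prod_unfold cis_conv_exp
  by (intro continuous_intros continuous_on_compose2[OF curve_cont[of UNIV]]) auto

lemma simple_loop: "simple_path \<gamma>" "pathfinish \<gamma> = pathstart \<gamma>"
proof -
  show *: "pathfinish \<gamma> = pathstart \<gamma>"
    using periodic[of 0] by (simp add: pathfinish_def pathstart_def)
  have "\<gamma> x \<noteq> \<gamma> y" if "x < y" "y < x + 1" for x y
    using below_tangent[OF that] by (auto simp: depth_def)
  then have "\<gamma> x = \<gamma> y \<Longrightarrow> x = y \<or> x = 0 \<and> y = 1 \<or> x = 1 \<and> y = 0"
    if "x \<in> {0..1}" "y \<in> {0..1}" for x y
    using that by (smt (verit, best) atLeastAtMost_iff)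
  then show "simple_path \<gamma>"
    unfolding simple_path_def loop_free_def path_def using curve_cont by blast
qed

lemma velocity_cont: "continuous_on A velocity"
  unfolding cis_conv_exp
  by (intro continuous_intros continuous_on_subset[OF speed_cont]) auto

lemma valid_path_curve: "valid_path \<gamma>"
  unfolding valid_path_def
  by (rule C1_differentiable_imp_piecewise)
    (use curve_deriv velocity_cont in \<open>auto simp: C1_differentiable_on_def intro!: exI[of _ velocity]\<close>)

text \<open>Seen from a point of the region the curve always turns counterclockwise, because the angular
  speed is a positive multiple of the depth; a simple loop with positive winding number winds
  exactly once.\<close>

lemma winding_region:
  assumes z: "z \<in> region" shows "winding_number \<gamma> z = 1"
proof (rule simple_closed_path_winding_number_pos[OF simple_loop])
  show nz: "z \<notin> path_image \<gamma>" using region_avoids_curve[OF z] by (auto simp: path_image_def)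
  have *: "Im (velocity t * cnj (\<gamma> t - z)) = \<rho> t * depth t z" for t
    by (simp add: depth_def algebra_simps)
  have "continuous_on {0..1} (\<lambda>t. \<rho> t * depth t z)"
    by (intro continuous_intros continuous_on_subset[OF speed_cont]
        continuous_on_compose2[OF depth_cont[of UNIV], where f = "\<lambda>t. (t, z)", simplified]) auto
  then obtain t0 where t0: "\<forall>t\<in>{0..1}. \<rho> t0 * depth t0 z \<le> \<rho> t * depth t z"
    using continuous_attains_inf[of "{0..1::real}" "\<lambda>t. \<rho> t * depth t z"] by auto
  have "\<rho> t0 * depth t0 z > 0" using z speed_pos by (auto simp: region_def)
  then show "Re (winding_number \<gamma> z) > 0"
    using winding_number_pos_lt[OF valid_path_curve nz] t0 * by (auto simp: curve_vector_derivative)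
qed

lemma path_image_closed_region: "path_image \<gamma> \<subseteq> closed_region"
  using curve_in_closed_region by (auto simp: path_image_def)

lemma winding_outside_closed_region:
  assumes "z \<notin> closed_region" shows "winding_number \<gamma> z = 0"
  by (rule winding_number_zero_outside[OF simple_path_imp_path[OF simple_loop(1)] convex_closed_region simple_loop(2) assms path_image_closed_region])

lemma region_subset_inside: "region \<subseteq> inside (path_image \<gamma>)"
proof
  fix z assume z: "z \<in> region"
  have "z \<notin> path_image \<gamma>" using region_avoids_curve[OF z] by (auto simp: path_image_def)
  moreover have "z \<notin> outside (path_image \<gamma>)"
    using winding_number_zero_in_outside[of \<gamma> z] winding_region[OF z] simple_loop simple_path_imp_path by force
  ultimately show "z \<in> inside (path_image \<gamma>)" by (simp add: inside_outside)
qed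

lemma inside_subset_closed_region: "inside (path_image \<gamma>) \<subseteq> closed_region"
  using outside_subset_convex[OF convex_closed_region path_image_closed_region] inside_Int_outside by blast

lemma closure_inside_subset_closed_region: "closure (inside (path_image \<gamma>)) \<subseteq> closed_region"
  by (simp add: closed_closed_region closure_minimal inside_subset_closed_region)

lemma compact_closed_region: "compact closed_region"
proof -
  have "closed_region \<subseteq> {z. \<bar>Re z\<bar> \<le> \<bar>Re (\<gamma> 0)\<bar> + \<bar>Re (\<gamma> (1/2))\<bar> \<and> \<bar>Im z\<bar> \<le> \<bar>Im (\<gamma> (1/4))\<bar> + \<bar>Im (\<gamma> (3/4))\<bar>}"
  proof safe
    fix z assume "z \<in> closed_region"
    then have d: "depth t z \<ge> 0" for t by (simp add: closed_region_def)
    have s: "cos (3 * pi / 2) = 0" "sin (3 * pi / 2) = -1"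
      using sin_add[of pi "pi/2"] cos_add[of pi "pi/2"] by (auto simp: field_simps)
    show "\<bar>Re z\<bar> \<le> \<bar>Re (\<gamma> 0)\<bar> + \<bar>Re (\<gamma> (1/2))\<bar>" using d[of 0] d[of "1/2"] by (simp add: depth_def)
    show "\<bar>Im z\<bar> \<le> \<bar>Im (\<gamma> (1/4))\<bar> + \<bar>Im (\<gamma> (3/4))\<bar>"
      using d[of "1/4"] d[of "3/4"] s by (simp add: depth_def)
  qed
  then have "bounded closed_region"
    by (auto intro!: boundedI[of _ "\<bar>Re (\<gamma> 0)\<bar> + \<bar>Re (\<gamma> (1/2))\<bar> + (\<bar>Im (\<gamma> (1/4))\<bar> + \<bar>Im (\<gamma> (3/4))\<bar>)"]
        order_trans[OF cmod_le])
  then show ?thesis using closed_closed_region compact_eq_bounded_closed by blast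
qed

lemma minimal_depth_attained:
  obtains t where "\<And>s. depth s z \<ge> depth t z"
proof -
  have "continuous_on {0..1} (\<lambda>t. depth t z)"
    by (rule continuous_on_compose2[OF depth_cont[of UNIV], where f = "\<lambda>t. (t, z)", simplified])
       (auto intro!: continuous_intros)
  then obtain t0 where t0: "\<forall>t\<in>{0..1}. depth t0 z \<le> depth t z"
    using continuous_attains_inf[of "{0..1::real}" "\<lambda>t. depth t z"] by auto
  have "depth t0 z \<le> depth t z" for t
  proof -
    obtain k :: int where "t + of_int k \<in> {0..<1}" by (rule reduce_01)
    then show ?thesis using bspec[OF t0, of "t + of_int k"] by (simp add: depth_periodic)
  qed
  then show ?thesis using that by blast
qed

text \<open>By periodicity the parameter may be confined to a compact interval, and then the condition
  fails on a closed set.\<close>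

lemma open_parallel_set: "open {z. \<forall>t. depth t z > c}"
proof -
  have "{z. \<forall>t. depth t z > c} = {z. \<forall>t\<in>{0..1}. depth t z > c}"
  proof safe
    fix z and t :: real assume *: "\<forall>t\<in>{0..1}. depth t z > c"
    obtain k :: int where "t + of_int k \<in> {0..<1}" by (rule reduce_01)
    then show "depth t z > c" using bspec[OF *, of "t + of_int k"] by (simp add: depth_periodic)
  qed auto
  moreover have "open {z. \<forall>t\<in>{0..1}. depth t z > c}"
  proof -
    have "closed {p. (\<lambda>(t, z). depth t z) p \<le> c}"
      by (intro closed_Collect_le depth_cont continuous_on_const)
    then have "closed {z. \<exists>t. t \<in> {0..1} \<and> (t, z) \<in> {p. (\<lambda>(t, z). depth t z) p \<le> c}}"
      by (intro closed_compact_projection) auto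
    moreover have "{z. \<exists>t. t \<in> {0..1} \<and> (t, z) \<in> {p. (\<lambda>(t, z). depth t z) p \<le> c}} = - {z. \<forall>t\<in>{0..1}. depth t z > c}"
      by (force simp: not_less)
    ultimately show ?thesis by (simp add: closed_def)
  qed
  ultimately show ?thesis by simp
qed

text \<open>The density of the double layer potential, which is \<open>1/\<pi>\<close> times the angular speed of \<open>\<gamma>(t)\<close> seen
  from \<open>z\<close>. It is nonnegative inside a convex curve.\<close>

definition kernel :: "complex \<Rightarrow> real \<Rightarrow> real" where
  "kernel z t = \<rho> t / pi * Re (cis (2 * pi * t) / (\<gamma> t - z))"

lemma contour_integral_curve:
  "contour_integral \<gamma> F = integral {0..1} (\<lambda>t. F (\<gamma> t) * velocity t)"
  by (simp add: contour_integral_integral curve_vector_derivative)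

lemma C1_curve: "\<gamma> C1_differentiable_on {0..1}"
  using curve_deriv velocity_cont by (auto simp: C1_differentiable_on_def intro!: exI[of _ velocity])

lemma integrable_curve:
  assumes "continuous_on (path_image \<gamma>) F"
  shows "(\<lambda>t. F (\<gamma> t) * velocity t) integrable_on {0..1}" "F contour_integrable_on \<gamma>"
proof -
  show "F contour_integrable_on \<gamma>" by (rule C1_contour_integrable[OF C1_curve assms])
  then show "(\<lambda>t. F (\<gamma> t) * velocity t) integrable_on {0..1}"
    by (simp add: contour_integrable_on curve_vector_derivative)
qed

lemma path_image_not_region: "region \<subseteq> - path_image \<gamma>"
  using region_avoids_curve by (auto simp: path_image_def)

lemma cauchy_transform_holomorphic_on_region:
  assumes "continuous_on (path_image \<gamma>) \<psi>"
  shows "cauchy_transform \<gamma> \<psi> holomorphic_on region"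
  using cauchy_transform_holomorphic[OF C1_curve assms] path_image_not_region holomorphic_on_subset by blast

lemma cauchy_formula:
  assumes "open U" "f holomorphic_on U" "closed_region \<subseteq> U" "z \<in> region"
  shows "cauchy_transform \<gamma> f z = f z"
proof -
  have "((\<lambda>w. f w / (w - z)) has_contour_integral (2 * pi * \<i> * winding_number \<gamma> z * f z)) \<gamma>"
    using assms path_image_not_region path_image_closed_region region_subset_closed_region
    by (intro Cauchy_integral_formula_global[OF assms(1,2) _ valid_path_curve _ simple_loop(2)]
        winding_outside_closed_region) auto
  then have "contour_integral \<gamma> (\<lambda>w. f w / (w - z)) = 2 * pi * \<i> * f z"
    using winding_region[OF assms(4)] contour_integral_unique by fastforce
  then show ?thesis unfolding cauchy_transform_def by simp
qed

lemma kernel_alt: "kernel z t = \<rho> t / pi * (depth t z / (cmod (\<gamma> t - z))\<^sup>2)"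
  unfolding kernel_def depth_def
  by (auto simp: complex_div_cnj[of "cis _"] Re_divide_of_real[of _ "(cmod _)\<^sup>2", simplified] algebra_simps)

lemma kernel_nonneg: "z \<in> region \<Longrightarrow> kernel z t \<ge> 0"
  unfolding kernel_alt using speed_pos[of t] by (simp add: region_def less_imp_le)

lemma kernel_Im: "kernel z t = Im (velocity t / (\<gamma> t - z)) / pi"
proof -
  have "velocity t / (\<gamma> t - z) = \<i> * (of_real (\<rho> t) * (cis (2 * pi * t) / (\<gamma> t - z)))" by simp
  moreover have "Im (\<i> * (of_real r * w)) = r * Re w" for r w by simp
  ultimately have "Im (velocity t / (\<gamma> t - z)) = \<rho> t * Re (cis (2 * pi * t) / (\<gamma> t - z))"
    by (simp only:)
  then show ?thesis unfolding kernel_def by simp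
qed

lemma kernel_cont: "z \<in> region \<Longrightarrow> continuous_on A (kernel z)"
  unfolding kernel_def cis_conv_exp using region_avoids_curve
  by (intro continuous_intros continuous_on_subset[OF speed_cont] curve_cont) auto

text \<open>The kernel is twice the real part of the Cauchy kernel with respect to the parameter.
  Integrating \<open>\<psi>\<close> against the two conjugate halves gives the transform of \<open>\<psi>\<close> and the conjugate of
  the transform of its conjugate.\<close>

lemma kernel_representation:
  assumes "continuous_on (path_image \<gamma>) \<psi>" "z \<in> region"
  shows "((\<lambda>t. \<psi> (\<gamma> t) * of_real (kernel z t)) has_integral
    (cauchy_transform \<gamma> \<psi> z + cnj (cauchy_transform \<gamma> (\<lambda>w. cnj (\<psi> w)) z))) {0..1}"
proof -
  have c: "continuous_on (path_image \<gamma>) (\<lambda>w. \<phi> w / (w - z))" if "continuous_on (path_image \<gamma>) \<phi>" for \<phi>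
    using path_image_not_region assms(2) by (intro continuous_intros that) auto
  have 1: "((\<lambda>t. \<phi> (\<gamma> t) / (\<gamma> t - z) * velocity t) has_integral
      contour_integral \<gamma> (\<lambda>w. \<phi> w / (w - z))) {0..1}" if "continuous_on (path_image \<gamma>) \<phi>" for \<phi>
    unfolding contour_integral_curve by (intro integrable_integral integrable_curve c that)
  have 2: "((\<lambda>t. 1 / (2 * pi * \<i>) * (\<phi> (\<gamma> t) / (\<gamma> t - z) * velocity t)) has_integral
      cauchy_transform \<gamma> \<phi> z) {0..1}" if "continuous_on (path_image \<gamma>) \<phi>" for \<phi>
    unfolding cauchy_transform_def by (intro has_integral_mult_right 1 that)
  have 3: "((\<lambda>t. cnj (1 / (2 * pi * \<i>) * (cnj (\<psi> (\<gamma> t)) / (\<gamma> t - z) * velocity t))) has_integral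
      cnj (cauchy_transform \<gamma> (\<lambda>w. cnj (\<psi> w)) z)) {0..1}"
    using has_integral_linear[OF 2 bounded_linear_cnj, of "\<lambda>w. cnj (\<psi> w)"] assms(1)
    by (simp add: o_def continuous_on_cnj)
  have "1 / (2 * pi * \<i>) * (\<psi> (\<gamma> t) / (\<gamma> t - z) * velocity t)
      + cnj (1 / (2 * pi * \<i>) * (cnj (\<psi> (\<gamma> t)) / (\<gamma> t - z) * velocity t))
      = \<psi> (\<gamma> t) * of_real (kernel z t)" (is "?L = ?R") for t
  proof -
    define q where "q = cis (2 * pi * t) / (\<gamma> t - z)"
    have q: "1 / (2 * pi * \<i>) * (p / (\<gamma> t - z) * velocity t) = p * (complex_of_real (\<rho> t) / complex_of_real (2 * pi)) * q" for p :: complex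
    proof -
      have "1 / (2 * pi * \<i>) * (p / d * (r * \<i> * c)) = p * (r / (2 * pi)) * (c / d)" for p r c d :: complex
        by (cases "d = 0") (simp_all add: field_simps)
      then show ?thesis unfolding q_def by blast
    qed
    have "?L = \<psi> (\<gamma> t) * (complex_of_real (\<rho> t) / complex_of_real (2 * pi)) * (q + cnj q)"
      unfolding q by (simp add: algebra_simps add_divide_distrib)
    also have "\<dots> = ?R" unfolding kernel_def q_def[symmetric] complex_add_cnj by simp
    finally show ?thesis .
  qed
  then show ?thesis using has_integral_add[OF 2[OF assms(1)] 3] by simp
qed

lemma kernel_mass:
  assumes "z \<in> region" shows "(kernel z has_integral 2) {0..1}"
proof -
  have "((\<lambda>t. of_real (kernel z t)) has_integral (2 :: complex)) {0..1}"
    using kernel_representation[of "\<lambda>_. 1", OF _ assms] cauchy_formula[of UNIV "\<lambda>_. 1" z] assms by simp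
  from has_integral_linear[OF this bounded_linear_Re] show ?thesis by (simp add: o_def)
qed

section \<open>The Cauchy transform of a conjugate\<close>

text \<open>For \<open>z\<close> just inside the boundary point \<open>\<gamma>(s)\<close>, the curve lies essentially in a half plane as seen
  from \<open>z\<close>, apart from an arc close to \<open>\<gamma>(s)\<close>. The remaining arc is seen under an angle of little
  more than \<open>\<pi>\<close>, so it carries at most about half of the total mass 2 of the kernel.\<close>

lemma far_mass:
  assumes z: "z \<in> region" and zs: "z = \<gamma> s - of_real d * cis (2 * pi * s)" and d: "0 < d" "d \<le> \<delta> * sin \<eta>"
    and \<eta>: "0 < \<eta>" "\<eta> < pi/2" and \<delta>: "0 < \<delta>" and ab: "a \<le> b"
    and far: "\<And>t. t \<in> {a..b} \<Longrightarrow> cmod (\<gamma> t - z) \<ge> \<delta>"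
  shows "integral {a..b} (kernel z) \<le> 1 + \<eta>"
proof -
  \<comment> \<open>Turn the picture so that the inner normal at \<open>\<gamma>(s)\<close> points along the positive real axis. Then
    the kernel is the derivative of \<open>Im (Ln w) / \<pi>\<close>.\<close>
  define w where "w t = - cnj (cis (2 * pi * s)) * (\<gamma> t - z)" for t
  have Re_w: "Re (w t) \<ge> - \<delta> * sin \<eta>" for t
  proof -
    have "depth s (\<gamma> t) \<ge> 0" using curve_in_closed_region by (auto simp: closed_region_def)
    moreover have "w t = cnj (cis (2 * pi * s)) * (\<gamma> s - \<gamma> t) - of_real d * (cis (2 * pi * s) * cnj (cis (2 * pi * s)))"
      unfolding w_def zs by (simp add: algebra_simps)
    ultimately have "Re (w t) \<ge> - d" by (simp add: depth_def cis_cnj cis_mult)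
    then show ?thesis using d by simp
  qed
  have norm_w: "cmod (w t) \<ge> \<delta>" if "t \<in> {a..b}" for t
    using far[OF that] by (simp add: w_def norm_mult)
  have slit: "w t \<notin> \<real>\<^sub>\<le>\<^sub>0" if "t \<in> {a..b}" for t
  proof
    assume *: "w t \<in> \<real>\<^sub>\<le>\<^sub>0"
    then have "cmod (w t) = - Re (w t)" by (auto simp: complex_nonpos_Reals_iff cmod_eq_Re)
    then have "\<delta> \<le> \<delta> * sin \<eta>" using norm_w[OF that] Re_w[of t] by simp
    then have "sin \<eta> \<ge> 1" using \<delta> by simp
    moreover have "sin \<eta> < sin (pi/2)" using \<eta> by (intro sin_monotone_2pi) auto
    ultimately show False by simp
  qed
  have der: "((\<lambda>t. Im (Ln (w t)) / pi) has_vector_derivative kernel z t) (at t within {a..b})" if "t \<in> {a..b}" for t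
  proof -
    have e0: "cnj (cis (2 * pi * s)) \<noteq> 0" by simp
    have "(w has_vector_derivative (- cnj (cis (2 * pi * s)) * (velocity t - 0))) (at t)"
      unfolding w_def by (intro derivative_intros curve_deriv)
    from field_vector_diff_chain_at[OF this has_field_derivative_Ln[OF slit[OF that]]]
    have "((\<lambda>t. Ln (w t)) has_vector_derivative (- cnj (cis (2 * pi * s)) * velocity t * inverse (w t))) (at t)"
      by (simp add: o_def)
    moreover have "- cnj (cis (2 * pi * s)) * velocity t * inverse (w t) = velocity t / (\<gamma> t - z)"
    proof -
      have "- e * v * inverse (- e * x) = v / x" if "e \<noteq> 0" for e v x :: complex
        using that by (simp add: field_simps)
      then show ?thesis unfolding w_def using e0 by blast
    qed
    ultimately have "((\<lambda>t. Ln (w t)) has_vector_derivative (velocity t / (\<gamma> t - z))) (at t)" by simp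
    from bounded_linear.has_vector_derivative[OF bounded_linear_Im this]
    have "((\<lambda>t. Im (Ln (w t))) has_vector_derivative (pi * kernel z t)) (at t)" unfolding kernel_Im by simp
    from has_vector_derivative_mult_right[OF this, of "1/pi"] show ?thesis
      by (simp add: has_vector_derivative_at_within)
  qed
  have "integral {a..b} (kernel z) = Im (Ln (w b)) / pi - Im (Ln (w a)) / pi"
    by (rule integral_unique[OF fundamental_theorem_of_calculus[OF ab der]])
  also have "\<dots> \<le> (pi/2 + \<eta>) / pi + (pi/2 + \<eta>) / pi"
  proof -
    have "\<bar>Im (Ln (w t))\<bar> \<le> pi/2 + \<eta>" if "t \<in> {a..b}" for t
      using abs_Im_Ln_bound[OF norm_w[OF that] Re_w \<delta> \<eta>] .
    from this[of a] this[of b] ab have "Im (Ln (w b)) \<le> pi/2 + \<eta>" "- Im (Ln (w a)) \<le> pi/2 + \<eta>" by auto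
    then have "Im (Ln (w b)) / pi \<le> (pi/2 + \<eta>) / pi" "(- Im (Ln (w a))) / pi \<le> (pi/2 + \<eta>) / pi"
      using pi_gt_zero by (intro divide_right_mono; simp)+
    then show ?thesis by (simp only: minus_divide_left[symmetric])
  qed
  also have "\<dots> \<le> 1 + \<eta>"
    using pi_gt3 \<eta> mult_left_mono[of 2 pi \<eta>] by (simp add: field_simps)
  finally show ?thesis .
qed

lemma kernel_periodic: "kernel z (t + 1) = kernel z t"
  using cis_periodic[of t 1] by (simp add: kernel_def periodic speed_periodic)

text \<open>Let \<open>c = f(z)\<close> and let \<open>\<theta>\<close> be the mass of the kernel on the arc far from \<open>\<gamma>(s)\<close>. On the
  complementary arc, of mass \<open>2 - \<theta>\<close>, the values of \<open>f\<close> are close to \<open>c\<close>. By \<open>kernel_representation\<close> and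
  Cauchy's formula the conjugate of the transform at \<open>z\<close> is the integral of \<open>f\<close> against the kernel
  minus \<open>c\<close>, hence close to \<open>(1 - \<theta>) c\<close> plus the far part, which is at most \<open>\<theta> M\<close>. As \<open>\<theta>\<close> hardly exceeds
  1, the sum \<open>\<bar>1 - \<theta>\<bar> M + \<theta> M\<close> hardly exceeds \<open>M\<close>.\<close>

lemma near_boundary_bound:
  assumes U: "open U" "f holomorphic_on U" "closed_region \<subseteq> U" and M: "\<And>z. z \<in> closed_region \<Longrightarrow> cmod (f z) \<le> M"
    and \<epsilon>: "\<epsilon> > 0"
  obtains d0 where "d0 > 0"
    "\<And>d s z. \<lbrakk>0 < d; d \<le> d0; z \<in> region; z = \<gamma> s - of_real d * cis (2 * pi * s)\<rbrakk>
      \<Longrightarrow> cmod (cauchy_transform \<gamma> (\<lambda>w. cnj (f w)) z) \<le> M + \<epsilon>"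
proof -
  have M0: "M \<ge> 0" using M[OF curve_in_closed_region[of 0]] norm_ge_zero order_trans by blast
  \<comment> \<open>The excess of the far mass over 1 costs at most \<open>2 \<eta> M\<close>, for which half of \<open>\<epsilon>\<close> is reserved.\<close>
  define \<eta> where "\<eta> = min 1 (\<epsilon> / (4 * (M + 1)))"
  have \<eta>: "0 < \<eta>" using \<epsilon> M0 by (auto simp: \<eta>_def)
  have "\<eta> \<le> 1" unfolding \<eta>_def by simp
  then have \<eta>: "0 < \<eta>" "\<eta> < pi/2" using \<eta> pi_gt3 by linarith+
  have M\<eta>: "M * (2 * \<eta>) \<le> \<epsilon> / 2"
  proof -
    have "\<eta> \<le> \<epsilon> / (4 * (M + 1))" by (simp add: \<eta>_def)
    then have "M * (2 * \<eta>) \<le> M * (2 * (\<epsilon> / (4 * (M + 1))))" using M0 by (intro mult_left_mono) auto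
    also have "\<dots> = \<epsilon> / 2 * (M / (M + 1))" using M0 by (simp add: field_simps)
    also have "\<dots> \<le> \<epsilon> / 2 * 1" using M0 \<epsilon> by (intro mult_left_mono) auto
    finally show ?thesis by simp
  qed
  have fcont: "continuous_on closed_region f"
    using U holomorphic_on_imp_continuous_on holomorphic_on_subset by blast
  obtain \<delta>1 where \<delta>1: "\<delta>1 > 0"
    "\<And>x y. x \<in> closed_region \<Longrightarrow> y \<in> closed_region \<Longrightarrow> dist x y < \<delta>1 \<Longrightarrow> dist (f x) (f y) < \<epsilon> / 4"
    using compact_uniformly_continuous[OF fcont compact_closed_region] \<epsilon>
    unfolding uniformly_continuous_on_def by (metis divide_pos_pos zero_less_numeral)
  \<comment> \<open>Parameters up to 2 occur because the period is taken to start at \<open>s\<close>.\<close>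
  obtain \<tau>0 where \<tau>0: "\<tau>0 > 0"
    "\<And>x y. x \<in> {0..2} \<Longrightarrow> y \<in> {0..2} \<Longrightarrow> dist x y < \<tau>0 \<Longrightarrow> dist (\<gamma> x) (\<gamma> y) < \<delta>1 / 2"
    using compact_uniformly_continuous[OF curve_cont[of "{0..2}"]] \<delta>1(1)
    unfolding uniformly_continuous_on_def by (metis compact_Icc half_gt_zero)
  define \<tau> where "\<tau> = min (1/4) (\<tau>0 / 2)"
  have \<tau>: "0 < \<tau>" "\<tau> < \<tau>0" "\<tau> \<le> 1/4" using \<tau>0(1) by (auto simp: \<tau>_def)
  \<comment> \<open>By compactness, points whose parameters differ by at least \<open>\<tau>\<close> modulo 1 have a distance
    bounded below by some \<open>2 \<delta>\<close>.\<close>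
  let ?P = "{0..1::real} \<times> {\<tau>..1-\<tau>}"
  have "continuous_on ?P (\<lambda>p. \<gamma> (fst p + snd p))" "continuous_on ?P (\<lambda>p. \<gamma> (fst p))"
    by (rule continuous_on_compose2[OF curve_cont[of UNIV]]; auto intro!: continuous_intros)+
  then have Pc: "continuous_on ?P (\<lambda>p. dist (\<gamma> (fst p + snd p)) (\<gamma> (fst p)))"
    by (rule continuous_on_dist)
  have P0: "?P \<noteq> {}" using \<tau> by auto
  obtain p where p: "p \<in> ?P"
    "\<forall>q\<in>?P. dist (\<gamma> (fst p + snd p)) (\<gamma> (fst p)) \<le> dist (\<gamma> (fst q + snd q)) (\<gamma> (fst q))"
    using continuous_attains_inf[OF compact_Times[OF compact_Icc compact_Icc] P0 Pc] by blast
  define \<delta> where "\<delta> = dist (\<gamma> (fst p + snd p)) (\<gamma> (fst p)) / 2"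
  have \<delta>: "\<delta> > 0"
  proof -
    have "depth (fst p) (\<gamma> (fst p + snd p)) > 0" using p(1) \<tau> by (intro below_tangent) auto
    then have "\<gamma> (fst p + snd p) \<noteq> \<gamma> (fst p)" by (auto simp: depth_def)
    then show ?thesis by (simp add: \<delta>_def)
  qed
  have far: "dist (\<gamma> t) (\<gamma> s) \<ge> 2 * \<delta>" if "s \<in> {0..1}" "t \<in> {s+\<tau>..s+1-\<tau>}" for s t
    using p(2)[rule_format, of "(s, t - s)"] that by (auto simp: \<delta>_def)
  \<comment> \<open>The first bound is the one in \<open>far_mass\<close>; by the second, \<open>z\<close> and the near arc are close enough
    for the uniform continuity of \<open>f\<close>.\<close>
  define d0 where "d0 = min (\<delta> * sin \<eta>) (\<delta>1 / 2)"
  have sin\<eta>: "0 < sin \<eta>" "sin \<eta> \<le> 1" using \<eta> sin_gt_zero by auto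
  have main: "cmod (cauchy_transform \<gamma> (\<lambda>w. cnj (f w)) z) \<le> M + \<epsilon>"
    if d: "0 < d" "d \<le> d0" and z: "z \<in> region" and zs: "z = \<gamma> s - of_real d * cis (2 * pi * s)" and s: "s \<in> {0..1}" for d s z
  proof -
    have dist_z: "dist (\<gamma> s) z = d" using d by (simp add: zs dist_norm norm_mult)
    have zc: "z \<in> closed_region" using z region_subset_closed_region by blast
    have d\<delta>: "d \<le> \<delta> * sin \<eta>" "d < \<delta>1" using d \<delta>1(1) by (auto simp: d0_def)
    have d\<delta>': "d \<le> \<delta>" using d\<delta>(1) mult_left_mono[OF sin\<eta>(2) less_imp_le[OF \<delta>]] by linarith
    define c where "c = f z"
    define F where "F t = f (\<gamma> t)" for t
    have Fc: "continuous_on A F" for A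
      unfolding F_def by (rule continuous_on_compose2[OF fcont curve_cont]) (use curve_in_closed_region in auto)
    have kc: "continuous_on A (kernel z)" for A by (rule kernel_cont[OF z])
    have FM: "cmod (F t) \<le> M" for t unfolding F_def by (rule M[OF curve_in_closed_region])
    have cM: "cmod c \<le> M" unfolding c_def by (rule M[OF zc])
    have near: "cmod (F t - c) \<le> \<epsilon> / 4" if "t \<in> {s..s+\<tau>} \<union> {s+1-\<tau>..s+1}" for t
    proof -
      have "dist (\<gamma> t) (\<gamma> s) < \<delta>1 / 2"
      proof (cases "t \<in> {s..s+\<tau>}")
        case True
        then show ?thesis using \<tau> s by (intro \<tau>0(2)) (auto simp: dist_real_def)
      next
        case False
        then have "dist (\<gamma> t) (\<gamma> (s + 1)) < \<delta>1 / 2" using that \<tau> s by (intro \<tau>0(2)) (auto simp: dist_real_def)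
        then show ?thesis by (simp add: periodic)
      qed
      then have "dist (\<gamma> t) z < \<delta>1"
        using dist_triangle[of "\<gamma> t" z "\<gamma> s"] dist_z d unfolding d0_def by auto
      then have "dist (F t) c < \<epsilon> / 4" unfolding F_def c_def by (intro \<delta>1(2) zc curve_in_closed_region)
      then show ?thesis by (simp add: dist_norm)
    qed
    let ?K = "\<lambda>t. of_real (kernel z t) :: complex"
    have Kc: "continuous_on A ?K" for A by (intro continuous_intros kc)
    let ?I1 = "{s..s+\<tau>}" let ?I2 = "{s+\<tau>..s+1-\<tau>}" let ?I3 = "{s+1-\<tau>..s+1}"
    have bl: "bounded_linear complex_of_real" by (rule bounded_linear_of_real)
    have split: "integral {s..s+1} h = integral ?I1 h + integral ?I2 h + integral ?I3 h"
      if "\<And>A. continuous_on A h" for h :: "real \<Rightarrow> 'a::euclidean_space"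
    proof -
      have "h integrable_on {a..b}" for a b by (intro integrable_continuous_real that)
      then show ?thesis
        using Henstock_Kurzweil_Integration.integral_combine[of s "s + \<tau>" "s + 1" h]
          Henstock_Kurzweil_Integration.integral_combine[of "s + \<tau>" "s + 1 - \<tau>" "s + 1" h] \<tau>
        by (simp add: add.assoc)
    qed
    have total: "integral {s..s+1} (kernel z) = 2"
      using periodic_integral[of "kernel z", OF kc kernel_periodic s] kernel_mass[OF z] by (simp add: integral_unique)
    define \<theta> where "\<theta> = integral ?I2 (kernel z)"
    have \<theta>0: "\<theta> \<ge> 0" unfolding \<theta>_def by (intro integral_nonneg integrable_continuous_real kc kernel_nonneg z)
    have \<theta>1: "\<theta> \<le> 1 + \<eta>" unfolding \<theta>_def
    proof (rule far_mass[OF z zs d(1) d\<delta>(1) \<eta> \<delta>])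
      show "s + \<tau> \<le> s + 1 - \<tau>" using \<tau> by simp
      fix t assume "t \<in> ?I2"
      then show "\<delta> \<le> cmod (\<gamma> t - z)"
        using far[OF s, of t] dist_triangle[of "\<gamma> t" "\<gamma> s" z] dist_z d\<delta>' by (simp add: dist_norm norm_minus_commute)
    qed
    have n13: "integral ?I1 (kernel z) + integral ?I3 (kernel z) = 2 - \<theta>"
      using split[of "kernel z", OF kc] total by (simp add: \<theta>_def)
    have "cauchy_transform \<gamma> f z + cnj (cauchy_transform \<gamma> (\<lambda>w. cnj (f w)) z) = integral {0..1} (\<lambda>t. F t * ?K t)"
      using kernel_representation[OF continuous_on_subset[OF fcont path_image_closed_region] z]
      by (simp add: F_def integral_unique)
    moreover have "cauchy_transform \<gamma> f z = c" unfolding c_def by (rule cauchy_formula[OF U z])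
    moreover have "integral {0..1} (\<lambda>t. F t * ?K t) = integral {s..s+1} (\<lambda>t. F t * ?K t)"
    proof (rule periodic_integral[symmetric, OF _ _ s])
      show "continuous_on A (\<lambda>t. F t * ?K t)" for A by (intro continuous_on_mult Fc Kc)
      show "F (t + 1) * ?K (t + 1) = F t * ?K t" for t by (simp add: F_def periodic kernel_periodic)
    qed
    moreover have "integral {s..s+1} (\<lambda>t. F t * ?K t) - c
      = integral ?I1 (\<lambda>t. (F t - c) * ?K t) + integral ?I3 (\<lambda>t. (F t - c) * ?K t)
        + integral ?I2 (\<lambda>t. F t * ?K t) + c * of_real (1 - \<theta>)"
    proof -
      have 1: "integral {a..b} (\<lambda>t. F t * ?K t) = integral {a..b} (\<lambda>t. (F t - c) * ?K t) + c * of_real (integral {a..b} (kernel z))" for a b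
      proof -
        have "integral {a..b} (\<lambda>t. (F t - c) * ?K t) = integral {a..b} (\<lambda>t. F t * ?K t - c * ?K t)"
          by (simp add: algebra_simps)
        also have "\<dots> = integral {a..b} (\<lambda>t. F t * ?K t) - integral {a..b} (\<lambda>t. c * ?K t)"
          by (intro integral_diff integrable_continuous_real continuous_on_mult Fc Kc continuous_on_const)
        also have "integral {a..b} (\<lambda>t. c * ?K t) = c * of_real (integral {a..b} (kernel z))"
          using integral_linear[OF integrable_continuous_real[OF kc[of "{a..b}"]] bl]
          by (simp add: o_def)
        finally show ?thesis by simp
      qed
      have k: "c * of_real (integral ?I1 (kernel z)) + c * of_real (integral ?I3 (kernel z)) = c * of_real (2 - \<theta>)"
        unfolding n13[symmetric] by (simp add: distrib_left)
      have gen: "X = (P + p) + Q + (R + r) \<Longrightarrow> p + r = c * of_real (2 - \<theta>) \<Longrightarrow> X - c = P + R + Q + c * of_real (1 - \<theta>)"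
        for X P p Q R r by (simp add: algebra_simps)
      show ?thesis
        by (rule gen[OF _ k]) (simp only: split[of "\<lambda>t. F t * ?K t", OF continuous_on_mult[OF Fc Kc]] 1[of s "s+\<tau>"] 1[of "s+1-\<tau>" "s+1"])
    qed
    ultimately have "cnj (cauchy_transform \<gamma> (\<lambda>w. cnj (f w)) z)
      = integral ?I1 (\<lambda>t. (F t - c) * ?K t) + integral ?I3 (\<lambda>t. (F t - c) * ?K t)
        + integral ?I2 (\<lambda>t. F t * ?K t) + c * of_real (1 - \<theta>)"
      by (metis add_diff_cancel_left')
    then have "cmod (cnj (cauchy_transform \<gamma> (\<lambda>w. cnj (f w)) z)) = cmod (integral ?I1 (\<lambda>t. (F t - c) * ?K t) + integral ?I3 (\<lambda>t. (F t - c) * ?K t)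
        + integral ?I2 (\<lambda>t. F t * ?K t) + c * of_real (1 - \<theta>))" by (rule arg_cong)
    then have "cmod (cauchy_transform \<gamma> (\<lambda>w. cnj (f w)) z) \<le> cmod (integral ?I1 (\<lambda>t. (F t - c) * ?K t))
       + cmod (integral ?I3 (\<lambda>t. (F t - c) * ?K t)) + cmod (integral ?I2 (\<lambda>t. F t * ?K t)) + cmod c * \<bar>1 - \<theta>\<bar>"
      unfolding complex_mod_cnj
    proof (rule ord_eq_le_trans)
      show "cmod (p + q + r + c * of_real x) \<le> cmod p + cmod q + cmod r + cmod c * \<bar>x\<bar>" for p q r x
        by (intro order_trans[OF norm_triangle_ineq] add_mono order_refl) (simp add: norm_mult)
    qed
    moreover have bnd: "cmod (integral {a..b} (\<lambda>t. h t * ?K t)) \<le> B * integral {a..b} (kernel z)"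
      if "\<And>t. t \<in> {a..b} \<Longrightarrow> cmod (h t) \<le> B" and h: "continuous_on {a..b} h" for h a b B
    proof -
      have "cmod (integral {a..b} (\<lambda>t. h t * ?K t)) \<le> integral {a..b} (\<lambda>t. B * kernel z t)"
      proof (rule integral_norm_bound_integral)
        show "cmod (h t * ?K t) \<le> B * kernel z t" if "t \<in> {a..b}" for t
          using \<open>\<And>t. t \<in> {a..b} \<Longrightarrow> cmod (h t) \<le> B\<close>[OF that] kernel_nonneg[OF z, of t]
          by (simp add: norm_mult mult_right_mono)
      qed (intro integrable_continuous_real continuous_intros h Kc kc)+
      then show ?thesis by simp
    qed
    moreover have "cmod (integral ?I1 (\<lambda>t. (F t - c) * ?K t)) \<le> \<epsilon> / 4 * integral ?I1 (kernel z)"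
      by (rule bnd) (use near in \<open>auto intro!: continuous_intros Fc\<close>)
    moreover have "cmod (integral ?I3 (\<lambda>t. (F t - c) * ?K t)) \<le> \<epsilon> / 4 * integral ?I3 (kernel z)"
      by (rule bnd) (use near in \<open>auto intro!: continuous_intros Fc\<close>)
    moreover have "cmod (integral ?I2 (\<lambda>t. F t * ?K t)) \<le> M * \<theta>"
      unfolding \<theta>_def by (rule bnd) (use FM in \<open>auto intro!: continuous_intros Fc\<close>)
    moreover have "cmod c * \<bar>1 - \<theta>\<bar> \<le> M * \<bar>1 - \<theta>\<bar>" using cM by (intro mult_right_mono) auto
    ultimately have "cmod (cauchy_transform \<gamma> (\<lambda>w. cnj (f w)) z) \<le> \<epsilon> / 4 * (2 - \<theta>) + M * \<theta> + M * \<bar>1 - \<theta>\<bar>"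
      unfolding n13[symmetric] by (simp add: algebra_simps)
    moreover have "\<epsilon> / 4 * (2 - \<theta>) \<le> \<epsilon> / 2" using \<epsilon> \<theta>0 by (simp add: field_simps)
    moreover have "M * \<theta> + M * \<bar>1 - \<theta>\<bar> \<le> M + M * (2 * \<eta>)"
    proof -
      have "\<theta> + \<bar>1 - \<theta>\<bar> \<le> 1 + 2 * \<eta>" using \<theta>1 \<eta> by auto
      from mult_left_mono[OF this M0] show ?thesis by (simp add: algebra_simps)
    qed
    ultimately show ?thesis using M\<eta> by linarith
  qed
  show ?thesis
  proof (rule that[of d0])
    show "d0 > 0" using \<delta> sin\<eta> \<delta>1 by (auto simp: d0_def)
    fix d s z assume *: "0 < d" "d \<le> d0" "z \<in> region" "z = \<gamma> s - of_real d * cis (2 * pi * s)"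
    obtain k :: int where k: "s + of_int k \<in> {0..<1}" by (rule reduce_01)
    have "z = \<gamma> (s + of_int k) - of_real d * cis (2 * pi * (s + of_int k))"
      by (simp only: periodic_int cis_periodic *(4))
    then show "cmod (cauchy_transform \<gamma> (\<lambda>w. cnj (f w)) z) \<le> M + \<epsilon>" using main[of d z "s + of_int k"] * k by auto
  qed
qed

text \<open>At a minimum of the depth its derivative in \<open>t\<close> vanishes; this derivative is a multiple of the
  tangential component of \<open>\<gamma>(t) - z\<close>, so \<open>z\<close> lies on the normal through \<open>\<gamma>(t)\<close>.\<close>

lemma minimal_depth_normal:
  assumes "\<And>s. depth s z \<ge> depth t z"
  shows "z = \<gamma> t - of_real (depth t z) * cis (2 * pi * t)"
proof -
  have d: "((\<lambda>s. cnj (cis (2 * pi * s))) has_vector_derivative cnj (2 * pi * \<i> * cis (2 * pi * t))) (at t)"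
  proof (rule bounded_linear.has_vector_derivative[OF bounded_linear_cnj])
    show "((\<lambda>s. cis (2 * pi * s)) has_vector_derivative (2 * pi * \<i> * cis (2 * pi * t))) (at t)"
    proof -
      have "((\<lambda>z. exp (2 * pi * \<i> * z)) has_field_derivative (2 * pi * \<i> * exp (2 * pi * \<i> * of_real t))) (at (of_real t))"
        by (auto intro!: derivative_eq_intros)
      from has_vector_derivative_real_field[OF this] show ?thesis
        unfolding cis_conv_exp by (simp add: mult_ac)
    qed
  qed
  have "((\<lambda>s. cnj (cis (2 * pi * s)) * (\<gamma> s - z)) has_vector_derivative
     (cnj (cis (2 * pi * t)) * (velocity t - 0) + cnj (2 * pi * \<i> * cis (2 * pi * t)) * (\<gamma> t - z))) (at t)"
    by (intro has_vector_derivative_mult d derivative_intros curve_deriv)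
  from bounded_linear.has_vector_derivative[OF bounded_linear_Re this]
  have "((\<lambda>s. depth s z) has_real_derivative
     Re (cnj (cis (2 * pi * t)) * (velocity t - 0) + cnj (2 * pi * \<i> * cis (2 * pi * t)) * (\<gamma> t - z))) (at t)"
    unfolding depth_def by (simp add: has_real_derivative_iff_has_vector_derivative)
  from DERIV_local_min[OF this, of 1] assms
  have "Re (cnj (cis (2 * pi * t)) * (velocity t - 0) + cnj (2 * pi * \<i> * cis (2 * pi * t)) * (\<gamma> t - z)) = 0"
    by auto
  moreover have "Re (cnj (cis (2 * pi * t)) * (velocity t - 0) + cnj (2 * pi * \<i> * cis (2 * pi * t)) * (\<gamma> t - z))
     = 2 * pi * Im (cnj (cis (2 * pi * t)) * (\<gamma> t - z))"
    by (simp add: algebra_simps)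
  ultimately have "Im (cnj (cis (2 * pi * t)) * (\<gamma> t - z)) = 0" by simp
  then have "cnj (cis (2 * pi * t)) * (\<gamma> t - z) = of_real (depth t z)"
    unfolding depth_def by (simp add: complex_eq_iff)
  then have "cis (2 * pi * t) * (cnj (cis (2 * pi * t)) * (\<gamma> t - z)) = cis (2 * pi * t) * of_real (depth t z)" by simp
  then have "\<gamma> t - z = cis (2 * pi * t) * of_real (depth t z)"
    by (simp add: cis_cnj cis_mult flip: mult.assoc)
  then show ?thesis by (simp add: algebra_simps)
qed

text \<open>Points of the frontier of the inner parallel set at distance \<open>d\<close> lie at distance \<open>d\<close> on the normal
  of a point of the curve (\<open>minimal_depth_normal\<close>), where \<open>near_boundary_bound\<close> applies. The maximum
  principle carries the bound inside.\<close>

theorem cauchy_transform_cnj_bound: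
  assumes U: "open U" "f holomorphic_on U" "closed_region \<subseteq> U" and M: "\<And>z. z \<in> closed_region \<Longrightarrow> cmod (f z) \<le> M"
    and z0: "z0 \<in> region"
  shows "cmod (cauchy_transform \<gamma> (\<lambda>w. cnj (f w)) z0) \<le> M"
proof (rule field_le_epsilon)
  fix \<epsilon> :: real assume "\<epsilon> > 0"
  then obtain d0 where d0: "d0 > 0"
    "\<And>d s z. \<lbrakk>0 < d; d \<le> d0; z \<in> region; z = \<gamma> s - of_real d * cis (2 * pi * s)\<rbrakk>
      \<Longrightarrow> cmod (cauchy_transform \<gamma> (\<lambda>w. cnj (f w)) z) \<le> M + \<epsilon>"
    using near_boundary_bound[OF U M] by metis
  obtain t0 where t0: "\<And>s. depth s z0 \<ge> depth t0 z0" using minimal_depth_attained by blast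
  \<comment> \<open>The bound by the depth keeps \<open>z0\<close> in the parallel set.\<close>
  define d where "d = min d0 (depth t0 z0)"
  have d: "d > 0" "d \<le> d0" using d0 z0 by (auto simp: d_def region_def)
  define S where "S = {z. \<forall>t. depth t z \<ge> d}"
  have Sreg: "S \<subseteq> region" using d by (auto simp: S_def region_def intro: less_le_trans)
  have Scl: "closed S" unfolding S_def by (rule closed_parallel_set)
  have Sbd: "bounded S"
    using bounded_subset[OF compact_imp_bounded[OF compact_closed_region]] Sreg region_subset_closed_region by (meson order_trans)
  have fcont: "continuous_on (path_image \<gamma>) (\<lambda>w. cnj (f w))"
    using U holomorphic_on_imp_continuous_on path_image_closed_region by (intro continuous_intros) (meson continuous_on_subset)
  have hol: "cauchy_transform \<gamma> (\<lambda>w. cnj (f w)) holomorphic_on S"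
    using cauchy_transform_holomorphic_on_region[OF fcont] Sreg holomorphic_on_subset by blast
  show "cmod (cauchy_transform \<gamma> (\<lambda>w. cnj (f w)) z0) \<le> M + \<epsilon>"
  proof (rule maximum_modulus_frontier[where S = S and f = "cauchy_transform \<gamma> (\<lambda>w. cnj (f w))"])
    show "cauchy_transform \<gamma> (\<lambda>w. cnj (f w)) holomorphic_on interior S"
      using hol holomorphic_on_subset interior_subset by blast
    show "continuous_on (closure S) (cauchy_transform \<gamma> (\<lambda>w. cnj (f w)))"
      using hol Scl by (simp add: holomorphic_on_imp_continuous_on)
    show "bounded S" by (rule Sbd)
    show "z0 \<in> S" using t0 by (auto simp: S_def d_def intro: min.coboundedI2)
    fix z assume z: "z \<in> frontier S"
    then have zS: "z \<in> S" using Scl frontier_subset_closed by blast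
    have "{z. \<forall>t. depth t z > d} \<subseteq> interior S"
      by (rule interior_maximal[OF _ open_parallel_set]) (auto simp: S_def intro: less_imp_le)
    then have "\<exists>t. depth t z \<le> d" using z by (force simp: frontier_def not_le)
    then obtain t where "depth t z \<le> d" by blast
    then have t: "depth t z = d" using zS by (auto simp: S_def intro: antisym)
    have "z = \<gamma> t - of_real d * cis (2 * pi * t)"
      using minimal_depth_normal[of t z] zS t by (auto simp: S_def)
    then show "cmod (cauchy_transform \<gamma> (\<lambda>w. cnj (f w)) z) \<le> M + \<epsilon>"
      using d0(2)[OF d] zS Sreg by blast
  qed
qed

end

lemma Re_cnj_cis_mult: "Re (cnj (cis a) * z) = Re z * cos a + Im z * sin a"
  by simp

section \<open>Convex sets enclosed by smooth curves\<close>

lemma chord_le_arc: "2 * (1 - cos x) \<le> (x::real)\<^sup>2"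
proof -
  have "cos x = 1 - 2 * (sin (x / 2))\<^sup>2" using cos_double_sin[of "x / 2"] by (metis mult.commute nonzero_divide_eq_eq zero_neq_numeral)
  moreover have "(sin (x / 2))\<^sup>2 \<le> (x / 2)\<^sup>2"
    using abs_sin_x_le_abs_x[of "x / 2"] by (simp only: abs_le_square_iff)
  ultimately show ?thesis by (simp add: power_divide)
qed

definition support :: "complex set \<Rightarrow> real \<Rightarrow> real" where
  "support K \<tau> = (SUP z\<in>K. Re (cnj (cis \<tau>) * z))"

context
  fixes K :: "complex set"
  assumes K: "compact K" "K \<noteq> {}"
begin

lemma support_attained: obtains z where "z \<in> K" "support K \<tau> = Re (cnj (cis \<tau>) * z)"
    "\<And>w. w \<in> K \<Longrightarrow> Re (cnj (cis \<tau>) * w) \<le> support K \<tau>"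
proof -
  have "continuous_on K (\<lambda>z. Re (cnj (cis \<tau>) * z))" by (intro continuous_intros)
  then obtain z where z: "z \<in> K" "\<forall>w\<in>K. Re (cnj (cis \<tau>) * w) \<le> Re (cnj (cis \<tau>) * z)"
    using continuous_attains_sup[OF K] by blast
  then have "support K \<tau> = Re (cnj (cis \<tau>) * z)"
    unfolding support_def by (intro cSup_eq_maximum) auto
  then show ?thesis using that z by auto
qed

lemma support_ge: "w \<in> K \<Longrightarrow> Re (cnj (cis \<tau>) * w) \<le> support K \<tau>"
  by (rule support_attained)

lemma support_periodic: "support K (\<tau> + 2 * pi) = support K \<tau>"
  by (simp add: support_def flip: cis_mult)

text \<open>The discrete form of \<open>h + h'' \<ge> 0\<close>, the differential inequality that characterises support
  functions. It is an equality for a single point, and the support function is a supremum over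
  points.\<close>

lemma support_trig_convex: "support K (\<tau> + e) + support K (\<tau> - e) \<ge> 2 * cos e * support K \<tau>"
proof -
  obtain z where z: "z \<in> K" "support K \<tau> = Re (cnj (cis \<tau>) * z)" by (rule support_attained)
  have "2 * cos e * Re (cnj (cis \<tau>) * z) = Re (cnj (cis (\<tau> + e)) * z) + Re (cnj (cis (\<tau> - e)) * z)"
    unfolding Re_cnj_cis_mult by (simp add: cos_add cos_diff sin_add sin_diff algebra_simps)
  then show ?thesis using support_ge[OF z(1), of "\<tau> + e"] support_ge[OF z(1), of "\<tau> - e"] z(2) by simp
qed

lemma support_lipschitz:
  assumes R: "\<And>z. z \<in> K \<Longrightarrow> cmod z \<le> R"
  shows "\<bar>support K s - support K t\<bar> \<le> R * \<bar>s - t\<bar>"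
proof -
  have "support K s - support K t \<le> R * \<bar>s - t\<bar>" for s t
  proof -
    obtain z where z: "z \<in> K" "support K s = Re (cnj (cis s) * z)" by (rule support_attained)
    have "support K s - support K t \<le> Re ((cnj (cis s) - cnj (cis t)) * z)"
      using support_ge[OF z(1), of t] z(2) by (simp add: algebra_simps)
    also have "\<dots> \<le> cmod (cis s - cis t) * cmod z"
      by (metis complex_Re_le_cmod complex_cnj_diff complex_mod_cnj norm_mult)
    also have "\<dots> \<le> \<bar>s - t\<bar> * R"
    proof (intro mult_mono R z)
      have "cis s - cis t = cis t * (cis (s - t) - 1)"
        by (simp add: algebra_simps cis_mult)
      then have "cmod (cis s - cis t) = cmod (cis (s - t) - 1)" by (simp add: norm_mult)
      also have "\<dots> \<le> \<bar>s - t\<bar>"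
      proof -
        have "cmod (cis (s - t) - 1) ^ 2 = 2 * (1 - cos (s - t))"
          using sin_cos_squared_add[of "s - t"] unfolding cmod_power2 by (simp add: power2_eq_square algebra_simps)
        also have "\<dots> \<le> (s - t) ^ 2" by (rule chord_le_arc)
        finally show ?thesis by (simp add: abs_le_square_iff[symmetric])
      qed
      finally show "cmod (cis s - cis t) \<le> \<bar>s - t\<bar>" .
    qed auto
    finally show ?thesis by (simp add: mult.commute)
  qed
  from this[of s t] this[of t s] show ?thesis by (simp add: abs_minus_commute)
qed

text \<open>If \<open>z\<close> is outside \<open>K\<close> and \<open>p\<close> is the point of \<open>K\<close> closest to it, then the supporting line at \<open>p\<close>
  orthogonal to \<open>z - p\<close> measures the distance from \<open>z\<close> to \<open>K\<close>.\<close>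

lemma support_determines:
  assumes conv: "convex K" and z: "\<And>\<tau>. Re (cnj (cis \<tau>) * z) \<le> support K \<tau> + \<eta>" and \<eta>: "\<eta> \<ge> 0"
  shows "\<exists>w\<in>K. dist w z \<le> \<eta>"
proof -
  define p where "p = closest_point K z"
  have cl: "closed K" using K compact_imp_closed by blast
  have p: "p \<in> K" unfolding p_def using closest_point_in_set cl K by blast
  show ?thesis
  proof (cases "z = p")
    case True then show ?thesis using p \<eta> by (intro bexI[of _ p]) auto
  next
    case False
    obtain \<tau> where \<tau>: "z - p = of_real (cmod (z - p)) * cis \<tau>"
      by (metis rcis_cmod_Arg rcis_def)
    have le: "Re (cnj (cis \<tau>) * w) \<le> Re (cnj (cis \<tau>) * p)" if w: "w \<in> K" for w
    proof -
      have "inner (z - p) (w - p) \<le> 0" unfolding p_def by (rule closest_point_dot[OF conv cl w])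
      moreover have "inner (z - p) (w - p) = Re (cnj (z - p) * (w - p))" by (simp add: inner_complex_def algebra_simps)
      moreover have "Re (cnj (z - p) * (w - p)) = cmod (z - p) * Re (cnj (cis \<tau>) * (w - p))"
        by (subst (1) \<tau>) (simp add: algebra_simps)
      ultimately have "cmod (z - p) * Re (cnj (cis \<tau>) * (w - p)) \<le> 0" by linarith
      then have "Re (cnj (cis \<tau>) * (w - p)) \<le> 0"
        using False by (smt (verit) mult_pos_pos right_minus_eq zero_less_norm_iff)
      then show ?thesis by (simp add: algebra_simps)
    qed
    obtain w where "w \<in> K" "support K \<tau> = Re (cnj (cis \<tau>) * w)" by (rule support_attained)
    then have "support K \<tau> \<le> Re (cnj (cis \<tau>) * p)" using le by simp
    then have "Re (cnj (cis \<tau>) * (z - p)) \<le> \<eta>" using z[of \<tau>] by (simp add: algebra_simps)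
    also have "cnj (cis \<tau>) * (z - p) = of_real (cmod (z - p)) * (cis \<tau> * cnj (cis \<tau>))"
      by (subst (1) \<tau>) (simp add: algebra_simps)
    finally have "cmod (z - p) \<le> \<eta>" by (simp add: cis_cnj cis_mult)
    then show ?thesis using p by (auto simp: dist_norm norm_minus_commute)
  qed
qed

end

lemma global_antiderivative:
  fixes f :: "real \<Rightarrow> real"
  assumes "continuous_on UNIV f"
  obtains F where "\<And>x. (F has_real_derivative f x) (at x)"
proof -
  have "\<exists>F. \<forall>x::real. -\<infinity> < ereal x \<longrightarrow> ereal x < \<infinity> \<longrightarrow> (F has_vector_derivative f x) (at x)"
    by (rule einterval_antiderivative) (use assms in \<open>auto simp: continuous_on_eq_continuous_at\<close>)
  then show ?thesis using that by (auto simp: has_real_derivative_iff_has_vector_derivative)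
qed

text \<open>The second difference quotient of a second antiderivative of \<open>H\<close> is an average of \<open>H\<close> with a
  triangular weight of half width \<open>e\<close>: a \<open>C\<^sup>2\<close> function close to \<open>H\<close> whose second derivative is
  explicit.\<close>

lemma second_difference_bound:
  fixes Q P H :: "real \<Rightarrow> real"
  assumes Q: "\<And>x. (Q has_real_derivative P x) (at x)" and P: "\<And>x. (P has_real_derivative H x) (at x)"
    and lip: "\<And>s t. \<bar>H s - H t\<bar> \<le> R * \<bar>s - t\<bar>" and e: "e > 0"
  shows "\<bar>(Q (\<tau> + e) - 2 * Q \<tau> + Q (\<tau> - e)) / e\<^sup>2 - H \<tau>\<bar> \<le> 2 * R * e"
proof -
  \<comment> \<open>The mean value theorem, twice, for the symmetrised remainder.\<close>
  define D where "D x = Q (\<tau> + x) + Q (\<tau> - x) - 2 * Q \<tau> - x\<^sup>2 * H \<tau>" for x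
  define D' where "D' x = P (\<tau> + x) - P (\<tau> - x) - 2 * x * H \<tau>" for x
  note [derivative_intros] = DERIV_chain2[OF Q] DERIV_chain2[OF P]
  have d1: "(D has_real_derivative D' x) (at x)" for x
    unfolding D_def D'_def by (auto intro!: derivative_eq_intros)
  have d2: "(D' has_real_derivative (H (\<tau> + x) + H (\<tau> - x) - 2 * H \<tau>)) (at x)" for x
    unfolding D'_def by (auto intro!: derivative_eq_intros)
  obtain x where x: "0 < x" "x < e" "D e - D 0 = (e - 0) * D' x" using MVT2[OF e d1] by blast
  obtain y where y: "0 < y" "y < x" "D' x - D' 0 = (x - 0) * (H (\<tau> + y) + H (\<tau> - y) - 2 * H \<tau>)"
    using MVT2[OF x(1) d2] by blast
  have R: "R \<ge> 0" using lip[of 1 0] by simp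
  have "\<bar>H (\<tau> + y) + H (\<tau> - y) - 2 * H \<tau>\<bar> \<le> 2 * (R * y)"
    using lip[of "\<tau> + y" \<tau>] lip[of "\<tau> - y" \<tau>] y by simp
  also have "\<dots> \<le> 2 * (R * e)" using x y R by (intro mult_left_mono) auto
  finally have H: "\<bar>H (\<tau> + y) + H (\<tau> - y) - 2 * H \<tau>\<bar> \<le> 2 * (R * e)" .
  have "D e = e * (x * (H (\<tau> + y) + H (\<tau> - y) - 2 * H \<tau>))" using x y by (simp add: D_def D'_def)
  then have "\<bar>D e\<bar> = e * (x * \<bar>H (\<tau> + y) + H (\<tau> - y) - 2 * H \<tau>\<bar>)"
    using x e by (simp add: abs_mult)
  also have "\<dots> \<le> e * (e * (2 * (R * e)))"
    using H x e by (intro mult_left_mono mult_mono) auto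
  finally have De: "\<bar>D e\<bar> \<le> e\<^sup>2 * (2 * R * e)" by (simp add: power2_eq_square algebra_simps)
  have "(Q (\<tau> + e) - 2 * Q \<tau> + Q (\<tau> - e)) / e\<^sup>2 - H \<tau> = D e / e\<^sup>2"
    using e by (simp add: D_def field_simps)
  then have "\<bar>(Q (\<tau> + e) - 2 * Q \<tau> + Q (\<tau> - e)) / e\<^sup>2 - H \<tau>\<bar> = \<bar>D e\<bar> / e\<^sup>2" by simp
  also have "\<dots> \<le> 2 * R * e" using De e by (simp add: divide_le_eq mult.commute)
  finally show ?thesis .
qed

text \<open>If \<open>f\<close> is periodic up to a constant increment \<open>c\<close>, an antiderivative is periodic up to a linear
  function, which second differences do not see. For \<open>c = 0\<close> the linear function is constant, so
  the antiderivative satisfies the assumption in its turn.\<close>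

lemma second_difference_periodic:
  fixes F f :: "real \<Rightarrow> real"
  assumes F: "\<And>x. (F has_real_derivative f x) (at x)" and c: "\<And>x. f (x + p) = f x + c"
  shows "F (x + p + e) - 2 * F (x + p) + F (x + p - e) = F (x + e) - 2 * F x + F (x - e)"
    and "c = 0 \<Longrightarrow> \<exists>d. \<forall>x. F (x + p) = F x + d"
proof -
  note [derivative_intros] = DERIV_chain2[OF F]
  have "((\<lambda>x. F (x + p) - F x - c * x) has_real_derivative 0) (at x)" for x
    by (auto intro!: derivative_eq_intros simp: c)
  then have k: "F (x + p) - F x - c * x = F (0 + p) - F 0 - c * 0" for x
    using DERIV_isconst_all[of "\<lambda>x. F (x + p) - F x - c * x" x 0] by blast
  show "F (x + p + e) - 2 * F (x + p) + F (x + p - e) = F (x + e) - 2 * F x + F (x - e)"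
    using k[of "x + e"] k[of x] k[of "x - e"] by (simp add: algebra_simps)
  show "\<exists>d. \<forall>x. F (x + p) = F x + d" if "c = 0"
    using k that by (intro exI[of _ "F p - F 0"]) (auto simp: algebra_simps)
qed

text \<open>A function \<open>h\<close> of the normal angle with \<open>h + h'' > 0\<close> is the support function of the curve \<open>(h + \<i>
  h') cis \<tau>\<close>, whose velocity is \<open>(h + h'') \<i> cis \<tau>\<close>. Such an \<open>h\<close> is obtained from the support
  function \<open>H\<close> of \<open>K\<close> by averaging, which makes it smooth, and adding a small constant \<open>c\<close>.
  Trigonometric convexity gives \<open>h'' \<ge> - H\<close>, and the constant absorbs the difference between \<open>h\<close> and
  \<open>H\<close>. The origin is placed in \<open>K\<close> to have \<open>H \<ge> 0\<close>.\<close>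

lemma convex_curve_around_origin:
  assumes K: "compact K" "convex K" "0 \<in> K" and \<epsilon>: "\<epsilon> > 0"
  obtains \<gamma> \<rho> where "convex_curve \<gamma> \<rho>" "K \<subseteq> convex_curve.region \<gamma>"
    "\<And>z. z \<in> convex_curve.closed_region \<gamma> \<Longrightarrow> \<exists>w\<in>K. dist w z < \<epsilon>"
proof -
  have K0: "K \<noteq> {}" using K by auto
  obtain R where R: "R > 0" "\<And>z. z \<in> K \<Longrightarrow> cmod z \<le> R"
    using compact_imp_bounded[OF K(1)] by (auto simp: bounded_pos)
  define H where "H = support K"
  have lip: "\<bar>H s - H t\<bar> \<le> R * \<bar>s - t\<bar>" for s t unfolding H_def by (rule support_lipschitz[OF K(1) K0 R(2)])
  have H0: "H \<tau> \<ge> 0" for \<tau> using support_ge[OF K(1) K0 K(3), of \<tau>] by (simp add: H_def)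
  have Hcont: "continuous_on A H" for A
    by (rule lipschitz_on_continuous_on[of R]) (use lip R in \<open>auto simp: lipschitz_on_def dist_real_def\<close>)
  obtain P where P: "\<And>x. (P has_real_derivative H x) (at x)" using global_antiderivative[OF Hcont] by blast
  then have "continuous_on UNIV P" using DERIV_isCont continuous_at_imp_continuous_on by blast
  then obtain Q where Q: "\<And>x. (Q has_real_derivative P x) (at x)" using global_antiderivative by blast
  \<comment> \<open>The curve leaves \<open>K\<close> by at most \<open>2 R e\<close> from averaging plus \<open>c = 3 R e\<close>.\<close>
  define e where "e = \<epsilon> / (6 * R)"
  have e: "e > 0" "5 * R * e < \<epsilon>" using \<epsilon> R by (auto simp: e_def)
  define h where "h \<tau> = (Q (\<tau> + e) - 2 * Q \<tau> + Q (\<tau> - e)) / e\<^sup>2" for \<tau>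
  define h1 where "h1 \<tau> = (P (\<tau> + e) - 2 * P \<tau> + P (\<tau> - e)) / e\<^sup>2" for \<tau>
  define h2 where "h2 \<tau> = (H (\<tau> + e) - 2 * H \<tau> + H (\<tau> - e)) / e\<^sup>2" for \<tau>
  define c where "c = 3 * R * e"
  note [derivative_intros] = DERIV_chain2[OF Q] DERIV_chain2[OF P]
  have dh: "(h has_real_derivative h1 x) (at x)" for x
    unfolding h_def h1_def by (rule DERIV_cdivide) (auto intro!: derivative_eq_intros)
  have dh1: "(h1 has_real_derivative h2 x) (at x)" for x
    unfolding h1_def h2_def by (rule DERIV_cdivide) (auto intro!: derivative_eq_intros)
  have hH: "\<bar>h \<tau> - H \<tau>\<bar> \<le> 2 * R * e" for \<tau>
    unfolding h_def by (rule second_difference_bound[OF Q P lip e(1)])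
  have h2H: "h2 \<tau> \<ge> - H \<tau>" for \<tau>
  proof -
    have "2 - 2 * cos e \<le> e\<^sup>2" using chord_le_arc[of e] by simp
    from mult_right_mono[OF this H0[of \<tau>]]
    have "- H \<tau> * e\<^sup>2 \<le> H (\<tau> + e) - 2 * H \<tau> + H (\<tau> - e)"
      using support_trig_convex[OF K(1) K0, of e \<tau>] by (simp add: H_def algebra_simps)
    then show ?thesis using e by (simp add: h2_def le_divide_eq)
  qed
  have Hper: "H (x + 2 * pi) = H x + 0" for x by (simp add: H_def support_periodic[OF K(1) K0])
  obtain d where d: "\<And>x. P (x + 2 * pi) = P x + d" using second_difference_periodic(2)[OF P Hper] by auto
  have hper: "h (x + 2 * pi) = h x" for x
    unfolding h_def using second_difference_periodic(1)[OF Q d, of x e] by (simp add: add_ac)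
  have h1per: "h1 (x + 2 * pi) = h1 x" for x
    unfolding h1_def using second_difference_periodic(1)[OF P Hper, of x e] by (simp add: add_ac)
  define \<gamma> where "\<gamma> t = Complex (h (2 * pi * t) + c) (h1 (2 * pi * t)) * cis (2 * pi * t)" for t
  define \<rho> where "\<rho> t = 2 * pi * (h (2 * pi * t) + c + h2 (2 * pi * t))" for t
  have cc: "convex_curve \<gamma> \<rho>"
  proof
    have "continuous_on UNIV h" using dh DERIV_isCont continuous_at_imp_continuous_on by blast
    moreover have "continuous_on UNIV (\<lambda>\<tau>. H (\<tau> + e))" "continuous_on UNIV (\<lambda>\<tau>. H (\<tau> - e))"
      by (rule continuous_on_compose2[OF Hcont[of UNIV]]; auto intro!: continuous_intros)+
    then have "continuous_on UNIV h2" unfolding h2_def using e(1) Hcont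
      by (intro continuous_on_divide continuous_on_add continuous_on_diff continuous_on_mult continuous_on_const) auto
    ultimately have "continuous_on UNIV (\<lambda>t. h (2 * pi * t))" "continuous_on UNIV (\<lambda>t. h2 (2 * pi * t))"
      by (auto intro!: continuous_on_compose2[of UNIV h UNIV "\<lambda>t. 2 * pi * t"]
          continuous_on_compose2[of UNIV h2 UNIV "\<lambda>t. 2 * pi * t"] continuous_intros)
    then show "continuous_on UNIV \<rho>" unfolding \<rho>_def by (intro continuous_intros)
    show "\<rho> t > 0" for t
    proof -
      have "h (2 * pi * t) + c + h2 (2 * pi * t) > 0"
        using hH[of "2 * pi * t"] h2H[of "2 * pi * t"] mult_pos_pos[OF R(1) e(1)] unfolding c_def abs_le_iff by linarith
      then show ?thesis by (simp add: \<rho>_def)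
    qed
    show "(\<gamma> has_vector_derivative complex_of_real (\<rho> t) * \<i> * cis (2 * pi * t)) (at t)" for t
    proof -
      let ?\<tau> = "2 * pi * t"
      have 0: "((\<lambda>t. 2 * pi * t) has_real_derivative 2 * pi) (at t)"
        by (auto intro!: derivative_eq_intros)
      have 1: "((\<lambda>t. h (2 * pi * t) + c) has_real_derivative 2 * pi * h1 ?\<tau>) (at t)"
        using DERIV_add[OF DERIV_chain2[OF dh 0] DERIV_const[of c]]
        by (simp add: mult_ac)
      have 2: "((\<lambda>t. h1 (2 * pi * t)) has_real_derivative 2 * pi * h2 ?\<tau>) (at t)"
        using DERIV_chain2[OF dh1 0]
        by (simp add: mult_ac)
      have "((\<lambda>z. exp (2 * pi * \<i> * z)) has_field_derivative (2 * pi * \<i> * exp (2 * pi * \<i> * of_real t))) (at (of_real t))"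
        by (auto intro!: derivative_eq_intros)
      from has_vector_derivative_real_field[OF this]
      have 3: "((\<lambda>s. cis (2 * pi * s)) has_vector_derivative (2 * pi * \<i> * cis ?\<tau>)) (at t)"
        unfolding cis_conv_exp by (simp add: mult_ac)
      have 4: "((\<lambda>t. of_real (h (2 * pi * t) + c) + \<i> * of_real (h1 (2 * pi * t))) has_vector_derivative
          of_real (2 * pi * h1 ?\<tau>) + \<i> * of_real (2 * pi * h2 ?\<tau>)) (at t)"
        by (intro has_vector_derivative_add has_vector_derivative_mult_right has_vector_derivative_of_real 1 2)
      have "((\<lambda>t. (of_real (h (2 * pi * t) + c) + \<i> * of_real (h1 (2 * pi * t))) * cis (2 * pi * t)) has_vector_derivative
          ((of_real (h ?\<tau> + c) + \<i> * of_real (h1 ?\<tau>)) * (2 * pi * \<i> * cis ?\<tau>)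
           + (of_real (2 * pi * h1 ?\<tau>) + \<i> * of_real (2 * pi * h2 ?\<tau>)) * cis ?\<tau>)) (at t)"
        by (rule has_vector_derivative_mult[OF 4 3])
      moreover have "(of_real (h ?\<tau> + c) + \<i> * of_real (h1 ?\<tau>)) * (2 * pi * \<i> * cis ?\<tau>)
           + (of_real (2 * pi * h1 ?\<tau>) + \<i> * of_real (2 * pi * h2 ?\<tau>)) * cis ?\<tau>
         = complex_of_real (\<rho> t) * \<i> * cis ?\<tau>"
        unfolding \<rho>_def by (simp add: algebra_simps)
      ultimately show ?thesis unfolding \<gamma>_def Complex_eq by simp
    qed
    show "\<gamma> (t + 1) = \<gamma> t" for t
      using hper[of "2 * pi * t"] h1per[of "2 * pi * t"]
      by (simp add: \<gamma>_def distrib_left flip: cis_mult)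
  qed
  interpret convex_curve \<gamma> \<rho> by (rule cc)
  have dep: "depth t z = h (2 * pi * t) + c - Re (cnj (cis (2 * pi * t)) * z)" for t z
  proof -
    have "cnj (cis (2 * pi * t)) * \<gamma> t = Complex (h (2 * pi * t) + c) (h1 (2 * pi * t))"
      unfolding \<gamma>_def by (simp add: cis_cnj cis_mult mult.left_commute)
    then show ?thesis unfolding depth_def right_diff_distrib by simp
  qed
  show ?thesis
  proof (rule that[OF cc])
    show "K \<subseteq> region"
    proof
      fix z assume z: "z \<in> K"
      have "depth t z > 0" for t
        using support_ge[OF K(1) K0 z, of "2 * pi * t"] hH[of "2 * pi * t"] mult_pos_pos[OF R(1) e(1)]
        unfolding dep c_def H_def abs_le_iff by linarith
      then show "z \<in> region" by (simp add: region_def)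
    qed
    fix z assume z: "z \<in> closed_region"
    have "Re (cnj (cis \<tau>) * z) \<le> support K \<tau> + 5 * R * e" for \<tau>
    proof -
      have "depth (\<tau> / (2 * pi)) z \<ge> 0" using z by (simp add: closed_region_def)
      then show ?thesis using hH[of \<tau>] unfolding dep c_def H_def abs_le_iff by simp
    qed
    then have "\<exists>w\<in>K. dist w z \<le> 5 * R * e"
      using R e by (intro support_determines[OF K(1) K0 K(2)]) auto
    then show "\<exists>w\<in>K. dist w z < \<epsilon>" using e by force
  qed
qed

text \<open>Contours for all Cauchy integrals below. The previous lemma applies after a translation that
  moves a point of \<open>K\<close> to the origin.\<close>

theorem convex_curve_exists:
  assumes K: "compact K" "convex K" "K \<noteq> {}" and U: "open U" "K \<subseteq> U"
  obtains \<gamma> \<rho> where "convex_curve \<gamma> \<rho>" "K \<subseteq> convex_curve.region \<gamma>" "convex_curve.closed_region \<gamma> \<subseteq> U"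
proof -
  obtain k where k: "k \<in> K" using K by blast
  obtain \<epsilon> where \<epsilon>: "\<epsilon> > 0" "(\<Union>x\<in>K. ball x \<epsilon>) \<subseteq> U"
    using compact_subset_open_imp_ball_epsilon_subset[OF K(1) U] by blast
  define K' where "K' = (\<lambda>z. z - k) ` K"
  have "compact K'" "convex K'" "0 \<in> K'"
    using K k unfolding K'_def by (auto intro: compact_translation_subtract convex_translation_subtract)
  then obtain \<gamma> \<rho> where c: "convex_curve \<gamma> \<rho>" and 1: "K' \<subseteq> convex_curve.region \<gamma>"
    and 2: "\<And>z. z \<in> convex_curve.closed_region \<gamma> \<Longrightarrow> \<exists>w\<in>K'. dist w z < \<epsilon>"
    using convex_curve_around_origin[OF _ _ _ \<epsilon>(1)] by metis
  interpret c: convex_curve \<gamma> \<rho> by (rule c)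
  define \<gamma>' where "\<gamma>' t = \<gamma> t + k" for t
  have c': "convex_curve \<gamma>' \<rho>"
  proof
    show "(\<gamma>' has_vector_derivative complex_of_real (\<rho> t) * \<i> * cis (2 * pi * t)) (at t)" for t
      unfolding \<gamma>'_def using c.curve_deriv has_vector_derivative_add_const by blast
  qed (auto simp: \<gamma>'_def c.periodic c.speed_pos c.speed_cont)
  interpret c': convex_curve \<gamma>' \<rho> by (rule c')
  have dep: "c'.depth t z = c.depth t (z - k)" for t z
    by (simp add: c.depth_def c'.depth_def \<gamma>'_def algebra_simps)
  show ?thesis
  proof (rule that[OF c'])
    show "K \<subseteq> c'.region" using 1 by (auto simp: c'.region_def c.region_def dep K'_def)
    show "c'.closed_region \<subseteq> U"
    proof
      fix z assume "z \<in> c'.closed_region"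
      then have "z - k \<in> c.closed_region" by (simp add: c'.closed_region_def c.closed_region_def dep)
      then obtain w where "w \<in> K'" "dist w (z - k) < \<epsilon>" using 2 by blast
      then obtain x where "x \<in> K" "dist (x - k) (z - k) < \<epsilon>" by (auto simp: K'_def)
      then have "x \<in> K" "z \<in> ball x \<epsilon>" by (auto simp: dist_norm)
      then show "z \<in> U" using \<epsilon>(2) by blast
    qed
  qed
qed

section \<open>Functions of a matrix\<close>

text \<open>The value \<open>p(A)\<close> by Horner's scheme.\<close>

definition poly_at_mat :: "complex mat \<Rightarrow> complex poly \<Rightarrow> complex mat" where
  "poly_at_mat A p = fold_coeffs (\<lambda>a M. a \<cdot>\<^sub>m 1\<^sub>m (dim_row A) + A * M) p (0\<^sub>m (dim_row A) (dim_row A))"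

lemma poly_at_mat_0 [simp]: "poly_at_mat A 0 = 0\<^sub>m (dim_row A) (dim_row A)"
  by (simp add: poly_at_mat_def)

lemma add_mat_swap:
  assumes "X \<in> carrier_mat n m" "Y \<in> carrier_mat n m" "Z \<in> carrier_mat n m" "W \<in> carrier_mat n m"
  shows "(X + Y) + (Z + W) = (X + Z) + (Y + (W :: 'a :: comm_ring mat))"
  using assms by (intro eq_matI) auto

context
  fixes A :: "complex mat" and n :: nat
  assumes A: "A \<in> carrier_mat n n"
begin

lemma poly_at_mat_pCons: "poly_at_mat A (pCons a p) = a \<cdot>\<^sub>m 1\<^sub>m n + A * poly_at_mat A p"
proof (cases "a = 0 \<and> p = 0")
  case True
  have "0 \<cdot>\<^sub>m 1\<^sub>m n + A * 0\<^sub>m n n = 0\<^sub>m n n"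
    using A by (intro eq_matI) auto
  then show ?thesis using True A by simp
next
  case False
  then have "coeffs (pCons a p) = a # coeffs p" by auto
  then show ?thesis using A by (simp add: poly_at_mat_def fold_coeffs_def)
qed

lemma poly_at_mat_carrier [simp]: "poly_at_mat A p \<in> carrier_mat n n"
  by (induction p) (use A in \<open>auto simp: poly_at_mat_pCons\<close>)

lemma poly_at_mat_dim [simp]: "dim_row (poly_at_mat A p) = n" "dim_col (poly_at_mat A p) = n"
  by (rule carrier_matD[OF poly_at_mat_carrier])+

lemma poly_at_mat_add: "poly_at_mat A (p + q) = poly_at_mat A p + poly_at_mat A q"
proof (induction p q rule: poly_induct2)
  case 0
  then show ?case using A by simp
next
  case (pCons a p b q)
  have "(a + b) \<cdot>\<^sub>m 1\<^sub>m n = a \<cdot>\<^sub>m 1\<^sub>m n + b \<cdot>\<^sub>m 1\<^sub>m n" by (auto intro!: eq_matI)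
  then have "poly_at_mat A (pCons a p + pCons b q) = (a \<cdot>\<^sub>m 1\<^sub>m n + b \<cdot>\<^sub>m 1\<^sub>m n) + (A * poly_at_mat A p + A * poly_at_mat A q)"
    using A by (simp add: poly_at_mat_pCons pCons.IH mult_add_distrib_mat[OF A poly_at_mat_carrier poly_at_mat_carrier])
  also have "\<dots> = (a \<cdot>\<^sub>m 1\<^sub>m n + A * poly_at_mat A p) + (b \<cdot>\<^sub>m 1\<^sub>m n + A * poly_at_mat A q)"
    by (rule add_mat_swap[where n = n and m = n]) (use A in auto)
  finally show ?case by (simp add: poly_at_mat_pCons)
qed

lemma poly_at_mat_smult: "poly_at_mat A (Polynomial.smult c p) = c \<cdot>\<^sub>m poly_at_mat A p"
proof (induction p)
  case 0
  then show ?case using A by (auto intro!: eq_matI)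
next
  case (pCons a p)
  have "c \<cdot>\<^sub>m (a \<cdot>\<^sub>m 1\<^sub>m n) = (c * a) \<cdot>\<^sub>m 1\<^sub>m n" by (auto intro!: eq_matI)
  with pCons show ?case using A
    by (simp add: poly_at_mat_pCons add_smult_distrib_left_mat[where nr = n and nc = n] mult_smult_distrib[OF A poly_at_mat_carrier])
qed

lemma poly_at_mat_pCons_0: "poly_at_mat A (pCons 0 p) = A * poly_at_mat A p"
proof -
  have "0 \<cdot>\<^sub>m 1\<^sub>m n + A * poly_at_mat A p = A * poly_at_mat A p" using A by (intro eq_matI) auto
  then show ?thesis by (simp add: poly_at_mat_pCons)
qed

lemma poly_at_mat_mult: "poly_at_mat A (p * q) = poly_at_mat A p * poly_at_mat A q"
proof (induction p)
  case 0
  then show ?case using A by (simp add: left_mult_zero_mat[OF poly_at_mat_carrier])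
next
  case (pCons a p)
  have "poly_at_mat A (pCons a p * q) = a \<cdot>\<^sub>m poly_at_mat A q + A * (poly_at_mat A p * poly_at_mat A q)"
    by (simp add: mult_pCons_left poly_at_mat_add poly_at_mat_smult poly_at_mat_pCons_0 pCons.IH)
  also have "a \<cdot>\<^sub>m poly_at_mat A q = (a \<cdot>\<^sub>m 1\<^sub>m n) * poly_at_mat A q"
    by (simp add: mult_smult_assoc_mat[OF one_carrier_mat poly_at_mat_carrier])
  also have "A * (poly_at_mat A p * poly_at_mat A q) = (A * poly_at_mat A p) * poly_at_mat A q"
    by (simp add: assoc_mult_mat[OF A poly_at_mat_carrier poly_at_mat_carrier])
  also have "(a \<cdot>\<^sub>m 1\<^sub>m n) * poly_at_mat A q + (A * poly_at_mat A p) * poly_at_mat A q = poly_at_mat A (pCons a p) * poly_at_mat A q"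
    unfolding poly_at_mat_pCons by (rule add_mult_distrib_mat[symmetric, where nr = n and n = n and nc = n]) (use A in auto)
  finally show ?case .
qed

lemma poly_at_mat_1: "poly_at_mat A 1 = 1\<^sub>m n"
proof -
  have "1 \<cdot>\<^sub>m 1\<^sub>m n + A * 0\<^sub>m n n = 1\<^sub>m n" using A by (intro eq_matI) auto
  then show ?thesis using A poly_at_mat_pCons[of 1 0] by (simp add: one_pCons)
qed

lemma poly_at_mat_linear: "poly_at_mat A [:c, d:] = c \<cdot>\<^sub>m 1\<^sub>m n + d \<cdot>\<^sub>m A"
proof -
  have "poly_at_mat A [:c, d:] = c \<cdot>\<^sub>m 1\<^sub>m n + A * (d \<cdot>\<^sub>m 1\<^sub>m n + A * 0\<^sub>m n n)"
    using A by (simp add: poly_at_mat_pCons)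
  also have "d \<cdot>\<^sub>m 1\<^sub>m n + A * 0\<^sub>m n n = d \<cdot>\<^sub>m 1\<^sub>m n" using A by (intro eq_matI) auto
  also have "A * (d \<cdot>\<^sub>m 1\<^sub>m n) = d \<cdot>\<^sub>m A"
    using A mult_smult_distrib[OF A one_carrier_mat, of d] by simp
  finally show ?thesis .
qed

lemma poly_at_mat_commute: "poly_at_mat A p * poly_at_mat A q = poly_at_mat A q * poly_at_mat A p"
  by (metis mult.commute poly_at_mat_mult)

end

lemma poly_at_mat_similar:
  assumes "similar_mat_wit A B P Q" "A \<in> carrier_mat n n"
  shows "poly_at_mat A p = P * poly_at_mat B p * Q"
proof -
  from similar_mat_witD2[OF assms(2,1)] have PQ: "P * Q = 1\<^sub>m n" "Q * P = 1\<^sub>m n" "A = P * B * Q"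
    and c: "A \<in> carrier_mat n n" "B \<in> carrier_mat n n" "P \<in> carrier_mat n n" "Q \<in> carrier_mat n n" by auto
  show ?thesis
  proof (induction p)
    case 0
    then show ?case using c by simp
  next
    case (pCons a p)
    let ?M = "poly_at_mat B p"
    have M: "?M \<in> carrier_mat n n" using c(2) by simp
    note mc = mult_carrier_mat[of _ n n _ n]
    have "A * (P * ?M * Q) = P * (B * ?M) * Q"
    proof -
      have "A * (P * ?M * Q) = P * B * (Q * (P * ?M * Q))" unfolding PQ(3) using c M by (simp add: assoc_mult_mat[of _ n n _ n _ n] mc)
      also have "Q * (P * ?M * Q) = (Q * P) * (?M * Q)" using c M by (simp add: assoc_mult_mat[of _ n n _ n _ n] mc)
      also have "\<dots> = ?M * Q" using PQ c M by (simp add: left_mult_one_mat[of _ n n] mc)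
      finally show ?thesis using c M by (simp add: assoc_mult_mat[of _ n n _ n _ n] mc)
    qed
    moreover have "a \<cdot>\<^sub>m 1\<^sub>m n = P * (a \<cdot>\<^sub>m 1\<^sub>m n) * Q"
    proof -
      have "P * (a \<cdot>\<^sub>m 1\<^sub>m n) * Q = a \<cdot>\<^sub>m (P * Q)"
        using c by (simp add: mult_smult_distrib[of _ n n _ n] mult_smult_assoc_mat[of _ n n _ n])
      then show ?thesis using PQ by simp
    qed
    ultimately have "poly_at_mat A (pCons a p) = P * (a \<cdot>\<^sub>m 1\<^sub>m n) * Q + P * (B * ?M) * Q"
      using pCons.IH by (simp add: poly_at_mat_pCons[OF c(1)])
    also have "\<dots> = P * (a \<cdot>\<^sub>m 1\<^sub>m n + B * ?M) * Q"
      using c M by (simp add: mult_add_distrib_mat[of _ n n _ n] add_mult_distrib_mat[of _ n n _ _ n])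
    finally show ?case by (simp add: poly_at_mat_pCons[OF c(2)])
  qed
qed

lemma roots_poly_snoc: "roots_poly (as @ [a]) = roots_poly as * [:- a, 1:]"
  by (simp add: roots_poly_def)

text \<open>Each factor \<open>B - B\<^sub>k\<^sub>k\<close> maps the span of the first \<open>k + 1\<close> unit vectors into the span of the first
  \<open>k\<close>.\<close>

lemma roots_poly_diag_kills_triangular:
  fixes B :: "complex mat" and x :: "complex vec"
  assumes B: "B \<in> carrier_mat n n" and ut: "upper_triangular B" and k: "k \<le> n"
    and x: "x \<in> carrier_vec n" "\<And>i. k \<le> i \<Longrightarrow> i < n \<Longrightarrow> x $ i = 0"
  shows "poly_at_mat B (roots_poly (take k (diag_mat B))) *\<^sub>v x = 0\<^sub>v n"
  using k x
proof (induction k arbitrary: x)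
  case 0
  then have "x = 0\<^sub>v n" by (intro eq_vecI) auto
  then show ?case using B by (simp add: poly_at_mat_1)
next
  case (Suc k)
  let ?b = "B $$ (k, k)"
  define y where "y = poly_at_mat B [:- ?b, 1:] *\<^sub>v x"
  have kn: "k < n" using Suc by simp
  have y: "y \<in> carrier_vec n" unfolding y_def using Suc.prems(2) B by (auto intro!: mult_mat_vec_carrier)
  have y_alt: "y = B *\<^sub>v x - ?b \<cdot>\<^sub>v x"
  proof -
    have "y = (- ?b \<cdot>\<^sub>m 1\<^sub>m n + 1 \<cdot>\<^sub>m B) *\<^sub>v x" unfolding y_def using poly_at_mat_linear[OF B] by simp
    also have "\<dots> = (- ?b \<cdot>\<^sub>m 1\<^sub>m n) *\<^sub>v x + (1 \<cdot>\<^sub>m B) *\<^sub>v x"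
      by (rule add_mult_distrib_mat_vec[where nr = n and nc = n]) (use B Suc.prems in auto)
    also have "(- ?b \<cdot>\<^sub>m 1\<^sub>m n) *\<^sub>v x = - ?b \<cdot>\<^sub>v x" using Suc.prems by (auto intro!: eq_vecI simp: smult_scalar_prod_distrib[of _ n])
    also have "1 \<cdot>\<^sub>m B = B" by auto
    finally show ?thesis using B Suc.prems by (intro eq_vecI) auto
  qed
  have "y $ i = 0" if i: "k \<le> i" "i < n" for i
  proof -
    have "(B *\<^sub>v x) $ i = (\<Sum>j\<in>{0..<n}. B $$ (i, j) * x $ j)"
      using B i Suc.prems by (simp add: scalar_prod_def)
    also have "\<dots> = (\<Sum>j\<in>{0..<n}. if j = k \<and> i = k then ?b * x $ k else 0)"
    proof (rule sum.cong)
      fix j assume j: "j \<in> {0..<n}"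
      show "B $$ (i, j) * x $ j = (if j = k \<and> i = k then ?b * x $ k else 0)"
      proof (cases "j < i")
        case True
        then have "B $$ (i, j) = 0" using ut B i by (auto simp: upper_triangular_def)
        then show ?thesis using True by auto
      next
        case False
        then have "j > k \<or> j = k \<and> i = k" using i by auto
        then show ?thesis using Suc.prems(3)[of j] j by auto
      qed
    qed simp
    also have "\<dots> = ?b * x $ i"
    proof (cases "i = k")
      case True then show ?thesis using kn by (simp add: sum.delta)
    next
      case False then show ?thesis using Suc.prems(3)[of i] i by simp
    qed
    finally show ?thesis unfolding y_alt using B i Suc.prems by simp
  qed
  then have "poly_at_mat B (roots_poly (take k (diag_mat B))) *\<^sub>v y = 0\<^sub>v n" by (intro Suc.IH y) (use Suc in auto)
  moreover have "take (Suc k) (diag_mat B) = take k (diag_mat B) @ [?b]"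
    using kn B by (simp add: take_Suc_conv_app_nth diag_mat_def)
  moreover have "poly_at_mat B (roots_poly (take k (diag_mat B)) * [:- ?b, 1:]) *\<^sub>v x
      = poly_at_mat B (roots_poly (take k (diag_mat B))) *\<^sub>v (poly_at_mat B [:- ?b, 1:] *\<^sub>v x)"
    unfolding poly_at_mat_mult[OF B] by (rule assoc_mult_mat_vec[OF poly_at_mat_carrier[OF B] poly_at_mat_carrier[OF B] Suc.prems(2)])
  ultimately show ?case unfolding y_def by (simp only: roots_poly_snoc)
qed

text \<open>The Cayley--Hamilton theorem in factored form, by Schur triangularisation.\<close>

lemma annihilating_roots_exist:
  fixes A :: "complex mat"
  assumes A: "A \<in> carrier_mat n n"
  obtains as where "set as \<subseteq> spectrum A" "poly_at_mat A (roots_poly as) = 0\<^sub>m n n"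
proof -
  obtain as where as: "char_poly A = (\<Prod>a\<leftarrow>as. [:- a, 1:])" using char_poly_factorized[OF A] by blast
  obtain B P Q where s: "schur_decomposition A as = (B, P, Q)" by (metis prod_cases3)
  from schur_decomposition[OF A as s] have w: "similar_mat_wit A B P Q" and ut: "upper_triangular B" and d: "diag_mat B = as" by auto
  have c: "B \<in> carrier_mat n n" "P \<in> carrier_mat n n" "Q \<in> carrier_mat n n" using similar_mat_witD2[OF A w] by auto
  have len: "length as = n" using d c by (auto simp: diag_mat_def)
  have "poly_at_mat B (roots_poly as) *\<^sub>v unit_vec n j = 0\<^sub>v n" if "j < n" for j
    using roots_poly_diag_kills_triangular[OF c(1) ut, of n "unit_vec n j"] d len by simp
  then have "poly_at_mat B (roots_poly as) $$ (i, j) = 0" if "i < n" "j < n" for i j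
  proof -
    have "(poly_at_mat B (roots_poly as) *\<^sub>v unit_vec n j) $ i = poly_at_mat B (roots_poly as) $$ (i, j)"
      using that poly_at_mat_dim[OF c(1)] by simp
    then show ?thesis using \<open>\<And>j. j < n \<Longrightarrow> poly_at_mat B (roots_poly as) *\<^sub>v unit_vec n j = 0\<^sub>v n\<close>[OF that(2)] that by simp
  qed
  then have "poly_at_mat B (roots_poly as) = 0\<^sub>m n n" using poly_at_mat_dim[OF c(1)] by (intro eq_matI) auto
  then have "poly_at_mat A (roots_poly as) = 0\<^sub>m n n" using poly_at_mat_similar[OF w A] c by simp
  moreover have "set as \<subseteq> spectrum A"
    using eigenvalue_root_char_poly[OF A] poly_roots_poly_eq_0[of as] by (auto simp: spectrum_def as roots_poly_def)
  ultimately show ?thesis using that by blast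
qed

text \<open>Functions of a fixed matrix, computed by interpolation at the zeros \<open>as\<close> of an annihilating
  polynomial. All zeros are eigenvalues, so every contour around the spectrum encloses them.\<close>

locale matrix_calculus =
  fixes A :: "complex mat" and n :: nat and as :: "complex list"
  assumes A: "A \<in> carrier_mat n n"
    and roots: "set as \<subseteq> spectrum A"
    and annihilated: "poly_at_mat A (roots_poly as) = 0\<^sub>m n n"
begin

text \<open>The relation \<open>X = \<phi>(A)\<close>: near the zeros, \<open>\<phi>\<close> is the polynomial \<open>q\<close> modulo the annihilating
  polynomial, and \<open>X = q(A)\<close>. The cofactor \<open>r\<close> is required to be continuous so that \<open>q(A)\<close> is
  determined by \<open>\<phi>\<close> also at multiple zeros. In this form products and Cauchy transforms of
  functions are immediate.\<close>

definition function_value :: "(complex \<Rightarrow> complex) \<Rightarrow> complex mat \<Rightarrow> bool" where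
  "function_value \<phi> X \<longleftrightarrow> (\<exists>q r U. open U \<and> set as \<subseteq> U \<and> continuous_on U r \<and>
     (\<forall>z\<in>U. \<phi> z = poly q z + poly (roots_poly as) z * r z) \<and> X = poly_at_mat A q)"

lemma function_valueE:
  assumes "function_value \<phi> X"
  obtains q r U where "open U" "set as \<subseteq> U" "continuous_on U r"
    "\<forall>z\<in>U. \<phi> z = poly q z + poly (roots_poly as) z * r z" "X = poly_at_mat A q"
  using assms unfolding function_value_def by blast

lemma function_value_carrier: "function_value \<phi> X \<Longrightarrow> X \<in> carrier_mat n n"
  using A by (auto simp: function_value_def)

lemma function_value_unique:
  assumes "function_value \<phi> X" "function_value \<phi> Y" shows "X = Y"
proof -
  obtain q r U where 1: "open U" "set as \<subseteq> U" "continuous_on U r"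
     "\<forall>z\<in>U. \<phi> z = poly q z + poly (roots_poly as) z * r z" "X = poly_at_mat A q"
    using function_valueE[OF assms(1)] .
  obtain q' r' U' where 2: "open U'" "set as \<subseteq> U'" "continuous_on U' r'"
     "\<forall>z\<in>U'. \<phi> z = poly q' z + poly (roots_poly as) z * r' z" "Y = poly_at_mat A q'"
    using function_valueE[OF assms(2)] .
  have "roots_poly as dvd q - q'"
  proof (rule roots_poly_dvd_of_factor[of "U \<inter> U'"])
    show "continuous_on (U \<inter> U') (\<lambda>z. r' z - r z)"
      using 1 2 by (intro continuous_on_diff) (auto intro: continuous_on_subset)
    show "poly (q - q') z = poly (roots_poly as) z * (r' z - r z)" if "z \<in> U \<inter> U'" for z
      using 1(4) 2(4) that by (auto simp: algebra_simps)
  qed (use 1 2 in auto)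
  then obtain s where "q = q' + roots_poly as * s" by (metis dvdE diff_add_cancel add.commute)
  then show ?thesis using 1 2 A
    by (simp add: poly_at_mat_add[OF A] poly_at_mat_mult[OF A] annihilated left_mult_zero_mat[of _ n n])
qed

lemma function_value_cong:
  assumes "function_value \<phi> X" "open V" "set as \<subseteq> V" "\<And>z. z \<in> V \<Longrightarrow> \<phi>' z = \<phi> z"
  shows "function_value \<phi>' X"
proof -
  obtain q r U where 1: "open U" "set as \<subseteq> U" "continuous_on U r"
     "\<forall>z\<in>U. \<phi> z = poly q z + poly (roots_poly as) z * r z" "X = poly_at_mat A q"
    using function_valueE[OF assms(1)] .
  show ?thesis unfolding function_value_def
    by (rule exI[of _ q], rule exI[of _ r], rule exI[of _ "U \<inter> V"])
       (use 1 assms in \<open>auto intro: continuous_on_subset\<close>)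
qed

lemma function_value_poly: "function_value (poly q) (poly_at_mat A q)"
  unfolding function_value_def by (rule exI[of _ q], rule exI[of _ "\<lambda>_. 0"], rule exI[of _ UNIV]) auto

lemma function_value_mult:
  assumes "function_value \<phi> X" "function_value \<psi> Y" shows "function_value (\<lambda>z. \<phi> z * \<psi> z) (X * Y)"
proof -
  obtain q r U where 1: "open U" "set as \<subseteq> U" "continuous_on U r"
     "\<forall>z\<in>U. \<phi> z = poly q z + poly (roots_poly as) z * r z" "X = poly_at_mat A q"
    using function_valueE[OF assms(1)] .
  obtain q' r' U' where 2: "open U'" "set as \<subseteq> U'" "continuous_on U' r'"
     "\<forall>z\<in>U'. \<psi> z = poly q' z + poly (roots_poly as) z * r' z" "Y = poly_at_mat A q'"
    using function_valueE[OF assms(2)] .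
  show ?thesis unfolding function_value_def
  proof (intro exI conjI ballI)
    show "continuous_on (U \<inter> U') (\<lambda>z. poly q z * r' z + poly q' z * r z + poly (roots_poly as) z * r z * r' z)"
      using 1 2 by (intro continuous_intros) (auto intro: continuous_on_subset)
    show "X * Y = poly_at_mat A (q * q')" using 1 2 by (simp add: poly_at_mat_mult[OF A])
  qed (use 1 2 in \<open>auto simp: algebra_simps\<close>)
qed

lemma function_value_diff:
  assumes "function_value \<phi> X" "function_value \<psi> Y" shows "function_value (\<lambda>z. \<phi> z - \<psi> z) (X - Y)"
proof -
  obtain q r U where 1: "open U" "set as \<subseteq> U" "continuous_on U r"
     "\<forall>z\<in>U. \<phi> z = poly q z + poly (roots_poly as) z * r z" "X = poly_at_mat A q"
    using function_valueE[OF assms(1)] .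
  obtain q' r' U' where 2: "open U'" "set as \<subseteq> U'" "continuous_on U' r'"
     "\<forall>z\<in>U'. \<psi> z = poly q' z + poly (roots_poly as) z * r' z" "Y = poly_at_mat A q'"
    using function_valueE[OF assms(2)] .
  have "poly_at_mat A q' + poly_at_mat A (q - q') = poly_at_mat A q" by (simp add: poly_at_mat_add[OF A, symmetric])
  then have "poly_at_mat A q - poly_at_mat A q' = (poly_at_mat A q' + poly_at_mat A (q - q')) - poly_at_mat A q'" by simp
  also have "\<dots> = poly_at_mat A (q - q')" using poly_at_mat_dim[OF A] by (intro eq_matI) auto
  finally have "poly_at_mat A (q - q') = poly_at_mat A q - poly_at_mat A q'" by simp
  then show ?thesis unfolding function_value_def using 1 2
    by (intro exI[of _ "q - q'"] exI[of _ "\<lambda>z. r z - r' z"] exI[of _ "U \<inter> U'"])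
       (auto simp: algebra_simps intro!: continuous_on_diff intro: continuous_on_subset)
qed

lemma function_value_cauchy_transform:
  assumes "\<gamma> C1_differentiable_on {0..1}" "continuous_on (path_image \<gamma>) \<psi>" "set as \<inter> path_image \<gamma> = {}"
  shows "function_value (cauchy_transform \<gamma> \<psi>) (poly_at_mat A (newton_interpolant \<gamma> as \<psi>))"
proof -
  let ?\<psi> = "\<lambda>z. \<psi> z / poly (roots_poly as) z"
  have "continuous_on (path_image \<gamma>) ?\<psi>"
    using assms by (intro continuous_intros) (auto simp: poly_roots_poly_eq_0)
  then have "continuous_on (- path_image \<gamma>) (cauchy_transform \<gamma> ?\<psi>)"
    using cauchy_transform_holomorphic[OF assms(1)] holomorphic_on_imp_continuous_on by blast
  moreover have "open (- path_image \<gamma>)" using closed_valid_path_image C1_valid_path[OF assms(1)] by blast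
  ultimately show ?thesis
    unfolding function_value_def using cauchy_transform_newton[OF assms(1,2,3)] assms(3)
    by (intro exI[of _ "newton_interpolant \<gamma> as \<psi>"] exI[of _ "cauchy_transform \<gamma> ?\<psi>"] exI[of _ "- path_image \<gamma>"]) auto
qed

lemma resolvent_poly_inverse:
  assumes "z \<notin> set as"
  shows "(z \<cdot>\<^sub>m 1\<^sub>m n - A) * poly_at_mat A (resolvent_poly as z) = 1\<^sub>m n"
    "poly_at_mat A (resolvent_poly as z) * (z \<cdot>\<^sub>m 1\<^sub>m n - A) = 1\<^sub>m n"
proof -
  have f: "poly_at_mat A [:z, -1:] = z \<cdot>\<^sub>m 1\<^sub>m n - A"
    unfolding poly_at_mat_linear[OF A] using A by (intro eq_matI) auto
  have "1 - Polynomial.smult (1 / poly (roots_poly as) z) (roots_poly as)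
      = 1 + Polynomial.smult (- (1 / poly (roots_poly as) z)) (roots_poly as)" by simp
  then have "poly_at_mat A ([:z, -1:] * resolvent_poly as z) = 1\<^sub>m n"
    unfolding resolvent_poly_identity[OF assms] by (simp only: poly_at_mat_add[OF A] poly_at_mat_smult[OF A] poly_at_mat_1[OF A] annihilated) (auto intro!: eq_matI)
  then show "(z \<cdot>\<^sub>m 1\<^sub>m n - A) * poly_at_mat A (resolvent_poly as z) = 1\<^sub>m n"
    "poly_at_mat A (resolvent_poly as z) * (z \<cdot>\<^sub>m 1\<^sub>m n - A) = 1\<^sub>m n"
    by (simp_all only: poly_at_mat_mult[OF A] f poly_at_mat_commute[OF A, of "resolvent_poly as z" "[:z, -1:]", unfolded f])
qed

lemma resolvent_eq:
  assumes "z \<notin> set as"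
  shows "resolvent A z = poly_at_mat A (resolvent_poly as z)"
proof -
  let ?M = "z \<cdot>\<^sub>m 1\<^sub>m n - A" let ?R = "poly_at_mat A (resolvent_poly as z)"
  have M: "?M \<in> carrier_mat n n" and R: "?R \<in> carrier_mat n n" using A by auto
  note inv = resolvent_poly_inverse[OF assms]
  have "?M \<in> Units (ring_mat TYPE(complex) n ())"
    using M R inv unfolding Units_def ring_mat_def by auto
  then obtain X where X: "mat_inverse ?M = Some X" using mat_inverse(1)[OF M, where b = "()"] by (cases "mat_inverse ?M") auto
  from mat_inverse(2)[OF M X] have "?M * X = 1\<^sub>m n" "X \<in> carrier_mat n n" by auto
  note MX = this
  have "X = (?R * ?M) * X" using MX by (simp add: inv(2))
  also have "\<dots> = ?R * (?M * X)" by (rule assoc_mult_mat[OF R M MX(2)])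
  also have "\<dots> = ?R" unfolding MX(1) by (rule right_mult_one_mat[OF R])
  finally have "X = ?R" .
  then show ?thesis using X A by (simp add: resolvent_def)
qed

lemma poly_functional_entry: "i < n \<Longrightarrow> j < n \<Longrightarrow> poly_functional (\<lambda>p. poly_at_mat A p $$ (i, j))"
  unfolding poly_functional_def using poly_at_mat_dim[OF A] by (simp add: poly_at_mat_add[OF A] poly_at_mat_smult[OF A])

text \<open>The contour integral that defines \<open>f(A)\<close> may be taken over a smooth loop with the same winding
  numbers. On the loop the resolvent is a polynomial in \<open>A\<close>, and the integral is the interpolant
  of the Cauchy transform of \<open>f\<close>, which is \<open>f\<close> itself near the spectrum.\<close>

lemma function_value_mat_fun:
  assumes "cauchy_contour f A \<gamma>0"
  shows "function_value f (mat_fun f A)"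
proof -
  define \<gamma> where "\<gamma> = (SOME \<gamma>. cauchy_contour f A \<gamma>)"
  have cc: "cauchy_contour f A \<gamma>" unfolding \<gamma>_def by (rule someI[where P = "cauchy_contour f A", OF assms])
  then have \<gamma>: "valid_path \<gamma>" "simple_path \<gamma>" "pathfinish \<gamma> = pathstart \<gamma>"
    and wind: "\<And>z. z \<in> inside (path_image \<gamma>) \<Longrightarrow> winding_number \<gamma> z = 1"
    and sp: "spectrum A \<subseteq> inside (path_image \<gamma>)"
    and an: "f analytic_on closure (inside (path_image \<gamma>))"
    unfolding cauchy_contour_def by auto
  have as: "set as \<subseteq> inside (path_image \<gamma>)" using roots sp by blast
  obtain S where S: "open S" "closure (inside (path_image \<gamma>)) \<subseteq> S" "f holomorphic_on S"
    using an by (auto simp: analytic_on_holomorphic)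
  have fr: "closure (inside (path_image \<gamma>)) = inside (path_image \<gamma>) \<union> path_image \<gamma>"
    using Jordan_inside_outside[OF \<gamma>(2,3)] by (simp add: closure_Un_frontier)
  have disj: "inside (path_image \<gamma>) \<inter> path_image \<gamma> = {}" using inside_no_overlap by blast
  \<comment> \<open>The integrand is holomorphic on \<open>T\<close>: it leaves out the poles of the resolvent.\<close>
  define T where "T = S - set as"
  have T: "open T" unfolding T_def by (intro open_Diff S finite_imp_closed) auto
  have T: "open T" "path_image \<gamma> \<subseteq> T" using T S(2) as disj unfolding T_def fr by blast+
  obtain p where p: "p C1_differentiable_on {0..1}" "path_image p \<subseteq> T" "pathfinish p = pathstart p"
    and eq: "\<And>F. F holomorphic_on T \<Longrightarrow> contour_integral p F = contour_integral \<gamma> F"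
    using C1_approximating_loop[OF T(1) \<gamma>(1) T(2) \<gamma>(3)] by blast
  have vp: "valid_path p" by (rule C1_valid_path[OF p(1)])
  have wp: "winding_number p w = winding_number \<gamma> w" if "w \<notin> T" for w
  proof -
    have "(\<lambda>z. 1 / (z - w)) holomorphic_on T" using that by (intro holomorphic_intros) auto
    then show ?thesis using eq that p T \<gamma> vp by (subst (1 2) winding_number_valid_path) auto
  qed
  have out: "winding_number p w = 0" if "w \<notin> S" for w
  proof -
    have "w \<in> outside (path_image \<gamma>)" using that S fr by (auto simp: outside_inside)
    then show ?thesis using wp[of w] that \<gamma> by (simp add: T_def winding_number_zero_in_outside valid_path_imp_path)
  qed
  have asp: "set as \<inter> path_image p = {}" using p(2) by (auto simp: T_def)
  have fcont: "continuous_on (path_image p) f"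
    by (rule continuous_on_subset[OF holomorphic_on_imp_continuous_on[OF S(3)]]) (use p(2) in \<open>auto simp: T_def\<close>)
  define q where "q = newton_interpolant p as f"
  have "function_value f (poly_at_mat A q)" unfolding q_def
  proof (rule function_value_cong[OF function_value_cauchy_transform[OF p(1) fcont asp]])
    show "open ({z. z \<notin> path_image p \<and> winding_number p z = 1} \<inter> S)"
      using open_winding_number_levelsets[OF valid_path_imp_path[OF vp] p(3)] S(1) by (auto intro: open_Int)
    show "set as \<subseteq> {z. z \<notin> path_image p \<and> winding_number p z = 1} \<inter> S"
      using as asp wp wind S fr by (auto simp: T_def)
    fix z assume z: "z \<in> {z. z \<notin> path_image p \<and> winding_number p z = 1} \<inter> S"
    have "((\<lambda>w. f w / (w - z)) has_contour_integral (2 * pi * \<i> * winding_number p z * f z)) p"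
      by (rule Cauchy_integral_formula_global[OF S(1,3) _ vp _ p(3) out]) (use z p(2) in \<open>auto simp: T_def\<close>)
    then show "f z = cauchy_transform p f z"
      using z by (simp add: cauchy_transform_def contour_integral_unique)
  qed
  moreover have "mat_fun f A = poly_at_mat A q"
  proof (rule eq_matI)
    fix i j assume "i < dim_row (poly_at_mat A q)" "j < dim_col (poly_at_mat A q)"
    then have ij: "i < n" "j < n" using poly_at_mat_dim[OF A] by auto
    let ?L = "\<lambda>p. poly_at_mat A p $$ (i, j)"
    have L: "poly_functional ?L" by (rule poly_functional_entry[OF ij])
    have "contour_integral \<gamma> (\<lambda>z. f z * resolvent A z $$ (i, j)) = contour_integral \<gamma> (\<lambda>z. f z * ?L (resolvent_poly as z))"
      by (rule contour_integral_eq) (use T(2) in \<open>auto simp: resolvent_eq T_def\<close>)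
    also have "\<dots> = contour_integral p (\<lambda>z. f z * ?L (resolvent_poly as z))"
    proof (rule eq[symmetric], intro holomorphic_on_mult)
      show "f holomorphic_on T" using S(3) by (rule holomorphic_on_subset) (auto simp: T_def)
      show "(\<lambda>z. ?L (resolvent_poly as z)) holomorphic_on T"
        by (rule holomorphic_functional_resolvent_poly[OF L]) (auto simp: T_def)
    qed
    also have "\<dots> = 2 * pi * \<i> * ?L q"
      unfolding q_def by (rule contour_integral_unique[OF integral_functional_resolvent_poly[OF p(1) fcont asp L]])
    finally show "mat_fun f A $$ (i, j) = poly_at_mat A q $$ (i, j)"
      using ij A unfolding mat_fun_def Let_def \<gamma>_def[symmetric] by simp
  qed (use A in \<open>auto simp: mat_fun_def Let_def\<close>)
  ultimately show ?thesis by simp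
qed

end

section \<open>Numerical ranges\<close>

lemma cinner_sum:
  fixes u w :: "complex vec"
  assumes "w \<in> carrier_vec n"
  shows "u \<bullet>c w = (\<Sum>i<n. u $ i * cnj (w $ i))"
  using assms by (simp add: scalar_prod_def lessThan_atLeast0)

lemma vec_norm2_sq:
  fixes u :: "complex vec"
  assumes "u \<in> carrier_vec n"
  shows "(vec_norm2 u)\<^sup>2 = (\<Sum>i<n. (cmod (u $ i))\<^sup>2)"
  using assms by (simp add: vec_norm2_def L2_set_def sum_nonneg)

lemma vec_norm2_nonneg [simp]: "vec_norm2 u \<ge> 0"
  by (simp add: vec_norm2_def)

lemma cinner_self:
  fixes u :: "complex vec"
  assumes "u \<in> carrier_vec n"
  shows "u \<bullet>c u = of_real ((vec_norm2 u)\<^sup>2)"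
  unfolding vec_norm2_sq[OF assms] cinner_sum[OF assms] of_real_sum
  by (intro sum.cong refl) (simp add: complex_norm_square[symmetric])

lemma cinner_add_left:
  fixes u v w :: "complex vec"
  assumes "u \<in> carrier_vec n" "v \<in> carrier_vec n" "w \<in> carrier_vec n"
  shows "(u + v) \<bullet>c w = u \<bullet>c w + v \<bullet>c w"
  using assms by (simp add: cinner_sum[OF assms(3)] algebra_simps sum.distrib)

lemma cinner_smult_left:
  fixes u w :: "complex vec"
  assumes "u \<in> carrier_vec n" "w \<in> carrier_vec n"
  shows "(c \<cdot>\<^sub>v u) \<bullet>c w = c * (u \<bullet>c w)"
  using assms by (simp add: cinner_sum[OF assms(2)] sum_distrib_left mult_ac)

lemma cinner_cnj:
  fixes u w :: "complex vec"
  assumes "u \<in> carrier_vec n" "w \<in> carrier_vec n"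
  shows "cnj (u \<bullet>c w) = w \<bullet>c u"
  by (simp add: cinner_sum[OF assms(1)] cinner_sum[OF assms(2)] mult_ac)

lemma cinner_add_right:
  fixes u v w :: "complex vec"
  assumes "u \<in> carrier_vec n" "v \<in> carrier_vec n" "w \<in> carrier_vec n"
  shows "w \<bullet>c (u + v) = w \<bullet>c u + w \<bullet>c v"
  using assms by (simp add: cinner_sum[of _ n] algebra_simps sum.distrib)

lemma cinner_smult_right:
  fixes u w :: "complex vec"
  assumes "u \<in> carrier_vec n" "w \<in> carrier_vec n"
  shows "w \<bullet>c (c \<cdot>\<^sub>v u) = cnj c * (w \<bullet>c u)"
  using assms by (simp add: cinner_sum[of _ n] sum_distrib_left mult_ac)

lemma cauchy_schwarz:
  fixes u w :: "complex vec"
  assumes "u \<in> carrier_vec n" "w \<in> carrier_vec n"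
  shows "cmod (u \<bullet>c w) \<le> vec_norm2 u * vec_norm2 w"
proof -
  have "cmod (u \<bullet>c w) \<le> (\<Sum>i<n. cmod (u $ i * cnj (w $ i)))"
    unfolding cinner_sum[OF assms(2)] by (rule norm_sum)
  also have "\<dots> = (\<Sum>i<n. \<bar>cmod (u $ i)\<bar> * \<bar>cmod (w $ i)\<bar>)" by (simp add: norm_mult)
  also have "\<dots> \<le> L2_set (\<lambda>i. cmod (u $ i)) {..<n} * L2_set (\<lambda>i. cmod (w $ i)) {..<n}"
    by (rule L2_set_mult_ineq)
  finally show ?thesis using assms by (simp add: vec_norm2_def)
qed

lemma vec_norm2_smult:
  fixes u :: "complex vec"
  shows "vec_norm2 (c \<cdot>\<^sub>v u) = cmod c * vec_norm2 u"
proof -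
  have "vec_norm2 (c \<cdot>\<^sub>v u) = L2_set (\<lambda>i. cmod c * cmod (u $ i)) {..<dim_vec u}"
    unfolding vec_norm2_def by (intro L2_set_cong) (auto simp: norm_mult)
  then show ?thesis by (simp add: vec_norm2_def L2_set_left_distrib L2_set_right_distrib)
qed

lemma vec_norm2_eq_0_iff:
  fixes u :: "complex vec"
  assumes "u \<in> carrier_vec n"
  shows "vec_norm2 u = 0 \<longleftrightarrow> u = 0\<^sub>v n"
  using assms unfolding vec_norm2_def by (auto simp: L2_set_eq_0_iff intro!: eq_vecI)

lemma vec_norm2_pos:
  fixes u :: "complex vec"
  assumes "u \<in> carrier_vec n" "u \<noteq> 0\<^sub>v n"
  shows "vec_norm2 u > 0"
  using vec_norm2_eq_0_iff[OF assms(1)] assms(2) vec_norm2_nonneg[of u] by linarith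

lemma vec_norm2_triangle_minus:
  fixes u w :: "complex vec"
  assumes "u \<in> carrier_vec n" "w \<in> carrier_vec n"
  shows "vec_norm2 (u - w) \<le> vec_norm2 u + vec_norm2 w"
proof -
  have "vec_norm2 (u - w) = L2_set (\<lambda>i. cmod (u $ i - w $ i)) {..<n}"
    unfolding vec_norm2_def using assms by (auto intro!: L2_set_cong)
  also have "\<dots> \<le> L2_set (\<lambda>i. cmod (u $ i) + cmod (w $ i)) {..<n}"
    by (intro L2_set_mono norm_triangle_ineq4) auto
  also have "\<dots> \<le> vec_norm2 u + vec_norm2 w"
    unfolding vec_norm2_def using assms L2_set_triangle_ineq[of "\<lambda>i. cmod (u $ i)" "\<lambda>i. cmod (w $ i)" "{..<n}"] by simp
  finally show ?thesis .
qed

lemma mat_adjoint_carrier [simp]: "X \<in> carrier_mat n m \<Longrightarrow> mat_adjoint X \<in> carrier_mat m n"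
  by (auto simp: mat_adjoint_def)

lemma mat_adjoint_index:
  fixes X :: "complex mat"
  shows "i < dim_col X \<Longrightarrow> j < dim_row X \<Longrightarrow> mat_adjoint X $$ (i, j) = cnj (X $$ (j, i))"
  by (simp add: mat_adjoint_def mat_of_rows_index)

lemma mat_mult_cinner_sum:
  fixes u w :: "complex vec"
  assumes "X \<in> carrier_mat n n" "u \<in> carrier_vec n" "w \<in> carrier_vec n"
  shows "(X *\<^sub>v u) \<bullet>c w = (\<Sum>i<n. \<Sum>j<n. X $$ (i, j) * u $ j * cnj (w $ i))"
  unfolding cinner_sum[OF assms(3)] using assms
  by (intro sum.cong refl) (simp add: scalar_prod_def lessThan_atLeast0 sum_distrib_right)

lemma mat_adjoint_cinner:
  fixes u w :: "complex vec"
  assumes "X \<in> carrier_mat n n" "u \<in> carrier_vec n" "w \<in> carrier_vec n"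
  shows "(X *\<^sub>v u) \<bullet>c w = u \<bullet>c (mat_adjoint X *\<^sub>v w)"
proof -
  have "(mat_adjoint X *\<^sub>v w) \<bullet>c u = (\<Sum>i<n. \<Sum>j<n. cnj (X $$ (j, i)) * w $ j * cnj (u $ i))"
    unfolding mat_mult_cinner_sum[OF mat_adjoint_carrier[OF assms(1)] assms(3,2)]
    using assms by (intro sum.cong refl) (auto simp: mat_adjoint_index)
  then have "cnj ((mat_adjoint X *\<^sub>v w) \<bullet>c u) = (\<Sum>i<n. \<Sum>j<n. X $$ (j, i) * u $ i * cnj (w $ j))"
    by (simp add: mult_ac)
  also have "\<dots> = (X *\<^sub>v u) \<bullet>c w"
    unfolding mat_mult_cinner_sum[OF assms] by (rule sum.swap)
  finally show ?thesis
    using cinner_cnj[OF mult_mat_vec_carrier[OF mat_adjoint_carrier[OF assms(1)] assms(3)] assms(2)] by simp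
qed

text \<open>Coordinates of unit vectors, extended by zero to sequences, so that compactness can be taken
  in the product topology.\<close>

definition coord_sphere :: "nat \<Rightarrow> (nat \<Rightarrow> complex) set" where
  "coord_sphere n = {x. (\<forall>i\<ge>n. x i = 0) \<and> (\<Sum>i<n. (cmod (x i))\<^sup>2) = 1}"

lemma continuous_on_coordinate [continuous_intros]: "continuous_on S (\<lambda>x :: nat \<Rightarrow> complex. x i)"
  by (rule continuous_on_subset[OF continuous_on_product_coordinates]) auto

text \<open>An instance of Tychonoff's theorem.\<close>

lemma compact_coord_box: "compact {x :: nat \<Rightarrow> complex. (\<forall>i\<ge>n. x i = 0) \<and> (\<forall>i<n. cmod (x i) \<le> b)}"
proof -
  let ?S = "\<lambda>i. if i < n then cball (0::complex) b else {0}"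
  have "compactin (product_topology (\<lambda>i::nat. euclidean :: complex topology) UNIV) (PiE UNIV ?S)"
    unfolding compactin_PiE by auto
  then have "compact (PiE UNIV ?S)" by (simp add: euclidean_product_topology compactin_euclidean_iff)
  moreover have "PiE UNIV ?S = {x. (\<forall>i\<ge>n. x i = 0) \<and> (\<forall>i<n. cmod (x i) \<le> b)}"
  proof -
    have "(x i \<in> ?S i) \<longleftrightarrow> (i \<ge> n \<longrightarrow> x i = 0) \<and> (i < n \<longrightarrow> cmod (x i) \<le> b)" for x :: "nat \<Rightarrow> complex" and i by simp
    then show ?thesis by (simp only: PiE_UNIV_domain Pi_def) blast
  qed
  ultimately show ?thesis by simp
qed

lemma compact_coord_sphere: "compact (coord_sphere n)"
proof -
  let ?B = "{x :: nat \<Rightarrow> complex. (\<forall>i\<ge>n. x i = 0) \<and> (\<forall>i<n. cmod (x i) \<le> 1)}"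
  have "cmod (x i) \<le> 1" if "x \<in> coord_sphere n" "i < n" for x i
  proof -
    have "(cmod (x i))\<^sup>2 \<le> (\<Sum>i<n. (cmod (x i))\<^sup>2)" using that(2) by (intro member_le_sum) auto
    then show ?thesis using that(1) by (simp add: coord_sphere_def abs_square_le_1)
  qed
  then have eq: "coord_sphere n = ?B \<inter> {x. (\<Sum>i<n. (cmod (x i))\<^sup>2) = 1}" by (auto simp: coord_sphere_def)
  have "closed {x :: nat \<Rightarrow> complex. (\<Sum>i<n. (cmod (x i))\<^sup>2) = 1}"
    by (intro closed_Collect_eq continuous_intros)
  then show ?thesis unfolding eq by (intro compact_Int_closed compact_coord_box)
qed

lemma numerical_range_image:
  assumes A: "A \<in> carrier_mat n n"
  shows "numerical_range A = (\<lambda>x. \<Sum>i<n. \<Sum>j<n. A $$ (i, j) * x j * cnj (x i)) ` coord_sphere n"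
proof safe
  fix \<omega> assume "\<omega> \<in> numerical_range A"
  then obtain z where z: "z \<in> carrier_vec n" "vec_norm2 z = 1" "\<omega> = (A *\<^sub>v z) \<bullet>c z"
    using A by (auto simp: numerical_range_def)
  define x where "x i = (if i < n then z $ i else 0)" for i
  have "x \<in> coord_sphere n" using vec_norm2_sq[OF z(1)] z(2) by (auto simp: coord_sphere_def x_def)
  moreover have "\<omega> = (\<Sum>i<n. \<Sum>j<n. A $$ (i, j) * x j * cnj (x i))"
    unfolding z(3) mat_mult_cinner_sum[OF A z(1,1)] by (simp add: x_def)
  ultimately show "\<omega> \<in> (\<lambda>x. \<Sum>i<n. \<Sum>j<n. A $$ (i, j) * x j * cnj (x i)) ` coord_sphere n" by blast
next
  fix x assume x: "x \<in> coord_sphere n"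
  define z where "z = vec n x"
  have z: "z \<in> carrier_vec n" by (simp add: z_def)
  have "(vec_norm2 z)\<^sup>2 = 1" using x unfolding vec_norm2_sq[OF z] by (simp add: z_def coord_sphere_def)
  then have "vec_norm2 z = 1" using vec_norm2_nonneg[of z] by (simp add: power2_eq_1_iff)
  moreover have "(A *\<^sub>v z) \<bullet>c z = (\<Sum>i<n. \<Sum>j<n. A $$ (i, j) * x j * cnj (x i))"
    unfolding mat_mult_cinner_sum[OF A z z] by (simp add: z_def)
  ultimately show "(\<Sum>i<n. \<Sum>j<n. A $$ (i, j) * x j * cnj (x i)) \<in> numerical_range A"
    using A z unfolding numerical_range_def by (intro CollectI exI[of _ z]) auto
qed

lemma compact_numerical_range:
  assumes "A \<in> carrier_mat n n" shows "compact (numerical_range A)"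
  unfolding numerical_range_image[OF assms]
  by (intro compact_continuous_image compact_coord_sphere continuous_intros)

text \<open>Normalising \<open>x\<close> lets the numerical range be used through quadratic forms of arbitrary nonzero
  vectors.\<close>

lemma rayleigh_in_numerical_range:
  fixes x :: "complex vec"
  assumes A: "A \<in> carrier_mat n n" and x: "x \<in> carrier_vec n" "x \<noteq> 0\<^sub>v n"
  obtains \<omega> where "\<omega> \<in> numerical_range A" "(A *\<^sub>v x) \<bullet>c x = of_real ((vec_norm2 x)\<^sup>2) * \<omega>"
proof -
  define r where "r = vec_norm2 x"
  have r: "r > 0" using vec_norm2_pos[OF x] by (simp add: r_def)
  define z where "z = of_real (1 / r) \<cdot>\<^sub>v x"
  have z: "z \<in> carrier_vec n" using x by (simp add: z_def)
  have "vec_norm2 z = 1" using r by (simp add: z_def vec_norm2_smult r_def[symmetric] norm_divide)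
  then have "(A *\<^sub>v z) \<bullet>c z \<in> numerical_range A" using A z by (auto simp: numerical_range_def)
  moreover have "(A *\<^sub>v z) \<bullet>c z = of_real (1 / r) * (of_real (1 / r) * ((A *\<^sub>v x) \<bullet>c x))"
    unfolding z_def mult_mat_vec[OF A x(1)]
    using A x by (simp add: cinner_smult_left[of _ n] cinner_smult_right[of _ n])
  then have "(A *\<^sub>v x) \<bullet>c x = of_real (r\<^sup>2) * ((A *\<^sub>v z) \<bullet>c z)"
    using r by (simp add: power2_eq_square)
  ultimately show ?thesis using that by (simp add: r_def)
qed

lemma spectrum_subset_numerical_range:
  assumes A: "A \<in> carrier_mat n n" shows "spectrum A \<subseteq> numerical_range A"
proof
  fix k assume "k \<in> spectrum A"
  then obtain v where v: "v \<in> carrier_vec n" "v \<noteq> 0\<^sub>v n" "A *\<^sub>v v = k \<cdot>\<^sub>v v"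
    using A by (auto simp: spectrum_def eigenvalue_def eigenvector_def)
  obtain \<omega> where "\<omega> \<in> numerical_range A" "(A *\<^sub>v v) \<bullet>c v = of_real ((vec_norm2 v)\<^sup>2) * \<omega>"
    using rayleigh_in_numerical_range[OF A v(1,2)] .
  moreover have "(A *\<^sub>v v) \<bullet>c v = of_real ((vec_norm2 v)\<^sup>2) * k"
    unfolding v(3) cinner_smult_left[OF v(1,1)] cinner_self[OF v(1)] by simp
  ultimately show "k \<in> numerical_range A" using vec_norm2_pos[OF v(1,2)] by auto
qed

lemma numerical_range_nonempty:
  assumes A: "A \<in> carrier_mat n n" and n: "n \<ge> 1" shows "numerical_range A \<noteq> {}"
proof -
  have "unit_vec n 0 \<noteq> (0\<^sub>v n :: complex vec)"
  proof
    assume "unit_vec n 0 = (0\<^sub>v n :: complex vec)"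
    then have "(unit_vec n 0 :: complex vec) $ 0 = 0\<^sub>v n $ 0" by simp
    then show False using n by simp
  qed
  then show ?thesis using rayleigh_in_numerical_range[OF A unit_vec_carrier] by blast
qed

text \<open>The Toeplitz--Hausdorff theorem. Normalise by an affine map so that the two given values
  become 0 and 1, attained at \<open>x\<close> and \<open>y\<close>. After multiplying \<open>y\<close> by a suitable unimodular number the
  form \<open>s\<close> is real on the real combinations of \<open>x\<close> and \<open>y\<close>. Along the segment from \<open>x\<close> to \<open>y\<close> the quotient
  \<open>s(z, z) / \<parallel>z\<parallel>\<^sup>2\<close> is continuous and goes from 0 to 1, so it takes every value between.\<close>

theorem convex_numerical_range:
  assumes A: "A \<in> carrier_mat n n" shows "convex (numerical_range A)"
  unfolding convex_alt
proof (intro ballI allI impI)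
  fix \<alpha> \<beta> and t :: real
  assume \<alpha>: "\<alpha> \<in> numerical_range A" and \<beta>: "\<beta> \<in> numerical_range A" and t: "0 \<le> t \<and> t \<le> 1"
  show "(1 - t) *\<^sub>R \<alpha> + t *\<^sub>R \<beta> \<in> numerical_range A"
  proof (cases "\<alpha> = \<beta>")
    case True
    then show ?thesis using \<alpha> by (simp add: algebra_simps)
  next
    case False
    obtain x where x: "x \<in> carrier_vec n" "vec_norm2 x = 1" "\<alpha> = (A *\<^sub>v x) \<bullet>c x"
      using \<alpha> A by (auto simp: numerical_range_def)
    obtain y where y: "y \<in> carrier_vec n" "vec_norm2 y = 1" "\<beta> = (A *\<^sub>v y) \<bullet>c y"
      using \<beta> A by (auto simp: numerical_range_def)
    \<comment> \<open>The form \<open>s\<close> belongs to the matrix \<open>\<kappa> (A - \<alpha>)\<close>.\<close>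
    define \<kappa> where "\<kappa> = 1 / (\<beta> - \<alpha>)"
    have \<kappa>: "\<kappa> * (\<beta> - \<alpha>) = 1" using False by (simp add: \<kappa>_def)
    define s where "s u w = \<kappa> * ((A *\<^sub>v u) \<bullet>c w - \<alpha> * (u \<bullet>c w))" for u w
    have Ac: "A *\<^sub>v u \<in> carrier_vec n" if "u \<in> carrier_vec n" for u using A that by simp
    have s_add_left: "s (u + v) w = s u w + s v w" if "u \<in> carrier_vec n" "v \<in> carrier_vec n" "w \<in> carrier_vec n" for u v w
      using that Ac unfolding s_def mult_add_distrib_mat_vec[OF A that(1,2)]
      by (simp add: cinner_add_left[of _ n] algebra_simps)
    have s_add_right: "s w (u + v) = s w u + s w v" if "u \<in> carrier_vec n" "v \<in> carrier_vec n" "w \<in> carrier_vec n" for u v w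
      using that Ac unfolding s_def
      by (simp add: cinner_add_right[of _ n] algebra_simps)
    have s_smult_left: "s (c \<cdot>\<^sub>v u) w = c * s u w" if "u \<in> carrier_vec n" "w \<in> carrier_vec n" for c u w
      using that Ac unfolding s_def mult_mat_vec[OF A that(1)]
      by (simp add: cinner_smult_left[of _ n] algebra_simps)
    have s_smult_right: "s w (c \<cdot>\<^sub>v u) = cnj c * s w u" if "u \<in> carrier_vec n" "w \<in> carrier_vec n" for c u w
      using that Ac unfolding s_def
      by (simp add: cinner_smult_right[of _ n] algebra_simps)
    have sxx: "s x x = 0" unfolding s_def x(3)[symmetric] cinner_self[OF x(1)] x(2) by simp
    have syy: "s y y = 1" unfolding s_def y(3)[symmetric] cinner_self[OF y(1)] y(2) using \<kappa> by simp
    \<comment> \<open>The phase \<open>c\<close> is chosen to make \<open>c d\<close> real, which is to say that \<open>s(x, c y) + s(c y, x)\<close> is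
      real.\<close>
    define d where "d = s y x - cnj (s x y)"
    define c where "c = (if d = 0 then 1 else cnj d / cmod d)"
    have c1: "cmod c = 1" by (simp add: c_def norm_divide)
    have cd: "Im (c * d) = 0"
    proof (cases "d = 0")
      case False
      have "c * d = of_real (cmod d)" using False
        by (simp add: c_def complex_norm_square[symmetric] mult.commute power2_eq_square)
      then show ?thesis by simp
    qed simp
    define y' where "y' = c \<cdot>\<^sub>v y"
    have y': "y' \<in> carrier_vec n" "vec_norm2 y' = 1" using y(1,2) c1 by (simp_all add: y'_def vec_norm2_smult)
    have cc: "c * cnj c = 1" using c1 by (simp add: complex_norm_square[symmetric])
    have syy': "s y' y' = 1" using y(1) syy cc by (simp add: y'_def s_smult_left s_smult_right mult.commute)
    define g where "g = Re (s x y' + s y' x)"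
    have g: "s x y' + s y' x = of_real g"
    proof -
      have "s x y' + s y' x = cnj c * s x y + c * s y x"
        using x(1) y(1) by (simp add: y'_def s_smult_left s_smult_right)
      then have "Im (s x y' + s y' x) = Im (c * d)" by (simp add: d_def algebra_simps)
      then show ?thesis using cd by (simp add: complex_eq_iff g_def)
    qed
    define z where "z \<tau> = of_real (1 - \<tau>) \<cdot>\<^sub>v x + of_real \<tau> \<cdot>\<^sub>v y'" for \<tau> :: real
    have z: "z \<tau> \<in> carrier_vec n" for \<tau> using x(1) y'(1) by (simp add: z_def)
    have szz: "s (z \<tau>) (z \<tau>) = of_real (\<tau> * (1 - \<tau>) * g + \<tau>\<^sup>2)" for \<tau>
    proof -
      have "s (a \<cdot>\<^sub>v x + b \<cdot>\<^sub>v y') (a \<cdot>\<^sub>v x + b \<cdot>\<^sub>v y')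
          = a * cnj b * s x y' + b * cnj a * s y' x + b * cnj b" for a b
      proof -
        have cx: "a \<cdot>\<^sub>v x \<in> carrier_vec n" and cy: "b \<cdot>\<^sub>v y' \<in> carrier_vec n"
          and cz: "a \<cdot>\<^sub>v x + b \<cdot>\<^sub>v y' \<in> carrier_vec n" using x(1) y'(1) by simp_all
        show ?thesis
          by (simp only: s_add_left[OF cx cy cz] s_add_right[OF cx cy cx] s_add_right[OF cx cy cy]
              s_smult_left[OF x(1) cx] s_smult_left[OF x(1) cy] s_smult_left[OF y'(1) cx] s_smult_left[OF y'(1) cy]
              s_smult_right[OF x(1) x(1)] s_smult_right[OF x(1) y'(1)] s_smult_right[OF y'(1) x(1)] s_smult_right[OF y'(1) y'(1)]
              sxx syy') (simp add: mult_ac)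
      qed
      from this[of "of_real (1 - \<tau>)" "of_real \<tau>"]
      have "s (z \<tau>) (z \<tau>) = of_real (1 - \<tau>) * of_real \<tau> * (s x y' + s y' x) + of_real \<tau> * of_real \<tau>"
        unfolding z_def by (simp add: algebra_simps)
      then show ?thesis unfolding g by (simp add: power2_eq_square)
    qed
    have z0: "z \<tau> \<noteq> 0\<^sub>v n" for \<tau>
    proof
      assume z0: "z \<tau> = 0\<^sub>v n"
      have x_eq: "of_real (1 - \<tau>) \<cdot>\<^sub>v x = of_real (- \<tau>) \<cdot>\<^sub>v y'"
      proof (rule eq_vecI)
        fix i assume "i < dim_vec (of_real (- \<tau>) \<cdot>\<^sub>v y')"
        then have i: "i < n" using y'(1) by simp
        have "(of_real (1 - \<tau>) \<cdot>\<^sub>v x + of_real \<tau> \<cdot>\<^sub>v y') $ i = 0" using z0 i by (simp add: z_def)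
        then show "(of_real (1 - \<tau>) \<cdot>\<^sub>v x) $ i = (of_real (- \<tau>) \<cdot>\<^sub>v y') $ i"
          using i x(1) y'(1) by (simp add: add_eq_0_iff2)
      qed (use x(1) y'(1) in simp)
      have 1: "s (a \<cdot>\<^sub>v x) (a \<cdot>\<^sub>v x) = 0" for a
        using s_smult_left[OF x(1) smult_carrier_vec[THEN iffD2, OF x(1)]] s_smult_right[OF x(1) x(1)] sxx by simp
      have 2: "s (a \<cdot>\<^sub>v y') (a \<cdot>\<^sub>v y') = a * cnj a" for a
        using s_smult_left[OF y'(1) smult_carrier_vec[THEN iffD2, OF y'(1)]] s_smult_right[OF y'(1) y'(1)] syy' by simp
      have "of_real (- \<tau>) * cnj (of_real (- \<tau>)) = (0 :: complex)"
        using 1[of "of_real (1 - \<tau>)"] unfolding x_eq 2 .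
      then have "\<tau> = 0" by simp
      then have "vec_norm2 (of_real (- \<tau>) \<cdot>\<^sub>v y') = 0" "vec_norm2 (of_real (1 - \<tau>) \<cdot>\<^sub>v x) = 1"
        using x(2) by (simp_all add: vec_norm2_smult)
      then show False unfolding x_eq by simp
    qed
    define N where "N \<tau> = (1 - \<tau>)\<^sup>2 + \<tau>\<^sup>2 + 2 * \<tau> * (1 - \<tau>) * Re (x \<bullet>c y')" for \<tau> :: real
    have N: "(vec_norm2 (z \<tau>))\<^sup>2 = N \<tau>" for \<tau>
    proof -
      have "(a \<cdot>\<^sub>v x + b \<cdot>\<^sub>v y') \<bullet>c (a \<cdot>\<^sub>v x + b \<cdot>\<^sub>v y')
          = a * cnj a + a * cnj b * (x \<bullet>c y') + b * cnj a * (y' \<bullet>c x) + b * cnj b" for a b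
      proof -
        have cx: "a \<cdot>\<^sub>v x \<in> carrier_vec n" and cy: "b \<cdot>\<^sub>v y' \<in> carrier_vec n"
          and cz: "a \<cdot>\<^sub>v x + b \<cdot>\<^sub>v y' \<in> carrier_vec n" using x(1) y'(1) by simp_all
        show ?thesis
          by (simp only: cinner_add_left[OF cx cy cz] cinner_add_right[OF cx cy cx] cinner_add_right[OF cx cy cy]
              cinner_smult_left[OF x(1) cx] cinner_smult_left[OF x(1) cy] cinner_smult_left[OF y'(1) cx] cinner_smult_left[OF y'(1) cy]
              cinner_smult_right[OF x(1) x(1)] cinner_smult_right[OF x(1) y'(1)] cinner_smult_right[OF y'(1) x(1)] cinner_smult_right[OF y'(1) y'(1)]
              cinner_self[OF x(1)] cinner_self[OF y'(1)] x(2) y'(2)) (simp add: mult_ac)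
      qed
      from this[of "of_real (1 - \<tau>)" "of_real \<tau>"]
      have "z \<tau> \<bullet>c z \<tau> = of_real (1 - \<tau>) * of_real (1 - \<tau>) + of_real \<tau> * of_real \<tau>
          + of_real \<tau> * of_real (1 - \<tau>) * (x \<bullet>c y' + y' \<bullet>c x)"
        unfolding z_def by (simp add: algebra_simps)
      also have "x \<bullet>c y' + y' \<bullet>c x = of_real (2 * Re (x \<bullet>c y'))"
        using cinner_cnj[OF x(1) y'(1)] complex_add_cnj by metis
      finally have "z \<tau> \<bullet>c z \<tau> = of_real (N \<tau>)" by (simp add: N_def power2_eq_square)
      then show ?thesis unfolding cinner_self[OF z] of_real_eq_iff .
    qed
    have Npos: "N \<tau> > 0" for \<tau> unfolding N[symmetric] by (rule zero_less_power[OF vec_norm2_pos[OF z z0]])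
    define F where "F \<tau> = (\<tau> * (1 - \<tau>) * g + \<tau>\<^sup>2) / N \<tau>" for \<tau>
    have "continuous_on {0..1} F"
      unfolding F_def N_def using Npos[unfolded N_def] by (intro continuous_intros) (metis less_irrefl)
    moreover have "F 0 \<le> t" "t \<le> F 1" using t by (auto simp: F_def N_def)
    ultimately obtain \<tau> where \<tau>: "0 \<le> \<tau>" "\<tau> \<le> 1" "F \<tau> = t" using IVT'[of F 0 t 1] by auto
    obtain \<omega> where \<omega>: "\<omega> \<in> numerical_range A" "(A *\<^sub>v z \<tau>) \<bullet>c z \<tau> = of_real ((vec_norm2 (z \<tau>))\<^sup>2) * \<omega>"
      using rayleigh_in_numerical_range[OF A z z0] .
    have "of_real (N \<tau> * t) = s (z \<tau>) (z \<tau>)"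
      unfolding szz using \<tau>(3) Npos[of \<tau>] by (simp add: F_def field_simps)
    also have "\<dots> = of_real (N \<tau>) * (\<kappa> * (\<omega> - \<alpha>))"
      unfolding s_def \<omega>(2) cinner_self[OF z] N by (simp add: algebra_simps)
    finally have "of_real t = \<kappa> * (\<omega> - \<alpha>)" using Npos[of \<tau>] by simp
    then have "of_real t * (\<beta> - \<alpha>) = (\<kappa> * (\<beta> - \<alpha>)) * (\<omega> - \<alpha>)" by (simp add: mult_ac)
    then have "\<omega> - \<alpha> = of_real t * (\<beta> - \<alpha>)" unfolding \<kappa> by simp
    then have "\<omega> = (1 - t) *\<^sub>R \<alpha> + t *\<^sub>R \<beta>" by (simp add: scaleR_conv_of_real algebra_simps)
    then show ?thesis using \<omega> by simp
  qed
qed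

section \<open>The Crouzeix--Palencia bound\<close>

lemma smult_mat_mult_vec:
  fixes X :: "'a :: comm_ring_1 mat"
  assumes "X \<in> carrier_mat n m" "x \<in> carrier_vec m"
  shows "(c \<cdot>\<^sub>m X) *\<^sub>v x = c \<cdot>\<^sub>v (X *\<^sub>v x)"
  using assms by (intro eq_vecI) (auto simp: scalar_prod_def sum_distrib_left mult_ac)

context matrix_calculus
begin

lemma poly_at_mat_in_carrier [simp]: "poly_at_mat A p \<in> carrier_mat n n" by (rule poly_at_mat_carrier[OF A])

lemma poly_functional_form:
  assumes "u \<in> carrier_vec n" "w \<in> carrier_vec n"
  shows "poly_functional (\<lambda>p. (poly_at_mat A p *\<^sub>v u) \<bullet>c w)"
  unfolding poly_functional_def mat_mult_cinner_sum[OF poly_at_mat_in_carrier assms]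
  using poly_at_mat_dim[OF A] by (simp add: poly_at_mat_add[OF A] poly_at_mat_smult[OF A] sum.distrib sum_distrib_left algebra_simps)

end

locale matrix_in_curve = matrix_calculus A n as + convex_curve \<gamma> \<rho>
  for A n as \<gamma> \<rho> +
  assumes numrange: "numerical_range A \<subseteq> region"
begin

lemma roots_in_region: "set as \<subseteq> region"
  using roots spectrum_subset_numerical_range[OF A] numrange by blast

lemma roots_off_path: "set as \<inter> path_image \<gamma> = {}"
  using roots_in_region path_image_not_region by blast

abbreviation transform_mat :: "(complex \<Rightarrow> complex) \<Rightarrow> complex mat" where
  "transform_mat \<psi> \<equiv> poly_at_mat A (newton_interpolant \<gamma> as \<psi>)"

lemma function_value_transform: "continuous_on (path_image \<gamma>) \<psi> \<Longrightarrow> function_value (cauchy_transform \<gamma> \<psi>) (transform_mat \<psi>)"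
  by (rule function_value_cauchy_transform[OF C1_curve _ roots_off_path])

lemma region_is_open: "open region"
  using open_parallel_set[of 0] by (simp add: region_def)

lemma function_value_holomorphic:
  assumes "open U" "f holomorphic_on U" "closed_region \<subseteq> U"
  shows "function_value f (transform_mat f)"
proof (rule function_value_cong[OF function_value_transform region_is_open roots_in_region])
  show "continuous_on (path_image \<gamma>) f"
    by (rule continuous_on_subset[OF holomorphic_on_imp_continuous_on[OF assms(2)] order_trans[OF path_image_closed_region assms(3)]])
  show "f z = cauchy_transform \<gamma> f z" if "z \<in> region" for z
    using cauchy_formula[OF assms that] by simp
qed

lemma transform_one: "transform_mat (\<lambda>_. 1) = 1\<^sub>m n"
proof -
  have "function_value (\<lambda>_. 1) (transform_mat (\<lambda>_. 1))"
    by (rule function_value_holomorphic[of UNIV]) auto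
  moreover have "function_value (\<lambda>_. 1) (1\<^sub>m n)"
  proof -
    have "poly 1 = (\<lambda>_ :: complex. 1 :: complex)" by (rule ext) simp
    then show ?thesis using function_value_poly[of 1] by (simp only: poly_at_mat_1[OF A])
  qed
  ultimately show ?thesis by (rule function_value_unique)
qed

definition curve_resolvent :: "real \<Rightarrow> complex mat" where "curve_resolvent t = poly_at_mat A (resolvent_poly as (\<gamma> t))"

lemma curve_resolvent_carrier: "curve_resolvent t \<in> carrier_mat n n"
  unfolding curve_resolvent_def by simp

text \<open>The sesquilinear form of the operator valued double layer kernel \<open>\<rho>(t)/(2 \<pi>) (\<nu> R + (\<nu> R)\<^sup>*)\<close>,
  where \<open>\<nu>\<close> is the outer normal and \<open>R\<close> the resolvent of \<open>A\<close> at \<open>\<gamma>(t)\<close>.\<close>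

definition layer_form :: "real \<Rightarrow> complex vec \<Rightarrow> complex vec \<Rightarrow> complex" where
  "layer_form t u w = of_real (\<rho> t / (2 * pi)) * (cis (2 * pi * t) * ((curve_resolvent t *\<^sub>v u) \<bullet>c w)
      + cnj (cis (2 * pi * t) * ((curve_resolvent t *\<^sub>v w) \<bullet>c u)))"

text \<open>The operator version of \<open>kernel_representation\<close>: the integral is the form of \<open>\<phi>(A) + g(A)\<^sup>*\<close>,
  where \<open>\<phi>\<close> and \<open>g\<close> are the Cauchy transforms of \<open>\<psi>\<close> and of its conjugate.\<close>

lemma layer_form_integral:
  assumes \<psi>: "continuous_on (path_image \<gamma>) \<psi>" and u: "u \<in> carrier_vec n" and w: "w \<in> carrier_vec n"
  shows "((\<lambda>t. \<psi> (\<gamma> t) * layer_form t u w) has_integral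
    ((transform_mat \<psi> *\<^sub>v u) \<bullet>c w + cnj ((transform_mat (\<lambda>z. cnj (\<psi> z)) *\<^sub>v w) \<bullet>c u))) {0..1}"
proof -
  have 1: "((\<lambda>t. of_real (\<rho> t / (2 * pi)) * cis (2 * pi * t) * (\<phi> (\<gamma> t) * ((curve_resolvent t *\<^sub>v x) \<bullet>c y))) has_integral
      ((transform_mat \<phi> *\<^sub>v x) \<bullet>c y)) {0..1}"
    if \<phi>: "continuous_on (path_image \<gamma>) \<phi>" and xy: "x \<in> carrier_vec n" "y \<in> carrier_vec n" for \<phi> x y
  proof -
    have "((\<lambda>z. \<phi> z * ((poly_at_mat A (resolvent_poly as z) *\<^sub>v x) \<bullet>c y)) has_contour_integral
        (2 * pi * \<i> * ((transform_mat \<phi> *\<^sub>v x) \<bullet>c y))) \<gamma>"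
      by (rule integral_functional_resolvent_poly[OF C1_curve \<phi> roots_off_path poly_functional_form[OF xy]])
    then have "((\<lambda>t. \<phi> (\<gamma> t) * ((curve_resolvent t *\<^sub>v x) \<bullet>c y) * velocity t) has_integral
        (2 * pi * \<i> * ((transform_mat \<phi> *\<^sub>v x) \<bullet>c y))) {0..1}"
      by (simp add: has_contour_integral curve_vector_derivative curve_resolvent_def)
    from has_integral_mult_right[OF this, of "1 / (2 * pi * \<i>)"]
    have H: "((\<lambda>t. 1 / (2 * pi * \<i>) * (\<phi> (\<gamma> t) * ((curve_resolvent t *\<^sub>v x) \<bullet>c y) * velocity t)) has_integral
        ((transform_mat \<phi> *\<^sub>v x) \<bullet>c y)) {0..1}" by simp
    have e: "1 / (2 * pi * \<i>) * (p * q * (of_real r * \<i> * e)) = of_real (r / (2 * pi)) * e * (p * q)" for p q e r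
      by (simp add: field_simps)
    show ?thesis by (rule has_integral_eq[OF _ H]) (rule e)
  qed
  have 2: "((\<lambda>t. cnj (of_real (\<rho> t / (2 * pi)) * cis (2 * pi * t) * (cnj (\<psi> (\<gamma> t)) * ((curve_resolvent t *\<^sub>v w) \<bullet>c u)))) has_integral
      cnj ((transform_mat (\<lambda>z. cnj (\<psi> z)) *\<^sub>v w) \<bullet>c u)) {0..1}"
    using has_integral_linear[OF 1[of "\<lambda>z. cnj (\<psi> z)", OF _ w u] bounded_linear_cnj] \<psi>
    by (simp add: o_def continuous_on_cnj)
  show ?thesis
    by (rule has_integral_eq[OF _ has_integral_add[OF 1[OF \<psi> u w] 2]]) (simp add: layer_form_def algebra_simps)
qed

text \<open>Put \<open>x = R u\<close>, so that \<open>u = (\<gamma>(t) - A) x\<close>. The form at \<open>u\<close> is a positive multiple of \<open>\<parallel>x\<parallel>\<^sup>2\<close> times the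
  depth of a point \<open>\<omega>\<close> of the numerical range, which is positive because the numerical range lies
  inside the curve.\<close>

lemma layer_form_nonneg:
  assumes u: "u \<in> carrier_vec n"
  shows "\<exists>r\<ge>0. layer_form t u u = of_real r"
proof -
  let ?e = "cis (2 * pi * t)"
  define x where "x = curve_resolvent t *\<^sub>v u"
  have x: "x \<in> carrier_vec n" unfolding x_def by (rule mult_mat_vec_carrier[OF curve_resolvent_carrier u])
  have nr: "\<gamma> t \<notin> set as" using roots_in_region region_avoids_curve by blast
  have M: "\<gamma> t \<cdot>\<^sub>m 1\<^sub>m n - A \<in> carrier_mat n n" using A by auto
  have "u = (\<gamma> t \<cdot>\<^sub>m 1\<^sub>m n - A) *\<^sub>v x"
    unfolding x_def curve_resolvent_def using resolvent_poly_inverse(1)[OF nr] assoc_mult_mat_vec[OF M poly_at_mat_in_carrier[of "resolvent_poly as (\<gamma> t)"] u]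
    by (metis one_mult_mat_vec u)
  also have "\<dots> = \<gamma> t \<cdot>\<^sub>v x + (- 1) \<cdot>\<^sub>v (A *\<^sub>v x)"
  proof -
    have "\<gamma> t \<cdot>\<^sub>m 1\<^sub>m n - A = \<gamma> t \<cdot>\<^sub>m 1\<^sub>m n + (- 1) \<cdot>\<^sub>m A" using A by (intro eq_matI) auto
    then show ?thesis
      using add_mult_distrib_mat_vec[of "\<gamma> t \<cdot>\<^sub>m 1\<^sub>m n" n n "(- 1) \<cdot>\<^sub>m A" x] A x
      by (simp add: smult_mat_mult_vec[OF one_carrier_mat x] smult_mat_mult_vec[OF A x])
  qed
  finally have u_eq: "u = \<gamma> t \<cdot>\<^sub>v x + (- 1) \<cdot>\<^sub>v (A *\<^sub>v x)" .
  have Ax: "A *\<^sub>v x \<in> carrier_vec n" using A x by simp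
  have ux: "u \<bullet>c x = \<gamma> t * of_real ((vec_norm2 x)\<^sup>2) - (A *\<^sub>v x) \<bullet>c x"
    by (subst u_eq) (use x Ax in \<open>simp add: cinner_add_left[of _ n] cinner_smult_left[of _ n] cinner_self[OF x]\<close>)
  have "\<exists>\<omega>. (A *\<^sub>v x) \<bullet>c x = of_real ((vec_norm2 x)\<^sup>2) * \<omega> \<and> (vec_norm2 x = 0 \<or> \<omega> \<in> numerical_range A)"
  proof (cases "x = 0\<^sub>v n")
    case True
    then show ?thesis using A vec_norm2_eq_0_iff[OF x] by (intro exI[of _ 0]) simp
  next
    case False
    then show ?thesis using rayleigh_in_numerical_range[OF A x False] by metis
  qed
  then obtain \<omega> where \<omega>: "(A *\<^sub>v x) \<bullet>c x = of_real ((vec_norm2 x)\<^sup>2) * \<omega>" "vec_norm2 x = 0 \<or> \<omega> \<in> numerical_range A"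
    by blast
  have dep: "(vec_norm2 x)\<^sup>2 * depth t \<omega> \<ge> 0"
    using \<omega>(2) numrange by (auto simp: region_def less_imp_le)
  have rr: "Re (of_real r * z) = r * Re z" for r z by simp
  have "cnj (?e * (x \<bullet>c u)) = cnj ?e * (u \<bullet>c x)" using cinner_cnj[OF x u] by simp
  also have "\<dots> = of_real ((vec_norm2 x)\<^sup>2) * (cnj ?e * (\<gamma> t - \<omega>))" unfolding ux \<omega>(1) by (simp add: algebra_simps)
  finally have "Re (cnj (?e * (x \<bullet>c u))) = (vec_norm2 x)\<^sup>2 * depth t \<omega>"
    by (simp only: depth_def rr)
  then have re: "Re (?e * (x \<bullet>c u)) \<ge> 0" using dep by (simp only: cnj.simps(1))
  have "layer_form t u u = of_real (\<rho> t / (2 * pi)) * (?e * (x \<bullet>c u) + cnj (?e * (x \<bullet>c u)))"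
    by (simp add: layer_form_def x_def)
  also have "\<dots> = of_real (\<rho> t / (2 * pi) * (2 * Re (?e * (x \<bullet>c u))))"
    unfolding complex_add_cnj by simp
  finally have F: "layer_form t u u = of_real (\<rho> t / (2 * pi) * (2 * Re (?e * (x \<bullet>c u))))" .
  have "\<rho> t / (2 * pi) * (2 * Re (?e * (x \<bullet>c u))) \<ge> 0"
    using re speed_pos[of t] by (intro mult_nonneg_nonneg divide_nonneg_nonneg) auto
  then show ?thesis unfolding F by blast
qed

lemma layer_form_swap: "layer_form t w u = cnj (layer_form t u w)"
  by (simp add: layer_form_def algebra_simps)

lemma layer_form_expand:
  assumes u: "u \<in> carrier_vec n" and w: "w \<in> carrier_vec n"
  shows "layer_form t (u + c \<cdot>\<^sub>v w) (u + c \<cdot>\<^sub>v w) = layer_form t u u + cnj c * layer_form t u w + c * layer_form t w u + c * cnj c * layer_form t w w"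
proof -
  define q where "q x y = (curve_resolvent t *\<^sub>v x) \<bullet>c y" for x y
  have cw: "c \<cdot>\<^sub>v w \<in> carrier_vec n" using w by simp
  have R: "curve_resolvent t *\<^sub>v x \<in> carrier_vec n" if "x \<in> carrier_vec n" for x by (rule mult_mat_vec_carrier[OF curve_resolvent_carrier that])
  have "q (u + c \<cdot>\<^sub>v w) (u + c \<cdot>\<^sub>v w) = q u u + cnj c * q u w + c * q w u + c * cnj c * q w w"
    unfolding q_def mult_add_distrib_mat_vec[OF curve_resolvent_carrier u cw] mult_mat_vec[OF curve_resolvent_carrier w]
    using u w cw R[OF u] R[OF w]
    by (simp add: cinner_add_left[of _ n] cinner_add_right[of _ n] cinner_smult_left[of _ n] cinner_smult_right[of _ n] algebra_simps)
  then show ?thesis unfolding layer_form_def q_def[symmetric] by (simp add: algebra_simps)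
qed

text \<open>The arithmetic mean version of the Cauchy--Schwarz inequality for positive semidefinite forms,
  from nonnegativity at \<open>u + c w\<close> for a unimodular \<open>c\<close>.\<close>

lemma layer_form_bound:
  assumes u: "u \<in> carrier_vec n" and w: "w \<in> carrier_vec n"
  shows "cmod (layer_form t u w) \<le> (Re (layer_form t u u) + Re (layer_form t w w)) / 2"
proof -
  \<comment> \<open>The phase that turns the mixed term into \<open>- 2\<close> times its modulus.\<close>
  define c where "c = (if layer_form t u w = 0 then 1 else - layer_form t u w / cmod (layer_form t u w))"
  have c1: "c * cnj c = 1" by (simp add: c_def complex_norm_square[symmetric] norm_divide)
  have c2: "cnj c * layer_form t u w = - of_real (cmod (layer_form t u w))"
    by (simp add: c_def) (simp add: complex_norm_square[symmetric] power2_eq_square mult.commute)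
  have "u + c \<cdot>\<^sub>v w \<in> carrier_vec n" using u w by simp
  then obtain r where r: "r \<ge> 0" "layer_form t (u + c \<cdot>\<^sub>v w) (u + c \<cdot>\<^sub>v w) = of_real r" using layer_form_nonneg by blast
  have "c * layer_form t w u = cnj (cnj c * layer_form t u w)" by (simp add: layer_form_swap[of t u w])
  then have "of_real r = layer_form t u u - 2 * of_real (cmod (layer_form t u w)) + layer_form t w w"
    using layer_form_expand[OF u w, of t c] r(2) c1 c2 by simp
  then have "r = Re (layer_form t u u) - 2 * cmod (layer_form t u w) + Re (layer_form t w w)"
    by (simp add: complex_eq_iff)
  then show ?thesis using r(1) by simp
qed

lemma layer_form_mass:
  assumes u: "u \<in> carrier_vec n"
  shows "((\<lambda>t. Re (layer_form t u u)) has_integral 2 * (vec_norm2 u)\<^sup>2) {0..1}"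
proof -
  have "((\<lambda>t. layer_form t u u) has_integral of_real (2 * (vec_norm2 u)\<^sup>2)) {0..1}"
    using layer_form_integral[of "\<lambda>_. 1", OF _ u u] u by (simp add: transform_one cinner_self[OF u])
  from has_integral_linear[OF this bounded_linear_Re] show ?thesis by (simp add: o_def)
qed

text \<open>The operator valued kernel is positive and has total mass 2, so integrating a function bounded
  by 1 against it gives an operator of norm at most 2. The bound by \<open>\<parallel>u\<parallel>\<^sup>2 + \<parallel>w\<parallel>\<^sup>2\<close> becomes a
  product after scaling both vectors to norm 1.\<close>

lemma double_layer_bound:
  assumes \<psi>: "continuous_on (path_image \<gamma>) \<psi>" "\<And>z. z \<in> path_image \<gamma> \<Longrightarrow> cmod (\<psi> z) \<le> 1"
    and u: "u \<in> carrier_vec n" and w: "w \<in> carrier_vec n"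
  shows "cmod ((transform_mat \<psi> *\<^sub>v u) \<bullet>c w + cnj ((transform_mat (\<lambda>z. cnj (\<psi> z)) *\<^sub>v w) \<bullet>c u))
    \<le> 2 * vec_norm2 u * vec_norm2 w"
proof -
  define S where "S u w = (transform_mat \<psi> *\<^sub>v u) \<bullet>c w + cnj ((transform_mat (\<lambda>z. cnj (\<psi> z)) *\<^sub>v w) \<bullet>c u)" for u w
  have *: "cmod (S u w) \<le> (vec_norm2 u)\<^sup>2 + (vec_norm2 w)\<^sup>2" if u: "u \<in> carrier_vec n" and w: "w \<in> carrier_vec n" for u w
  proof -
    note i = layer_form_integral[OF \<psi>(1) u w, folded S_def]
    have j: "((\<lambda>t. (Re (layer_form t u u) + Re (layer_form t w w)) / 2) has_integral (2 * (vec_norm2 u)\<^sup>2 + 2 * (vec_norm2 w)\<^sup>2) / 2) {0..1}"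
      by (intro has_integral_divide has_integral_add layer_form_mass u w)
    have "cmod (integral {0..1} (\<lambda>t. \<psi> (\<gamma> t) * layer_form t u w)) \<le> integral {0..1} (\<lambda>t. (Re (layer_form t u u) + Re (layer_form t w w)) / 2)"
    proof (rule integral_norm_bound_integral)
      fix t :: real assume "t \<in> {0..1}"
      then have "cmod (\<psi> (\<gamma> t)) \<le> 1" by (intro \<psi>(2)) (auto simp: path_image_def)
      then have "cmod (\<psi> (\<gamma> t) * layer_form t u w) \<le> 1 * cmod (layer_form t u w)"
        unfolding norm_mult by (rule mult_right_mono) simp
      then show "cmod (\<psi> (\<gamma> t) * layer_form t u w) \<le> (Re (layer_form t u u) + Re (layer_form t w w)) / 2"
        using layer_form_bound[OF u w, of t] by linarith
    qed (use i j in \<open>auto simp: has_integral_integrable\<close>)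
    then show ?thesis using integral_unique[OF i] integral_unique[OF j] by simp
  qed
  have "cmod (S u w) \<le> 2 * vec_norm2 u * vec_norm2 w"
  proof (cases "u = 0\<^sub>v n \<or> w = 0\<^sub>v n")
    case True
    have "S u w = 0"
    proof -
      have "X *\<^sub>v 0\<^sub>v n = 0\<^sub>v n" if "X \<in> carrier_mat n n" for X :: "complex mat" using that by auto
      then show ?thesis using True u w mult_mat_vec_carrier[OF poly_at_mat_in_carrier u] mult_mat_vec_carrier[OF poly_at_mat_in_carrier w]
        by (auto simp: S_def)
    qed
    then show ?thesis by simp
  next
    case False
    define a b where "a = vec_norm2 u" and "b = vec_norm2 w"
    have ab: "a > 0" "b > 0" using False vec_norm2_pos u w by (auto simp: a_def b_def)
    define u' w' where "u' = of_real (1 / a) \<cdot>\<^sub>v u" and "w' = of_real (1 / b) \<cdot>\<^sub>v w"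
    have u': "u' \<in> carrier_vec n" "w' \<in> carrier_vec n" using u w by (auto simp: u'_def w'_def)
    have n1: "vec_norm2 u' = 1" "vec_norm2 w' = 1" using ab by (auto simp: u'_def w'_def vec_norm2_smult norm_divide a_def[symmetric] b_def[symmetric])
    have "S u' w' = of_real (1 / a) * of_real (1 / b) * S u w"
    proof -
      have Xu: "X *\<^sub>v u \<in> carrier_vec n" "X *\<^sub>v w \<in> carrier_vec n" if "X \<in> carrier_mat n n" for X :: "complex mat"
        using that u w by auto
      show ?thesis unfolding S_def u'_def w'_def mult_mat_vec[OF poly_at_mat_in_carrier u] mult_mat_vec[OF poly_at_mat_in_carrier w]
        using u w Xu[OF poly_at_mat_in_carrier] by (simp add: cinner_smult_left[of _ n] cinner_smult_right[of _ n] algebra_simps)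
    qed
    then have "S u w = of_real a * of_real b * S u' w'" using ab by simp
    then have "cmod (S u w) = a * b * cmod (S u' w')" using ab by (simp add: norm_mult)
    also have "\<dots> \<le> a * b * 2" using *[OF u'] n1 ab by (intro mult_left_mono) auto
    finally show ?thesis by (simp add: a_def b_def mult_ac)
  qed
  then show ?thesis by (simp add: S_def)
qed

end

context matrix_calculus
begin

text \<open>Operator norm at most \<open>k\<close>, stated for the sesquilinear form.\<close>

definition bounded_by :: "complex mat \<Rightarrow> real \<Rightarrow> bool" where
  "bounded_by X k \<longleftrightarrow> (\<forall>u\<in>carrier_vec n. \<forall>w\<in>carrier_vec n. cmod ((X *\<^sub>v u) \<bullet>c w) \<le> k * vec_norm2 u * vec_norm2 w)"

text \<open>The matrices \<open>\<phi>(A)\<close> for functions \<open>\<phi>\<close> that are holomorphic and bounded by 1 near \<open>K\<close>. Each function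
  comes with a neighbourhood of its own, so that it can be integrated along a curve outside \<open>K\<close> on
  which it is still bounded by 1.\<close>

definition unit_class :: "complex set \<Rightarrow> complex mat set" where
  "unit_class K = {X. \<exists>\<phi> U. open U \<and> K \<subseteq> U \<and> \<phi> holomorphic_on U \<and> (\<forall>z\<in>U. cmod (\<phi> z) \<le> 1) \<and> function_value \<phi> X}"

lemma unit_classE:
  assumes "X \<in> unit_class K"
  obtains \<phi> U where "open U" "K \<subseteq> U" "\<phi> holomorphic_on U" "\<And>z. z \<in> U \<Longrightarrow> cmod (\<phi> z) \<le> 1" "function_value \<phi> X"
  using assms unfolding unit_class_def by blast

lemma bounded_by_entries:
  assumes X: "X \<in> carrier_mat n n" and b: "\<And>i j. i < n \<Longrightarrow> j < n \<Longrightarrow> cmod (X $$ (i, j)) \<le> b i j"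
  shows "bounded_by X (\<Sum>i<n. \<Sum>j<n. b i j)"
  unfolding bounded_by_def
proof (intro ballI)
  fix u w :: "complex vec" assume u: "u \<in> carrier_vec n" and w: "w \<in> carrier_vec n"
  have coord: "cmod (v $ i) \<le> vec_norm2 v" if "v \<in> carrier_vec n" "i < n" for v :: "complex vec" and i
    unfolding vec_norm2_def using that member_le_L2_set[of "{..<n}" i "\<lambda>i. cmod (v $ i)"] by simp
  have "cmod ((X *\<^sub>v u) \<bullet>c w) \<le> (\<Sum>i<n. \<Sum>j<n. cmod (X $$ (i, j) * u $ j * cnj (w $ i)))"
    unfolding mat_mult_cinner_sum[OF X u w] by (intro order_trans[OF norm_sum] sum_mono norm_sum)
  also have "\<dots> \<le> (\<Sum>i<n. \<Sum>j<n. b i j * vec_norm2 u * vec_norm2 w)"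
    unfolding norm_mult complex_mod_cnj
    by (intro sum_mono mult_mono b coord u w mult_nonneg_nonneg) (auto intro: order_trans[OF norm_ge_zero b])
  also have "\<dots> = (\<Sum>i<n. \<Sum>j<n. b i j) * vec_norm2 u * vec_norm2 w"
    by (simp add: sum_distrib_right)
  finally show "cmod ((X *\<^sub>v u) \<bullet>c w) \<le> (\<Sum>i<n. \<Sum>j<n. b i j) * vec_norm2 u * vec_norm2 w" .
qed

text \<open>A crude bound from Cauchy's integral along one fixed curve around the numerical range inside
  \<open>K\<close>. It makes the optimal constant of the class finite, which the extremal argument below
  requires.\<close>

lemma unit_class_uniformly_bounded:
  assumes n: "n \<ge> 1" and V: "open V" "numerical_range A \<subseteq> V" "V \<subseteq> K"
  shows "\<exists>k. \<forall>X\<in>unit_class K. bounded_by X k"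
proof -
  obtain \<gamma> \<rho> where c: "convex_curve \<gamma> \<rho>" and reg: "numerical_range A \<subseteq> convex_curve.region \<gamma>"
    and creg: "convex_curve.closed_region \<gamma> \<subseteq> V"
    using convex_curve_exists[OF compact_numerical_range[OF A] convex_numerical_range[OF A] numerical_range_nonempty[OF A n] V(1,2)] .
  interpret matrix_in_curve A n as \<gamma> \<rho>
    using c reg matrix_calculus_axioms by (simp add: matrix_in_curve_def matrix_in_curve_axioms_def)
  \<comment> \<open>The entry of Cauchy's integral for \<open>\<phi>(A)\<close>, estimated with \<open>\<bar>\<phi>\<bar> \<le> 1\<close>.\<close>
  define b where "b i j = integral {0..1} (\<lambda>t. cmod (poly_at_mat A (resolvent_poly as (\<gamma> t)) $$ (i, j) * velocity t)) / (2 * pi)" for i j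
  have "bounded_by X (\<Sum>i<n. \<Sum>j<n. b i j)" if XK: "X \<in> unit_class K" for X
  proof -
    obtain \<phi> U where \<phi>: "open U" "K \<subseteq> U" "\<phi> holomorphic_on U" "\<And>z. z \<in> U \<Longrightarrow> cmod (\<phi> z) \<le> 1" "function_value \<phi> X"
      by (rule unit_classE[OF XK]) (rule that; assumption)
    have cU: "closed_region \<subseteq> U" using creg V(3) \<phi>(2) by blast
    have X: "X = transform_mat \<phi>" using function_value_unique[OF \<phi>(5) function_value_holomorphic[OF \<phi>(1,3) cU]] .
    have cont: "continuous_on (path_image \<gamma>) \<phi>"
      by (rule continuous_on_subset[OF holomorphic_on_imp_continuous_on[OF \<phi>(3)] order_trans[OF path_image_closed_region cU]])
    show ?thesis
    proof (rule bounded_by_entries)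
      show "X \<in> carrier_mat n n" unfolding X by simp
      fix i j assume ij: "i < n" "j < n"
      let ?L = "\<lambda>p. poly_at_mat A p $$ (i, j)"
      have L: "poly_functional ?L" by (rule poly_functional_entry[OF ij])
      have Lc: "continuous_on (path_image \<gamma>) (\<lambda>z. ?L (resolvent_poly as z))"
        by (rule holomorphic_on_imp_continuous_on[OF holomorphic_functional_resolvent_poly[OF L roots_off_path]])
      have Lc': "continuous_on {0..1} (\<lambda>t. ?L (resolvent_poly as (\<gamma> t)))"
        by (rule continuous_on_compose2[OF Lc curve_cont]) (auto simp: path_image_def)
      have "((\<lambda>t. \<phi> (\<gamma> t) * ?L (resolvent_poly as (\<gamma> t)) * velocity t) has_integral (2 * pi * \<i> * X $$ (i, j))) {0..1}"
        using integral_functional_resolvent_poly[OF C1_curve cont roots_off_path L]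
        by (simp add: has_contour_integral curve_vector_derivative X)
      then have "2 * pi * \<i> * X $$ (i, j) = integral {0..1} (\<lambda>t. \<phi> (\<gamma> t) * ?L (resolvent_poly as (\<gamma> t)) * velocity t)"
        and int: "(\<lambda>t. \<phi> (\<gamma> t) * ?L (resolvent_poly as (\<gamma> t)) * velocity t) integrable_on {0..1}"
        by (auto simp: integral_unique has_integral_integrable)
      then have "cmod (2 * pi * \<i> * X $$ (i, j)) \<le> integral {0..1} (\<lambda>t. cmod (?L (resolvent_poly as (\<gamma> t)) * velocity t))"
      proof (simp only:, intro integral_norm_bound_integral)
        show "(\<lambda>t. cmod (?L (resolvent_poly as (\<gamma> t)) * velocity t)) integrable_on {0..1}"
          by (intro integrable_continuous_real continuous_on_norm continuous_on_mult Lc' velocity_cont)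
        fix t :: real assume "t \<in> {0..1}"
        then have "cmod (\<phi> (\<gamma> t)) \<le> 1" using cU curve_in_closed_region by (intro \<phi>(4)) auto
        from mult_right_mono[OF this, of "cmod (?L (resolvent_poly as (\<gamma> t)) * velocity t)"]
        show "cmod (\<phi> (\<gamma> t) * ?L (resolvent_poly as (\<gamma> t)) * velocity t) \<le> cmod (?L (resolvent_poly as (\<gamma> t)) * velocity t)"
          by (simp add: norm_mult mult.assoc)
      qed
      then show "cmod (X $$ (i, j)) \<le> b i j" unfolding b_def by (simp add: norm_mult field_simps)
    qed
  qed
  then show ?thesis by blast
qed

text \<open>The infimum of the admissible constants is admissible.\<close>

lemma least_bound:
  assumes "\<exists>k. \<forall>X\<in>\<X>. bounded_by X k"
  obtains k where "k \<ge> 0" "\<And>X. X \<in> \<X> \<Longrightarrow> bounded_by X k"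
    "\<And>k'. k' \<ge> 0 \<Longrightarrow> (\<And>X. X \<in> \<X> \<Longrightarrow> bounded_by X k') \<Longrightarrow> k \<le> k'"
proof -
  define T where "T = {k. k \<ge> 0 \<and> (\<forall>X\<in>\<X>. bounded_by X k)}"
  obtain k0 where k0: "\<forall>X\<in>\<X>. bounded_by X k0" using assms by blast
  have "bounded_by X (max k0 0)" if "X \<in> \<X>" for X
    unfolding bounded_by_def
  proof (intro ballI)
    fix u w :: "complex vec" assume "u \<in> carrier_vec n" "w \<in> carrier_vec n"
    then have "cmod ((X *\<^sub>v u) \<bullet>c w) \<le> k0 * (vec_norm2 u * vec_norm2 w)"
      using k0 that by (auto simp: bounded_by_def mult.assoc)
    also have "\<dots> \<le> max k0 0 * (vec_norm2 u * vec_norm2 w)" by (intro mult_right_mono) auto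
    finally show "cmod ((X *\<^sub>v u) \<bullet>c w) \<le> max k0 0 * vec_norm2 u * vec_norm2 w" by (simp add: mult.assoc)
  qed
  then have ne: "T \<noteq> {}" by (auto simp: T_def intro!: exI[of _ "max k0 0"])
  have bb: "bdd_below T" by (rule bdd_belowI[of _ 0]) (auto simp: T_def)
  show ?thesis
  proof (rule that[of "Inf T"])
    show "Inf T \<ge> 0" using ne by (intro cInf_greatest) (auto simp: T_def)
    show "Inf T \<le> k'" if "k' \<ge> 0" "\<And>X. X \<in> \<X> \<Longrightarrow> bounded_by X k'" for k'
      using that bb by (intro cInf_lower) (auto simp: T_def)
    fix X assume X: "X \<in> \<X>"
    show "bounded_by X (Inf T)" unfolding bounded_by_def
    proof (intro ballI)
      fix u w :: "complex vec" assume uw: "u \<in> carrier_vec n" "w \<in> carrier_vec n"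
      define c where "c = vec_norm2 u * vec_norm2 w"
      have le: "cmod ((X *\<^sub>v u) \<bullet>c w) \<le> k * c" if "k \<in> T" for k
        using that X uw by (auto simp: T_def bounded_by_def c_def mult.assoc)
      have c0: "c \<ge> 0" by (simp add: c_def)
      have "cmod ((X *\<^sub>v u) \<bullet>c w) \<le> Inf T * c"
      proof (cases "c = 0")
        case True
        then show ?thesis using le ne by force
      next
        case False
        then have "c > 0" using c0 by simp
        then have "cmod ((X *\<^sub>v u) \<bullet>c w) / c \<le> Inf T"
          using le ne by (intro cInf_greatest) (auto simp: divide_le_eq)
        then show ?thesis using \<open>c > 0\<close> by (simp add: divide_le_eq)
      qed
      then show "cmod ((X *\<^sub>v u) \<bullet>c w) \<le> Inf T * vec_norm2 u * vec_norm2 w" by (simp add: c_def mult.assoc)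
    qed
  qed
qed

text \<open>Let \<open>X = \<phi>(A)\<close>, let \<open>g\<close> be the Cauchy transform of the conjugate of \<open>\<phi>\<close> along a curve around \<open>K\<close>, and
  \<open>G = g(A)\<close>. With \<open>y = X\<^sup>* u\<close> and \<open>z = X y\<close> one has \<open>\<parallel>y\<parallel>\<^sup>2 \<le> \<parallel>z\<parallel>\<close>. By \<open>double_layer_bound\<close>, \<open>\<parallel>z\<parallel>\<^sup>2 = \<langle>X y,
  z\<rangle>\<close> differs from the conjugate of \<open>- \<langle>G z, y\<rangle>\<close> by at most \<open>2 \<parallel>y\<parallel> \<parallel>z\<parallel>\<close>. Finally \<open>\<langle>G z, y\<rangle> = \<langle>X G X y,
  u\<rangle>\<close>, and \<open>X G X\<close> is the value at \<open>A\<close> of \<open>\<phi> g \<phi>\<close>, which by \<open>cauchy_transform_cnj_bound\<close> is again bounded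
  by 1. So \<open>k\<close> bounds it too.\<close>

lemma ransford_schwenninger_step:
  assumes n: "n \<ge> 1" and K: "compact K" "convex K" "numerical_range A \<subseteq> K"
    and k: "k \<ge> 0" "\<And>X. X \<in> unit_class K \<Longrightarrow> bounded_by X k" and X: "X \<in> unit_class K"
    and u: "u \<in> carrier_vec n" "vec_norm2 u = 1"
  shows "(vec_norm2 (mat_adjoint X *\<^sub>v u)) ^ 4 \<le> 2 * k ^ 3 + k\<^sup>2"
proof -
  obtain \<phi> U where \<phi>: "open U" "K \<subseteq> U" "\<phi> holomorphic_on U" "\<And>z. z \<in> U \<Longrightarrow> cmod (\<phi> z) \<le> 1" "function_value \<phi> X"
    by (rule unit_classE[OF X]) (rule that; assumption)
  have K0: "K \<noteq> {}" using numerical_range_nonempty[OF A n] K by blast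
  obtain \<gamma> \<rho> where c: "convex_curve \<gamma> \<rho>" and reg: "K \<subseteq> convex_curve.region \<gamma>"
    and cU: "convex_curve.closed_region \<gamma> \<subseteq> U"
    using convex_curve_exists[OF K(1,2) K0 \<phi>(1,2)] .
  interpret matrix_in_curve A n as \<gamma> \<rho>
    using c reg K(3) matrix_calculus_axioms by (auto simp: matrix_in_curve_def matrix_in_curve_axioms_def)
  have cont: "continuous_on (path_image \<gamma>) \<phi>"
    by (rule continuous_on_subset[OF holomorphic_on_imp_continuous_on[OF \<phi>(3)] order_trans[OF path_image_closed_region cU]])
  define g where "g = cauchy_transform \<gamma> (\<lambda>z. cnj (\<phi> z))"
  define G where "G = transform_mat (\<lambda>z. cnj (\<phi> z))"
  have Xeq: "X = transform_mat \<phi>" using function_value_unique[OF \<phi>(5) function_value_holomorphic[OF \<phi>(1,3) cU]] .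
  have contc: "continuous_on (path_image \<gamma>) (\<lambda>z. cnj (\<phi> z))" using cont by (rule continuous_on_cnj)
  have G: "function_value g G" unfolding g_def G_def by (rule function_value_transform[OF contc])
  have ghol: "g holomorphic_on region" unfolding g_def by (rule cauchy_transform_holomorphic_on_region[OF contc])
  have gle: "cmod (g z) \<le> 1" if "z \<in> region" for z
    unfolding g_def by (rule cauchy_transform_cnj_bound[OF \<phi>(1,3) cU _ that]) (use \<phi>(4) cU in auto)
  have fgf: "X * G * X \<in> unit_class K"
    unfolding unit_class_def
  proof (intro CollectI exI conjI ballI)
    show "open region" by (rule region_is_open)
    show "K \<subseteq> region" by (rule reg)
    show "(\<lambda>z. \<phi> z * g z * \<phi> z) holomorphic_on region"
      by (intro holomorphic_on_mult ghol holomorphic_on_subset[OF \<phi>(3)]; use cU region_subset_closed_region in blast)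
    show "function_value (\<lambda>z. \<phi> z * g z * \<phi> z) (X * G * X)" by (intro function_value_mult \<phi>(5) G)
    fix z assume z: "z \<in> region"
    then have "cmod (\<phi> z) \<le> 1" using \<phi>(4) cU region_subset_closed_region by blast
    then show "cmod (\<phi> z * g z * \<phi> z) \<le> 1" using gle[OF z]
      by (auto simp: norm_mult intro!: mult_le_one)
  qed
  have Xc: "X \<in> carrier_mat n n" and Gc: "G \<in> carrier_mat n n" unfolding Xeq G_def by auto
  have aXc: "mat_adjoint X \<in> carrier_mat n n" using Xc by simp
  define y where "y = mat_adjoint X *\<^sub>v u"
  define z where "z = X *\<^sub>v y"
  have y: "y \<in> carrier_vec n" unfolding y_def using aXc u by simp
  have z: "z \<in> carrier_vec n" unfolding z_def using Xc y by simp
  let ?a = "vec_norm2 y" let ?b = "vec_norm2 z"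
  have "of_real (?a\<^sup>2) = y \<bullet>c y" by (simp add: cinner_self[OF y])
  also have "\<dots> = cnj (y \<bullet>c (mat_adjoint X *\<^sub>v u))" using cinner_cnj[OF y y] by (simp add: y_def)
  also have "\<dots> = cnj (z \<bullet>c u)" unfolding z_def mat_adjoint_cinner[OF Xc y u(1)] ..
  finally have "?a\<^sup>2 = cmod (z \<bullet>c u)" by (metis abs_of_nonneg complex_mod_cnj norm_of_real zero_le_power2)
  then have ab: "?a\<^sup>2 \<le> ?b" using cauchy_schwarz[OF z u(1)] u(2) by simp
  have ak: "?a \<le> k"
  proof -
    have "of_real (?a\<^sup>2) = (X *\<^sub>v y) \<bullet>c u" using \<open>of_real (?a\<^sup>2) = y \<bullet>c y\<close> mat_adjoint_cinner[OF Xc y u(1)] by (simp add: y_def)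
    then have "?a\<^sup>2 = cmod ((X *\<^sub>v y) \<bullet>c u)" by (metis abs_of_nonneg norm_of_real zero_le_power2)
    also have "\<dots> \<le> k * ?a * vec_norm2 u" using k(2)[OF X] y u unfolding bounded_by_def by blast
    finally have "?a * ?a \<le> k * ?a" using u by (simp add: power2_eq_square)
    then show ?thesis using k(1) vec_norm2_nonneg[of y] by (cases "?a = 0") (auto simp: mult_le_cancel_right)
  qed
  have bk: "?b \<le> k * ?a"
  proof -
    have "of_real (?b\<^sup>2) = (X *\<^sub>v y) \<bullet>c z" by (simp add: cinner_self[OF z] flip: z_def)
    then have "?b\<^sup>2 = cmod ((X *\<^sub>v y) \<bullet>c z)" by (metis abs_of_nonneg norm_of_real zero_le_power2)
    also have "\<dots> \<le> k * ?a * ?b" using k(2)[OF X] y z unfolding bounded_by_def by blast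
    finally have "?b * ?b \<le> k * ?a * ?b" by (simp add: power2_eq_square)
    then show ?thesis using k(1) vec_norm2_nonneg[of z] by (cases "?b = 0") (auto simp: mult_le_cancel_right)
  qed
  have "?b\<^sup>2 \<le> 2 * ?a * ?b + k * ?a"
  proof -
    have e1: "(X *\<^sub>v y) \<bullet>c z = of_real (?b\<^sup>2)" by (simp add: cinner_self[OF z] flip: z_def)
    have "(G *\<^sub>v z) \<bullet>c y = (X *\<^sub>v (G *\<^sub>v z)) \<bullet>c u"
      unfolding y_def using mat_adjoint_cinner[OF Xc _ u(1), of "G *\<^sub>v z"] Gc z by simp
    also have "X *\<^sub>v (G *\<^sub>v z) = (X * G * X) *\<^sub>v y"
      unfolding z_def using Xc Gc y by (simp add: assoc_mult_mat_vec[of _ n n _ n])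
    finally have e2: "cmod ((G *\<^sub>v z) \<bullet>c y) \<le> k * ?a"
      using k(2)[OF fgf] y u unfolding bounded_by_def by (metis mult.right_neutral)
    have e3: "cmod (of_real (?b\<^sup>2) + cnj ((G *\<^sub>v z) \<bullet>c y)) \<le> 2 * ?a * ?b"
      using double_layer_bound[OF cont _ y z] \<phi>(4) cU path_image_closed_region unfolding Xeq[symmetric] G_def[symmetric] e1 by blast
    have "?b\<^sup>2 = cmod (of_real (?b\<^sup>2))" by (simp add: norm_power)
    also have "\<dots> \<le> cmod (of_real (?b\<^sup>2) + cnj ((G *\<^sub>v z) \<bullet>c y)) + cmod (cnj ((G *\<^sub>v z) \<bullet>c y))"
      by (metis add_diff_cancel_right' norm_triangle_ineq4)
    finally show ?thesis using e2 e3 by simp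
  qed
  also have "\<dots> \<le> 2 * k * (k * k) + k * k"
  proof -
    have "k * ?a \<le> k * k" using ak k by (intro mult_left_mono)
    then have "?b \<le> k * k" using bk by simp
    then have "?a * ?b \<le> k * (k * k)" using ak k by (intro mult_mono) auto
    then show ?thesis using \<open>k * ?a \<le> k * k\<close> by simp
  qed
  finally have "?b\<^sup>2 \<le> 2 * k ^ 3 + k\<^sup>2" by (simp add: power2_eq_square power3_eq_cube)
  moreover have "?a ^ 4 \<le> ?b\<^sup>2"
    using power_mono[OF ab, of 2] by (simp flip: power_mult)
  ultimately show ?thesis by (simp add: y_def)
qed

text \<open>For the least constant \<open>k\<close> the previous estimate reads \<open>k\<^sup>4 \<le> 2 k\<^sup>3 + k\<^sup>2\<close>, that is \<open>k \<le> 1 + \<surd>2\<close>.\<close>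

lemma unit_class_bound:
  assumes n: "n \<ge> 1" and K: "compact K" "convex K" and V: "open V" "numerical_range A \<subseteq> V" "V \<subseteq> K"
    and X: "X \<in> unit_class K"
  shows "bounded_by X (1 + sqrt 2)"
proof -
  obtain k where k: "k \<ge> 0" "\<And>X. X \<in> unit_class K \<Longrightarrow> bounded_by X k"
    "\<And>k'. k' \<ge> 0 \<Longrightarrow> (\<And>X. X \<in> unit_class K \<Longrightarrow> bounded_by X k') \<Longrightarrow> k \<le> k'"
    using least_bound[OF unit_class_uniformly_bounded[OF n V]] by blast
  \<comment> \<open>The previous lemma bounds the adjoints of the class by \<open>k'\<close>, so \<open>k'\<close> is another constant for the
    class.\<close>
  define k' where "k' = root 4 (2 * k ^ 3 + k\<^sup>2)"
  have k'0: "k' \<ge> 0" unfolding k'_def using k(1) by simp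
  have k'4: "k' ^ 4 = 2 * k ^ 3 + k\<^sup>2" unfolding k'_def using k(1) by simp
  have b': "bounded_by X k'" if X: "X \<in> unit_class K" for X
    unfolding bounded_by_def
  proof (intro ballI)
    fix u w :: "complex vec" assume u: "u \<in> carrier_vec n" and w: "w \<in> carrier_vec n"
    have Xc: "X \<in> carrier_mat n n" using X function_value_carrier by (auto simp: unit_class_def)
    have aXc: "mat_adjoint X \<in> carrier_mat n n" using Xc by simp
    have "vec_norm2 (mat_adjoint X *\<^sub>v w) \<le> k' * vec_norm2 w"
    proof (cases "w = 0\<^sub>v n")
      case True
      then have "mat_adjoint X *\<^sub>v w = 0\<^sub>v n" using aXc by auto
      then show ?thesis using vec_norm2_eq_0_iff[of "0\<^sub>v n" n] True by simp
    next
      case False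
      define r where "r = vec_norm2 w"
      have r: "r > 0" using vec_norm2_pos[OF w False] by (simp add: r_def)
      define w' where "w' = of_real (1 / r) \<cdot>\<^sub>v w"
      have w': "w' \<in> carrier_vec n" "vec_norm2 w' = 1" using w r by (auto simp: w'_def vec_norm2_smult r_def[symmetric] norm_divide)
      have "vec_norm2 (mat_adjoint X *\<^sub>v w') ^ 4 \<le> k' ^ 4"
        unfolding k'4 using V by (intro ransford_schwenninger_step[OF n K _ k(1,2) X w']) auto
      then have "vec_norm2 (mat_adjoint X *\<^sub>v w') \<le> k'" using k'0 power_le_imp_le_base[of _ 3 k'] by (simp add: numeral_eq_Suc)
      then show ?thesis unfolding w'_def mult_mat_vec[OF aXc w] vec_norm2_smult
        using r by (simp add: r_def[symmetric] norm_divide field_simps)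
    qed
    then have "vec_norm2 u * vec_norm2 (mat_adjoint X *\<^sub>v w) \<le> vec_norm2 u * (k' * vec_norm2 w)"
      by (intro mult_left_mono) auto
    then show "cmod ((X *\<^sub>v u) \<bullet>c w) \<le> k' * vec_norm2 u * vec_norm2 w"
      using cauchy_schwarz[OF u, of "mat_adjoint X *\<^sub>v w"] aXc w unfolding mat_adjoint_cinner[OF Xc u w] by (simp add: mult_ac)
  qed
  have "k \<le> k'" using k(3) b' k'0 by blast
  then have "k ^ 4 \<le> 2 * k ^ 3 + k\<^sup>2" using power_mono[OF _ k(1), of k' 4] k'4 by simp
  have "k \<le> 1 + sqrt 2"
  proof (cases "k = 0")
    case False
    then have "k\<^sup>2 * (k\<^sup>2) \<le> k\<^sup>2 * (2 * k + 1)"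
      using \<open>k ^ 4 \<le> 2 * k ^ 3 + k\<^sup>2\<close> by (simp add: algebra_simps power2_eq_square power3_eq_cube power4_eq_xxxx)
    then have "k\<^sup>2 \<le> 2 * k + 1" by (rule mult_left_le_imp_le) (use False in simp)
    then have "(k - 1)\<^sup>2 \<le> 2" by (simp add: power2_eq_square algebra_simps)
    then show ?thesis using real_le_rsqrt by fastforce
  qed simp
  then have "k * vec_norm2 u * vec_norm2 w \<le> (1 + sqrt 2) * vec_norm2 u * vec_norm2 w" for u w :: "complex vec"
    by (intro mult_right_mono) auto
  then show ?thesis using k(2)[OF X] unfolding bounded_by_def by (meson order_trans)
qed

text \<open>The bound is applied to slightly larger regions, on which \<open>f\<close> is bounded by \<open>M + \<epsilon>\<close>. The numerical
  range itself may have empty interior and \<open>f\<close> may exceed \<open>M\<close> arbitrarily close to it.\<close>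

theorem crouzeix_palencia:
  assumes n: "n \<ge> 1" and \<Omega>: "open \<Omega>" "f holomorphic_on \<Omega>" "numerical_range A \<subseteq> \<Omega>"
    and M: "\<And>z. z \<in> numerical_range A \<Longrightarrow> cmod (f z) \<le> M"
    and X: "function_value f X" and u: "u \<in> carrier_vec n"
  shows "vec_norm2 (X *\<^sub>v u) \<le> (1 + sqrt 2) * M * vec_norm2 u"
proof -
  note W = compact_numerical_range[OF A] convex_numerical_range[OF A] numerical_range_nonempty[OF A n]
  obtain z0 where "z0 \<in> numerical_range A" using W(3) by blast
  then have M0: "M \<ge> 0" using order_trans[OF norm_ge_zero M] by blast
  have Xc: "X \<in> carrier_mat n n" by (rule function_value_carrier[OF X])
  have Xu: "X *\<^sub>v u \<in> carrier_vec n" using Xc u by simp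
  have main: "vec_norm2 (X *\<^sub>v u) \<le> (1 + sqrt 2) * (M + \<epsilon>) * vec_norm2 u" if \<epsilon>: "\<epsilon> > 0" for \<epsilon>
  proof -
    define V where "V = {z \<in> \<Omega>. cmod (f z) < M + \<epsilon>}"
    have "open V"
    proof -
      have "continuous_on \<Omega> (\<lambda>z. cmod (f z))" using \<Omega>(2) by (intro continuous_on_norm holomorphic_on_imp_continuous_on)
      then have "open (\<Omega> \<inter> (\<lambda>z. cmod (f z)) -` {..<M + \<epsilon>})" using \<Omega>(1) by (rule continuous_open_preimage) simp
      also have "\<Omega> \<inter> (\<lambda>z. cmod (f z)) -` {..<M + \<epsilon>} = V" by (auto simp: V_def)
      finally show ?thesis .
    qed
    moreover have "numerical_range A \<subseteq> V" using \<Omega>(3) M \<epsilon> by (force simp: V_def)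
    ultimately obtain \<gamma> \<rho> where c: "convex_curve \<gamma> \<rho>" and reg: "numerical_range A \<subseteq> convex_curve.region \<gamma>"
      and cV: "convex_curve.closed_region \<gamma> \<subseteq> V" using convex_curve_exists[OF W] by blast
    interpret c: convex_curve \<gamma> \<rho> by (rule c)
    have op: "open c.region" using c.open_parallel_set[of 0] by (simp add: c.region_def)
    define s :: complex where "s = of_real (1 / (M + \<epsilon>))"
    have s: "cmod s = 1 / (M + \<epsilon>)" "M + \<epsilon> > 0" using M0 \<epsilon> by (auto simp: s_def norm_divide simp flip: of_real_add)
    \<comment> \<open>Scaling \<open>f\<close> to modulus at most 1 on \<open>V\<close>, written as a product with a constant function.\<close>
    define Y where "Y = poly_at_mat A [:s:] * X"
    have Y: "Y \<in> unit_class c.closed_region"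
      unfolding unit_class_def
    proof (intro CollectI exI conjI ballI)
      show "open V" "c.closed_region \<subseteq> V" by fact+
      show "(\<lambda>z. poly [:s:] z * f z) holomorphic_on V"
        by (intro holomorphic_on_mult holomorphic_on_subset[OF \<Omega>(2)]) (auto simp: V_def)
      show "function_value (\<lambda>z. poly [:s:] z * f z) Y" unfolding Y_def by (intro function_value_mult function_value_poly X)
      show "cmod (poly [:s:] z * f z) \<le> 1" if "z \<in> V" for z
        using that s by (simp add: V_def norm_mult)
    qed
    have Yeq: "Y *\<^sub>v v = s \<cdot>\<^sub>v (X *\<^sub>v v)" if v: "v \<in> carrier_vec n" for v
    proof -
      have "poly_at_mat A [:s:] = s \<cdot>\<^sub>m 1\<^sub>m n" using poly_at_mat_smult[OF A, of s 1] poly_at_mat_1[OF A] by simp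
      then show ?thesis unfolding Y_def using Xc v by (auto intro!: eq_vecI simp: mult_smult_assoc_mat[OF one_carrier_mat Xc])
    qed
    have "bounded_by Y (1 + sqrt 2)"
      by (rule unit_class_bound[OF n c.compact_closed_region c.convex_closed_region op reg c.region_subset_closed_region Y])
    then have "cmod ((Y *\<^sub>v u) \<bullet>c (X *\<^sub>v u)) \<le> (1 + sqrt 2) * vec_norm2 u * vec_norm2 (X *\<^sub>v u)"
      using u Xu unfolding bounded_by_def by blast
    moreover have "(Y *\<^sub>v u) \<bullet>c (X *\<^sub>v u) = s * of_real ((vec_norm2 (X *\<^sub>v u))\<^sup>2)"
      unfolding Yeq[OF u] cinner_smult_left[OF Xu Xu] cinner_self[OF Xu] ..
    ultimately have "1 / (M + \<epsilon>) * (vec_norm2 (X *\<^sub>v u))\<^sup>2 \<le> (1 + sqrt 2) * vec_norm2 u * vec_norm2 (X *\<^sub>v u)"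
      using s by (simp add: norm_mult norm_power)
    then have "vec_norm2 (X *\<^sub>v u) * vec_norm2 (X *\<^sub>v u) \<le> ((1 + sqrt 2) * (M + \<epsilon>) * vec_norm2 u) * vec_norm2 (X *\<^sub>v u)"
      using s(2) by (simp add: power2_eq_square field_simps)
    moreover have "0 \<le> (1 + sqrt 2) * (M + \<epsilon>) * vec_norm2 u" using s(2) by simp
    ultimately show ?thesis using vec_norm2_nonneg[of "X *\<^sub>v u"]
      by (cases "vec_norm2 (X *\<^sub>v u) = 0") (auto simp: mult_le_cancel_right)
  qed
  show ?thesis
  proof (rule field_le_epsilon)
    fix e :: real assume e: "e > 0"
    define \<epsilon> where "\<epsilon> = e / ((1 + sqrt 2) * (vec_norm2 u + 1))"
    have p: "(1 + sqrt 2) * (vec_norm2 u + 1) > 0" by (intro mult_pos_pos add_pos_nonneg add_nonneg_pos) auto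
    have \<epsilon>: "\<epsilon> > 0" unfolding \<epsilon>_def using e p by simp
    have "(1 + sqrt 2) * \<epsilon> * vec_norm2 u \<le> (1 + sqrt 2) * \<epsilon> * (vec_norm2 u + 1)"
      using \<epsilon> by (intro mult_left_mono) auto
    also have "\<dots> = e" using p unfolding \<epsilon>_def by (simp add: field_simps)
    finally show "vec_norm2 (X *\<^sub>v u) \<le> (1 + sqrt 2) * M * vec_norm2 u + e"
      using main[OF \<epsilon>] by (simp add: algebra_simps)
  qed
qed

end

section \<open>Best polynomial approximation\<close>

lemma sup_norm_on_upper:
  assumes "compact K" "continuous_on K g" "z \<in> K"
  shows "cmod (g z) \<le> sup_norm_on K g"
proof -
  have "bdd_above ((\<lambda>z. cmod (g z)) ` K)"
    using assms by (intro bounded_imp_bdd_above compact_imp_bounded compact_continuous_image continuous_on_norm)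
  then show ?thesis unfolding sup_norm_on_def using assms(3) by (rule cSUP_upper2[OF _ _ order_refl])
qed

lemma sup_norm_on_least:
  assumes "K \<noteq> {}" "\<And>z. z \<in> K \<Longrightarrow> cmod (g z) \<le> c"
  shows "sup_norm_on K g \<le> c"
  unfolding sup_norm_on_def using assms by (intro cSUP_least) auto

text \<open>Polynomials are parametrised by their values at nodes in \<open>K\<close>, because these values are bounded
  by the uniform norm on \<open>K\<close>.\<close>

definition lagrange_basis :: "(nat \<Rightarrow> complex) \<Rightarrow> nat \<Rightarrow> nat \<Rightarrow> complex poly" where
  "lagrange_basis s N i = Polynomial.smult (1 / (\<Prod>j\<in>{..<N}-{i}. s i - s j)) (\<Prod>j\<in>{..<N}-{i}. [:- s j, 1:])"

lemma lagrange_basis_at_node: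
  assumes "inj_on s {..<N}" "i < N" "j < N"
  shows "poly (lagrange_basis s N i) (s j) = (if i = j then 1 else 0)"
proof -
  have "(\<Prod>l\<in>{..<N}-{i}. s i - s l) \<noteq> 0"
    using assms by (auto simp: inj_on_def)
  moreover have "i \<noteq> j \<Longrightarrow> (\<Prod>l\<in>{..<N}-{i}. s j - s l) = 0"
    using assms by (intro prod_zero) auto
  ultimately show ?thesis by (cases "i = j") (simp_all add: lagrange_basis_def poly_prod)
qed

lemma degree_lagrange_basis: "i < N \<Longrightarrow> degree (lagrange_basis s N i) \<le> N - 1"
proof -
  assume i: "i < N"
  have "degree (\<Prod>j\<in>{..<N}-{i}. [:- s j, 1:]) \<le> sum (degree \<circ> (\<lambda>j. [:- s j, 1:])) ({..<N}-{i})"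
    by (rule degree_prod_sum_le) simp
  also have "\<dots> = N - 1" using i by simp
  finally show ?thesis unfolding lagrange_basis_def using degree_smult_le order_trans by blast
qed

definition interpolate :: "(nat \<Rightarrow> complex) \<Rightarrow> nat \<Rightarrow> (nat \<Rightarrow> complex) \<Rightarrow> complex poly" where
  "interpolate s N y = (\<Sum>i<N. Polynomial.smult (y i) (lagrange_basis s N i))"

lemma degree_interpolate: "degree (interpolate s N y) \<le> N - 1"
  unfolding interpolate_def
proof (rule degree_sum_le)
  fix i assume "i \<in> {..<N}"
  then show "degree (Polynomial.smult (y i) (lagrange_basis s N i)) \<le> N - 1"
    using order_trans[OF degree_smult_le degree_lagrange_basis] by simp
qed simp

lemma poly_interpolate: "poly (interpolate s N y) z = (\<Sum>i<N. y i * poly (lagrange_basis s N i) z)"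
  by (simp add: interpolate_def poly_sum)

lemma interpolate_at_node:
  assumes "inj_on s {..<N}" "j < N"
  shows "poly (interpolate s N y) (s j) = y j"
proof -
  have "poly (interpolate s N y) (s j) = (\<Sum>i<N. if i = j then y j else 0)"
    unfolding poly_interpolate using assms by (intro sum.cong refl) (auto simp: lagrange_basis_at_node)
  then show ?thesis using assms by simp
qed

text \<open>A compactness argument in the space of values at the nodes. The near-optimal value vectors lie
  in a fixed box, and the sublevel sets are closed as intersections over the points of \<open>K\<close>, so
  they have a common point. If \<open>K\<close> has at most \<open>d\<close> points, all of them are nodes; a polynomial of
  degree \<open>d\<close> is then not determined by its values there, but its error on \<open>K\<close> is.\<close>

theorem best_approximation_exists:
  assumes K: "compact K" "K \<noteq> {}" and f: "continuous_on K f"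
  shows "\<exists>p. is_arg_min (\<lambda>p. sup_norm_on K (\<lambda>z. f z - poly p z)) (\<lambda>p. degree p \<le> d) p"
proof -
  define E where "E p = sup_norm_on K (\<lambda>z. f z - poly p z)" for p
  have cont: "continuous_on K (\<lambda>z. f z - poly p z)" for p by (intro continuous_intros f)
  have E_upper: "cmod (f z - poly p z) \<le> E p" if "z \<in> K" for z p
    unfolding E_def by (rule sup_norm_on_upper[OF K(1) cont that])
  have E_le: "E p \<le> c \<longleftrightarrow> (\<forall>z\<in>K. cmod (f z - poly p z) \<le> c)" for p c
    using E_upper[of _ p] sup_norm_on_least[OF K(2), of "\<lambda>z. f z - poly p z" c] unfolding E_def by (meson order_trans)
  have E_cong: "E p = E q" if "\<And>z. z \<in> K \<Longrightarrow> poly p z = poly q z" for p q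
    unfolding E_def sup_norm_on_def using that by (intro SUP_cong) auto
  \<comment> \<open>The set of nodes: \<open>d + 1\<close> points of \<open>K\<close> if there are as many, otherwise all of \<open>K\<close>.\<close>
  obtain N S where S: "S \<subseteq> K" "finite S" "card S = N" "N \<le> d + 1" "S = K \<or> N = d + 1"
  proof (cases "finite K \<and> card K \<le> d")
    case True
    then show ?thesis using that[of K "card K"] by simp
  next
    case False
    have "\<exists>S. S \<subseteq> K \<and> finite S \<and> card S = d + 1"
    proof (cases "finite K")
      case True
      then have "d + 1 \<le> card K" using False by simp
      then show ?thesis using obtain_subset_with_card_n[of "d + 1" K] by metis
    next
      case False
      then show ?thesis using infinite_arbitrarily_large[of K "d + 1"] by blast
    qed
    then obtain S where "S \<subseteq> K" "finite S" "card S = d + 1" by blast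
    then show ?thesis using that[of S "d + 1"] by simp
  qed
  obtain s where s: "bij_betw s {..<N} S"
    using ex_bij_betw_nat_finite[OF S(2)] S(3) by (auto simp: lessThan_atLeast0)
  have inj: "inj_on s {..<N}" and img: "s ` {..<N} = S" using s by (auto simp: bij_betw_def)
  have N1: "N \<ge> 1" using S K by (cases "N = 0") auto
  have rep: "E p = E (interpolate s N (\<lambda>i. poly p (s i)))" if p: "degree p \<le> d" for p
  proof -
    let ?q = "interpolate s N (\<lambda>i. poly p (s i))"
    have nodes: "poly p z = poly ?q z" if "z \<in> S" for z
      using that interpolate_at_node[OF inj] unfolding img[symmetric] by auto
    from S(5) show ?thesis
    proof
      assume "S = K"
      then show ?thesis using nodes by (intro E_cong) auto
    next
      assume N: "N = d + 1"
      have "p - ?q = 0"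
      proof (rule ccontr)
        assume nz: "p - ?q \<noteq> 0"
        have "S \<subseteq> {z. poly (p - ?q) z = 0}" using nodes by auto
        then have "N \<le> card {z. poly (p - ?q) z = 0}"
          using card_mono[OF poly_roots_finite[OF nz]] S(3) by auto
        also have "\<dots> \<le> degree (p - ?q)" by (rule card_poly_roots_bound[OF nz])
        also have "\<dots> \<le> d" using degree_interpolate[of s N] N p by (intro degree_diff_le) auto
        finally show False using N by simp
      qed
      then show ?thesis by simp
    qed
  qed
  define F where "F = E 0"
  \<comment> \<open>A polynomial that approximates at least as well as 0 is bounded by \<open>2 F\<close> on \<open>K\<close>.\<close>
  define Box where "Box = {x :: nat \<Rightarrow> complex. (\<forall>i\<ge>N. x i = 0) \<and> (\<forall>i<N. cmod (x i) \<le> 2 * F)}"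
  define T where "T c = {y. E (interpolate s N y) \<le> c}" for c
  have Tcl: "closed (T c)" for c
  proof -
    have "T c = (\<Inter>z\<in>K. {y. cmod (f z - (\<Sum>i<N. y i * poly (lagrange_basis s N i) z)) \<le> c})"
      unfolding T_def E_le poly_interpolate by auto
    moreover have "closed {y :: nat \<Rightarrow> complex. cmod (f z - (\<Sum>i<N. y i * poly (lagrange_basis s N i) z)) \<le> c}" for z
      by (intro closed_Collect_le continuous_intros)
    ultimately show ?thesis by auto
  qed
  define \<mu> where "\<mu> = Inf (E ` {p. degree p \<le> d})"
  obtain z0 where z0: "z0 \<in> K" using K(2) by blast
  have E0: "E p \<ge> 0" for p by (rule order_trans[OF norm_ge_zero E_upper[OF z0]])
  have bdd: "bdd_below (E ` {p. degree p \<le> d})" by (rule bdd_belowI[of _ 0]) (auto simp: E0)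
  have \<mu>_le: "\<mu> \<le> E p" if "degree p \<le> d" for p unfolding \<mu>_def using bdd that by (intro cInf_lower) auto
  have ne: "Box \<inter> T c \<noteq> {}" if c: "c > \<mu>" for c
  proof -
    obtain p where p: "degree p \<le> d" "E p < c" "E p \<le> F"
    proof -
      have "\<exists>x\<in>E ` {p. degree p \<le> d}. x < c"
        using c unfolding \<mu>_def by (subst (asm) cInf_less_iff) (use bdd in \<open>auto intro: exI[of _ 0]\<close>)
      then obtain p where "degree p \<le> d" "E p < c" by auto
      then show ?thesis using that[of p] that[of 0] unfolding F_def by (cases "E p \<le> E 0") auto
    qed
    define y where "y i = (if i < N then poly p (s i) else 0)" for i
    have eq: "interpolate s N y = interpolate s N (\<lambda>i. poly p (s i))"
      unfolding interpolate_def by (intro sum.cong refl) (simp add: y_def)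
    have "cmod (poly p z) \<le> 2 * F" if "z \<in> K" for z
    proof -
      have "poly p z = (f z - poly 0 z) - (f z - poly p z)" by simp
      then have "cmod (poly p z) \<le> cmod (f z - poly 0 z) + cmod (f z - poly p z)"
        by (metis norm_triangle_ineq4)
      then show ?thesis using E_upper[OF that, of 0] E_upper[OF that, of p] p(3) unfolding F_def by linarith
    qed
    then have "y \<in> Box" using S(1) img by (auto simp: Box_def y_def)
    moreover have "y \<in> T c" using rep[OF p(1)] p(2) by (simp add: T_def eq)
    ultimately show ?thesis by blast
  qed
  have "Box \<inter> \<Inter>(T ` {c. c > \<mu>}) \<noteq> {}"
  proof (rule compact_imp_fip)
    show "compact Box" unfolding Box_def by (rule compact_coord_box)
    show "closed X" if "X \<in> T ` {c. c > \<mu>}" for X using that Tcl by auto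
    fix \<F> assume "finite \<F>" "\<F> \<subseteq> T ` {c. c > \<mu>}"
    then obtain C where C: "finite C" "C \<subseteq> {c. c > \<mu>}" "\<F> = T ` C" by (meson finite_subset_image)
    define c where "c = Min (insert (\<mu> + 1) C)"
    have "c > \<mu>" using C by (auto simp: c_def)
    moreover have "T c \<subseteq> X" if X: "X \<in> \<F>" for X
    proof -
      obtain c' where c': "c' \<in> C" "X = T c'" using X C(3) by auto
      have "c \<le> c'" using C(1) c'(1) by (simp add: c_def)
      then show ?thesis by (auto simp: T_def c'(2))
    qed
    ultimately show "Box \<inter> \<Inter>\<F> \<noteq> {}" using ne[of c] by blast
  qed
  then obtain y where y: "\<And>c. c > \<mu> \<Longrightarrow> y \<in> T c" by auto
  define p where "p = interpolate s N y"
  have "E p \<le> \<mu>"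
  proof (rule dense_ge)
    show "E p \<le> c" if "\<mu> < c" for c using y[OF that] by (simp add: T_def p_def)
  qed
  moreover have "degree p \<le> d" using degree_interpolate[of s N y] S(4) by (simp add: p_def)
  ultimately have "is_arg_min E (\<lambda>p. degree p \<le> d) p"
    unfolding is_arg_min_def using \<mu>_le by (auto simp: not_less intro: order_trans)
  then show ?thesis unfolding E_def by blast
qed

section \<open>Krylov bases\<close>

lemma combination_in_span:
  fixes g :: "nat \<Rightarrow> real vec" and S :: "real vec set"
  assumes S: "S \<subseteq> carrier_vec n" and I: "finite I" "\<And>i. i \<in> I \<Longrightarrow> g i \<in> S"
  shows "vec n (\<lambda>r. \<Sum>i\<in>I. c i * (g i $ r)) \<in> LinearCombinations.module.span class_ring (module_vec TYPE(real) n) S"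
proof -
  interpret vec_space "TYPE(real)" n .
  note Sc = S
  have sub: "submodule class_ring (span S) V" by (rule span_is_submodule[OF Sc])
  show ?thesis using I
  proof (induction I rule: finite_induct)
    case empty
    have "vec n (\<lambda>r. \<Sum>i\<in>{}. c i * (g i $ r)) = 0\<^sub>v n" by (intro eq_vecI) auto
    then show ?case using submodule.zero_closed[OF sub] by simp
  next
    case (insert i I)
    have gi: "g i \<in> span S" using insert.prems in_own_span[OF Sc] by blast
    have "vec n (\<lambda>r. \<Sum>j\<in>insert i I. c j * (g j $ r)) = c i \<cdot>\<^sub>v g i + vec n (\<lambda>r. \<Sum>j\<in>I. c j * (g j $ r))"
    proof -
      have "g i \<in> carrier_vec n" using insert.prems S by blast
      then show ?thesis using insert.hyps by (intro eq_vecI) auto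
    qed
    moreover have "c i \<cdot>\<^sub>v g i \<in> span S"
      using submodule.smult_closed[OF sub, of "c i" "g i"] gi by (simp add: class_ring_simps)
    moreover have "vec n (\<lambda>r. \<Sum>j\<in>I. c j * (g j $ r)) \<in> span S" using insert by blast
    ultimately show ?case using submodule.m_closed[OF sub] by simp
  qed
qed

lemma subspace_dim_span_le:
  fixes S S' :: "real vec set"
  assumes S: "S \<subseteq> carrier_vec n" and S': "S' \<subseteq> S" "finite S'"
    and gen: "S \<subseteq> LinearCombinations.module.span class_ring (module_vec TYPE(real) n) S'"
  shows "subspace_dim n (LinearCombinations.module.span class_ring (module_vec TYPE(real) n) S) \<le> card S'"
proof -
  interpret vec_space "TYPE(real)" n .
  note Sc = S
  have Sc': "S' \<subseteq> carrier_vec n" using Sc S' by blast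
  have sub: "submodule class_ring (span S) V" by (rule span_is_submodule[OF Sc])
  have sub': "submodule class_ring (span S') V" by (rule span_is_submodule[OF Sc'])
  have eq: "span S = span S'"
    using span_is_subset[OF gen sub'] span_is_monotone[OF S'(1)] by blast
  have in': "S' \<subseteq> span S" using S'(1) in_own_span[OF Sc] by blast
  have vs: "vectorspace class_ring (V\<lparr>carrier := span S\<rparr>)"
    using subspace_is_vs[of "span S"] sub vectorspace_axioms by (simp add: subspace_def)
  have g: "LinearCombinations.module.span class_ring (V\<lparr>carrier := span S\<rparr>) S' = span S"
    using span_li_not_depend(1)[OF in' sub] eq by simp
  show ?thesis unfolding subspace_dim_def
    by (rule vectorspace.gen_ge_dim[OF vs S'(2)]) (use in' g in simp_all)
qed

text \<open>If one of the \<open>m\<close> generators depended on the others, the Krylov space would be spanned by fewer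
  than \<open>m\<close> vectors.\<close>

lemma krylov_independent:
  fixes A :: "real mat" and y :: "nat \<Rightarrow> real"
  assumes A: "A \<in> carrier_mat n n" and b: "b \<in> carrier_vec n"
    and dim: "subspace_dim n (krylov_space A b m) = m"
    and zero: "\<And>r. r < n \<Longrightarrow> (\<Sum>i<m. y i * ((A ^\<^sub>m i *\<^sub>v b) $ r)) = 0"
    and i0: "i0 < m"
  shows "y i0 = 0"
proof (rule ccontr)
  assume y0: "y i0 \<noteq> 0"
  define g where "g i = A ^\<^sub>m i *\<^sub>v b" for i
  have g: "g i \<in> carrier_vec n" for i unfolding g_def using A b by (auto intro!: mult_mat_vec_carrier)
  define S S' where "S = g ` {..<m}" and "S' = g ` ({..<m} - {i0})"
  have S: "S \<subseteq> carrier_vec n" using g by (auto simp: S_def)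
  have S'S: "S' \<subseteq> S" "finite S'" by (auto simp: S_def S'_def)
  have S'c: "S' \<subseteq> carrier_vec n" using S S'S by blast
  have kry: "krylov_space A b m = LinearCombinations.module.span class_ring (module_vec TYPE(real) n) S"
  proof -
    have "{A ^\<^sub>m i *\<^sub>v b |i. i < m} = S" by (auto simp: S_def g_def)
    then show ?thesis unfolding krylov_space_def using A by simp
  qed
  interpret vec_space "TYPE(real)" n .
  have own: "S' \<subseteq> span S'" using in_own_span[of S'] S'c by simp
  have "g i0 = vec n (\<lambda>r. \<Sum>i\<in>{..<m} - {i0}. (- y i / y i0) * (g i $ r))"
  proof (rule eq_vecI)
    fix r assume "r < dim_vec (vec n (\<lambda>r. \<Sum>i\<in>{..<m} - {i0}. (- y i / y i0) * (g i $ r)))"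
    then have r: "r < n" by simp
    have "0 = (\<Sum>i<m. y i * (g i $ r))" using zero[OF r] by (simp add: g_def)
    also have "\<dots> = y i0 * (g i0 $ r) + (\<Sum>i\<in>{..<m} - {i0}. y i * (g i $ r))"
      using i0 by (intro sum.remove) auto
    finally have "g i0 $ r = - (\<Sum>i\<in>{..<m} - {i0}. y i * (g i $ r)) / y i0"
      using y0 by (simp add: field_simps)
    also have "\<dots> = (\<Sum>i\<in>{..<m} - {i0}. (- y i / y i0) * (g i $ r))"
      by (simp add: sum_divide_distrib sum_negf)
    finally show "g i0 $ r = vec n (\<lambda>r. \<Sum>i\<in>{..<m} - {i0}. (- y i / y i0) * (g i $ r)) $ r" using r by simp
  qed (use g in auto)
  also have "\<dots> \<in> span S'" by (rule combination_in_span[OF S'c]) (auto simp: S'_def)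
  finally have "S \<subseteq> span S'" using own by (auto simp: S_def S'_def)
  then have "m \<le> card S'" using subspace_dim_span_le[OF S S'S] dim kry by simp
  also have "\<dots> \<le> card ({..<m} - {i0})" unfolding S'_def by (rule card_image_le) simp
  also have "\<dots> < m" using i0 by simp
  finally show False by simp
qed

text \<open>The relations that the procedure leaves behind, free of its program variables: the recurrence
  \<open>A v\<^sub>c = \<Sum>\<^sub>l h\<^sub>l\<^sub>c v\<^sub>l\<close>, the starting vector and the Hessenberg shape.\<close>

definition arnoldi_like :: "real mat \<Rightarrow> real vec \<Rightarrow> nat \<Rightarrow> nat \<Rightarrow> (nat \<Rightarrow> real vec) \<Rightarrow> (nat \<Rightarrow> nat \<Rightarrow> real) \<Rightarrow> bool" where
  "arnoldi_like A b n m v h \<longleftrightarrow>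
     (\<forall>i\<in>{1..m + 1}. v i \<in> carrier_vec n) \<and> (\<exists>\<beta>\<noteq>0. b = \<beta> \<cdot>\<^sub>v v 1) \<and>
     (\<forall>c\<in>{1..m}. \<forall>r<n. (A *\<^sub>v v c) $ r = (\<Sum>l=1..c+1. h l c * (v l $ r))) \<and>
     (\<forall>j c. j > c + 1 \<longrightarrow> h j c = 0)"

lemma vec_norm2_real_nonzero:
  fixes u :: "real vec"
  assumes "u \<in> carrier_vec n" "u \<noteq> 0\<^sub>v n"
  shows "vec_norm2 u \<noteq> 0"
proof
  assume "vec_norm2 u = 0"
  then have "\<forall>i<n. u $ i = 0" using assms(1) by (auto simp: vec_norm2_def L2_set_eq_0_iff)
  then have "u = 0\<^sub>v n" using assms(1) by (intro eq_vecI) auto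
  then show False using assms(2) by simp
qed

text \<open>Unrolling the inner loop expresses \<open>w\<^sub>i\<close> as \<open>A v\<^sub>i\<^sub>-\<^sub>1\<close> minus the projections removed so far; the
  terms before the truncation index may be included because their coefficients are zero.\<close>

lemma truncated_orthogonalization_arnoldi:
  assumes A: "A \<in> carrier_mat n n" and b: "b \<in> carrier_vec n" and k: "k \<ge> 1"
    and t: "truncated_orthogonalization A b m k v h"
  shows "arnoldi_like A b n m v h"
proof -
  from t obtain w :: "nat \<Rightarrow> nat \<Rightarrow> real vec" where b0: "b \<noteq> 0\<^sub>v (dim_vec b)" and v1: "v 1 = (1 / vec_norm2 b) \<cdot>\<^sub>v b"
    and w: "\<And>i. i \<in> {2..m + 1} \<Longrightarrow> w i (max 1 (i - k)) = A *\<^sub>v v (i - 1)"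
      "\<And>i j. i \<in> {2..m + 1} \<Longrightarrow> j \<in> {max 1 (i - k)..i - 1} \<Longrightarrow> w i (j + 1) = w i j - h j (i - 1) \<cdot>\<^sub>v v j"
      "\<And>i. i \<in> {2..m + 1} \<Longrightarrow> w i i \<noteq> 0\<^sub>v (dim_row A)"
      "\<And>i. i \<in> {2..m + 1} \<Longrightarrow> h i (i - 1) = vec_norm2 (w i i)"
      "\<And>i. i \<in> {2..m + 1} \<Longrightarrow> v i = (1 / vec_norm2 (w i i)) \<cdot>\<^sub>v w i i"
    and hz: "\<And>j c. \<not> (\<exists>i \<in> {2..m + 1}. c = i - 1 \<and> max 1 (i - k) \<le> j \<and> j \<le> i) \<Longrightarrow> h j c = 0"
    unfolding truncated_orthogonalization_def by blast
  have nb: "vec_norm2 b \<noteq> 0" using vec_norm2_real_nonzero[OF b] b0 b by simp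
  have loop: "w i j \<in> carrier_vec n \<and> (\<forall>r<n. w i j $ r = (A *\<^sub>v v (i - 1)) $ r - (\<Sum>l=max 1 (i - k)..<j. h l (i - 1) * (v l $ r)))"
    if i: "i \<in> {2..m + 1}" and prev: "\<And>l. l \<in> {1..i - 1} \<Longrightarrow> v l \<in> carrier_vec n" and j: "max 1 (i - k) \<le> j" "j \<le> i" for i j
    using j
  proof (induction j rule: dec_induct)
    case base
    have "A *\<^sub>v v (i - 1) \<in> carrier_vec n" using A by (auto intro!: carrier_vecI)
    then show ?case using w(1)[OF i] by simp
  next
    case (step j)
    have wj: "w i (j + 1) = w i j - h j (i - 1) \<cdot>\<^sub>v v j" using w(2)[OF i, of j] step by auto
    have vj: "v j \<in> carrier_vec n" using prev[of j] step by auto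
    show ?case using step wj vj by (auto simp: sum.atLeastLessThan_Suc)
  qed
  have v: "v i \<in> carrier_vec n" if "i \<in> {1..m + 1}" for i
    using that
  proof (induction i rule: less_induct)
    case (less i)
    show ?case
    proof (cases "i = 1")
      case True then show ?thesis using v1 b by simp
    next
      case False
      then have i: "i \<in> {2..m + 1}" using less.prems by auto
      have pv: "v l \<in> carrier_vec n" if "l \<in> {1..i - 1}" for l using less.IH[of l] that i by auto
      have "w i i \<in> carrier_vec n" using loop[OF i pv, of i] i k by auto
      then show ?thesis using w(5)[OF i] by simp
    qed
  qed
  have rec: "(A *\<^sub>v v c) $ r = (\<Sum>l=1..c+1. h l c * (v l $ r))" if c: "c \<in> {1..m}" and r: "r < n" for c r
  proof -
    define i where "i = c + 1"
    have i: "i \<in> {2..m + 1}" "i - 1 = c" using c by (auto simp: i_def)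
    let ?j0 = "max 1 (i - k)"
    have j0: "?j0 \<le> i" "1 \<le> ?j0" using k i by auto
    have wi: "w i i \<in> carrier_vec n" "w i i $ r = (A *\<^sub>v v c) $ r - (\<Sum>l=?j0..<i. h l c * (v l $ r))"
    proof -
      have pv: "v l \<in> carrier_vec n" if "l \<in> {1..i - 1}" for l using v[of l] that i by auto
      have L: "w i i \<in> carrier_vec n \<and> (\<forall>r<n. w i i $ r = (A *\<^sub>v v (i - 1)) $ r - (\<Sum>l=?j0..<i. h l (i - 1) * (v l $ r)))"
        by (rule loop[OF i(1) pv j0(1) order_refl])
      show "w i i \<in> carrier_vec n" by (rule conjunct1[OF L])
      show "w i i $ r = (A *\<^sub>v v c) $ r - (\<Sum>l=?j0..<i. h l c * (v l $ r))"
        using conjunct2[OF L] r unfolding i(2) by blast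
    qed
    have nz: "vec_norm2 (w i i) \<noteq> 0" using vec_norm2_real_nonzero[OF wi(1)] w(3)[OF i(1)] A by simp
    have "h i c * (v i $ r) = w i i $ r" using w(4,5)[OF i(1)] nz wi(1) r unfolding i(2) by simp
    moreover have "(\<Sum>l=1..<i. h l c * (v l $ r)) = (\<Sum>l=?j0..<i. h l c * (v l $ r))"
    proof (rule sum.mono_neutral_right)
      show "\<forall>l\<in>{1..<i} - {?j0..<i}. h l c * (v l $ r) = 0"
      proof
        fix l assume l: "l \<in> {1..<i} - {?j0..<i}"
        have "h l c = 0"
        proof (rule hz, safe)
          fix i' assume "i' \<in> {2..m + 1}" "c = i' - 1" "max 1 (i' - k) \<le> l" "l \<le> i'"
          moreover then have "i' = i" using i by auto
          ultimately show False using l by auto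
        qed
        then show "h l c * (v l $ r) = 0" by simp
      qed
    qed (use j0 in auto)
    moreover have "(\<Sum>l=1..c+1. h l c * (v l $ r)) = (\<Sum>l=1..<i. h l c * (v l $ r)) + h i c * (v i $ r)"
      using c by (simp add: i_def atLeastLessThanSuc_atLeastAtMost[symmetric])
    ultimately show ?thesis using wi(2) by simp
  qed
  have hess: "h j c = 0" if "j > c + 1" for j c
    by (rule hz) (use that in auto)
  have "b = vec_norm2 b \<cdot>\<^sub>v v 1" using v1 nb b by (intro eq_vecI) auto
  then have "\<exists>\<beta>\<noteq>0. b = \<beta> \<cdot>\<^sub>v v 1" using nb by (intro exI[of _ "vec_norm2 b"] conjI)
  with v rec hess show ?thesis unfolding arnoldi_like_def by (intro conjI ballI allI impI) auto
qed

lemma pow_mat_Suc_left: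
  fixes A :: "'a :: semiring_1 mat"
  assumes A: "A \<in> carrier_mat n n"
  shows "A ^\<^sub>m Suc i = A * A ^\<^sub>m i"
proof (induction i)
  case 0
  then show ?case using A by simp
next
  case (Suc i)
  have "A ^\<^sub>m Suc (Suc i) = (A * A ^\<^sub>m i) * A" using Suc by simp
  also have "\<dots> = A * (A ^\<^sub>m i * A)" by (rule assoc_mult_mat[OF A pow_carrier_mat[OF A] A])
  finally show ?case by simp
qed

lemma inverse_of_injective:
  fixes G :: "'a :: field mat"
  assumes G: "G \<in> carrier_mat m m" and inj: "\<And>x. x \<in> carrier_vec m \<Longrightarrow> G *\<^sub>v x = 0\<^sub>v m \<Longrightarrow> x = 0\<^sub>v m"
  obtains S where "S \<in> carrier_mat m m" "G * S = 1\<^sub>m m" "S * G = 1\<^sub>m m"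
proof -
  have "det G \<noteq> 0" using det_0_iff_vec_prod_zero_field[OF G] inj by blast
  then have "G \<in> Units (ring_mat TYPE('a) m ())" by (rule det_non_zero_imp_unit[OF G])
  then show ?thesis using that unfolding Units_def ring_mat_def by auto
qed

context
  fixes A :: "real mat" and b :: "real vec" and n m :: nat and v :: "nat \<Rightarrow> real vec" and h :: "nat \<Rightarrow> nat \<Rightarrow> real"
  assumes A: "A \<in> carrier_mat n n" and b: "b \<in> carrier_vec n" and arn: "arnoldi_like A b n m v h"
begin

lemma arn_v: "i \<in> {1..m + 1} \<Longrightarrow> v i \<in> carrier_vec n"
  using arn by (auto simp: arnoldi_like_def)

lemma arn_hess: "j > c + 1 \<Longrightarrow> h j c = 0"
  using arn unfolding arnoldi_like_def by blast

lemma arn_column: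
  assumes j: "j + 1 < m" and r: "r < n"
  shows "(A *\<^sub>v v (j + 1)) $ r = (\<Sum>l<m. h (l + 1) (j + 1) * (v (l + 1) $ r))"
proof -
  have "(A *\<^sub>v v (j + 1)) $ r = (\<Sum>l=1..j+2. h l (j + 1) * (v l $ r))"
    using arn j r unfolding arnoldi_like_def by auto
  also have "\<dots> = (\<Sum>l=1..m. h l (j + 1) * (v l $ r))"
    by (rule sum.mono_neutral_left) (use j arn_hess[of "j + 1"] in auto)
  also have "\<dots> = (\<Sum>l<m. h (l + 1) (j + 1) * (v (l + 1) $ r))"
    using sum.atLeast1_atMost_eq[of "\<lambda>l. h l (j + 1) * (v l $ r)" m] by simp
  finally show ?thesis .
qed

lemma mult_combination:
  fixes u :: "real vec" and x :: "nat \<Rightarrow> real"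
  assumes u: "\<And>r. r < n \<Longrightarrow> u $ r = (\<Sum>j<m. x j * (v (j + 1) $ r))" "u \<in> carrier_vec n" and r: "r < n"
  shows "(A *\<^sub>v u) $ r = (\<Sum>j<m. x j * ((A *\<^sub>v v (j + 1)) $ r))"
proof -
  have "(A *\<^sub>v u) $ r = (\<Sum>s<n. A $$ (r, s) * u $ s)"
    using A u(2) r by (simp add: scalar_prod_def lessThan_atLeast0)
  also have "\<dots> = (\<Sum>s<n. \<Sum>j<m. x j * (A $$ (r, s) * v (j + 1) $ s))"
    by (intro sum.cong refl) (simp add: u(1) sum_distrib_left mult_ac)
  also have "\<dots> = (\<Sum>j<m. \<Sum>s<n. x j * (A $$ (r, s) * v (j + 1) $ s))" by (rule sum.swap)
  also have "\<dots> = (\<Sum>j<m. x j * ((A *\<^sub>v v (j + 1)) $ r))"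
  proof (intro sum.cong refl)
    fix j assume "j \<in> {..<m}"
    then have "v (j + 1) \<in> carrier_vec n" by (intro arn_v) auto
    then show "(\<Sum>s<n. x j * (A $$ (r, s) * v (j + 1) $ s)) = x j * ((A *\<^sub>v v (j + 1)) $ r)"
      using A r by (simp add: scalar_prod_def lessThan_atLeast0 sum_distrib_left)
  qed
  finally show ?thesis .
qed

text \<open>By induction \<open>A\<^sup>i b\<close> is a combination of \<open>v\<^sub>1, \<dots>, v\<^sub>i\<^sub>+\<^sub>1\<close>: multiplication by \<open>A\<close> raises the last
  index by at most one because \<open>h\<close> is Hessenberg.\<close>

lemma krylov_in_range:
  assumes "i < m"
  shows "\<exists>x. (\<forall>j>i. x j = 0) \<and> (\<forall>r<n. (A ^\<^sub>m i *\<^sub>v b) $ r = (\<Sum>j<m. x j * (v (j + 1) $ r)))"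
  using assms
proof (induction i)
  case 0
  obtain \<beta> where \<beta>: "b = \<beta> \<cdot>\<^sub>v v 1" using arn by (auto simp: arnoldi_like_def)
  have v1: "v 1 \<in> carrier_vec n" by (rule arn_v) simp
  have "(A ^\<^sub>m 0 *\<^sub>v b) $ r = (\<Sum>j<m. (if j = 0 then \<beta> else 0) * (v (j + 1) $ r))" if r: "r < n" for r
  proof -
    have "(A ^\<^sub>m 0 *\<^sub>v b) $ r = \<beta> * (v 1 $ r)" using A b v1 r \<beta> by simp
    also have "\<dots> = (\<Sum>j<m. if j = 0 then \<beta> * (v 1 $ r) else 0)" using 0 by simp
    also have "\<dots> = (\<Sum>j<m. (if j = 0 then \<beta> else 0) * (v (j + 1) $ r))" by (intro sum.cong) auto
    finally show ?thesis .
  qed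
  then show ?case by (intro exI[of _ "\<lambda>j. if j = 0 then \<beta> else 0"]) auto
next
  case (Suc i)
  then obtain x where x: "\<And>j. j > i \<Longrightarrow> x j = 0"
    "\<And>r. r < n \<Longrightarrow> (A ^\<^sub>m i *\<^sub>v b) $ r = (\<Sum>j<m. x j * (v (j + 1) $ r))" by auto
  define x' where "x' l = (\<Sum>j<m. x j * h (l + 1) (j + 1))" for l
  have Ai: "A ^\<^sub>m i \<in> carrier_mat n n" using A by (rule pow_carrier_mat)
  have u: "A ^\<^sub>m i *\<^sub>v b \<in> carrier_vec n" by (rule mult_mat_vec_carrier[OF Ai b])
  have "(A ^\<^sub>m Suc i *\<^sub>v b) $ r = (\<Sum>l<m. x' l * (v (l + 1) $ r))" if r: "r < n" for r
  proof -
    have "A ^\<^sub>m Suc i *\<^sub>v b = A *\<^sub>v (A ^\<^sub>m i *\<^sub>v b)"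
      unfolding pow_mat_Suc_left[OF A] by (rule assoc_mult_mat_vec[OF A Ai b])
    then have "(A ^\<^sub>m Suc i *\<^sub>v b) $ r = (\<Sum>j<m. x j * ((A *\<^sub>v v (j + 1)) $ r))"
      using mult_combination[OF x(2) u r] by simp
    also have "\<dots> = (\<Sum>j<m. \<Sum>l<m. x j * (h (l + 1) (j + 1) * (v (l + 1) $ r)))"
    proof (intro sum.cong refl)
      fix j assume "j \<in> {..<m}"
      show "x j * ((A *\<^sub>v v (j + 1)) $ r) = (\<Sum>l<m. x j * (h (l + 1) (j + 1) * (v (l + 1) $ r)))"
      proof (cases "j \<le> i")
        case True
        then show ?thesis using arn_column[of j r] r Suc.prems by (simp add: sum_distrib_left)
      next
        case False
        then show ?thesis using x(1)[of j] by simp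
      qed
    qed
    also have "\<dots> = (\<Sum>l<m. \<Sum>j<m. x j * (h (l + 1) (j + 1) * (v (l + 1) $ r)))" by (rule sum.swap)
    also have "\<dots> = (\<Sum>l<m. x' l * (v (l + 1) $ r))"
      by (intro sum.cong refl) (simp add: x'_def sum_distrib_right mult.assoc)
    finally show ?thesis .
  qed
  moreover have "x' l = 0" if l: "l > Suc i" for l
    unfolding x'_def
  proof (rule sum.neutral, rule ballI)
    fix j assume "j \<in> {..<m}"
    show "x j * h (l + 1) (j + 1) = 0" using x(1)[of j] arn_hess[of "j + 1" "l + 1"] l by (cases "j \<le> i") auto
  qed
  ultimately show ?case by blast
qed

lemma basis_mat_carrier: "basis_mat n m v \<in> carrier_mat n m"
  by (auto simp: basis_mat_def)

lemma basis_mat_index: "r < n \<Longrightarrow> j < m \<Longrightarrow> basis_mat n m v $$ (r, j) = v (j + 1) $ r"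
  unfolding basis_mat_def by (subst mat_of_cols_index) (auto simp del: upt_Suc)

lemma basis_mat_mult_vec:
  fixes x :: "real vec"
  assumes "x \<in> carrier_vec m" "r < n"
  shows "(basis_mat n m v *\<^sub>v x) $ r = (\<Sum>j<m. x $ j * (v (j + 1) $ r))"
proof -
  have "(basis_mat n m v *\<^sub>v x) $ r = (\<Sum>j<m. basis_mat n m v $$ (r, j) * x $ j)"
    using assms basis_mat_carrier by (simp add: scalar_prod_def lessThan_atLeast0)
  also have "\<dots> = (\<Sum>j<m. x $ j * (v (j + 1) $ r))"
    using assms by (intro sum.cong refl) (simp add: basis_mat_index mult.commute)
  finally show ?thesis .
qed

text \<open>Write the Krylov vectors as the columns of \<open>V T\<close>. They are independent, so \<open>T\<close> is injective, hence
  invertible, and every \<open>x\<close> in the kernel of \<open>V\<close> has the form \<open>T y\<close> with \<open>y\<close> in the kernel of \<open>V T\<close>.\<close>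

lemma basis_mat_injective:
  fixes x :: "real vec"
  assumes dim: "subspace_dim n (krylov_space A b m) = m"
    and x: "x \<in> carrier_vec m" "basis_mat n m v *\<^sub>v x = 0\<^sub>v n"
  shows "x = 0\<^sub>v m"
proof -
  have "\<forall>i\<in>{..<m}. \<exists>x. \<forall>r<n. (A ^\<^sub>m i *\<^sub>v b) $ r = (\<Sum>j<m. x j * (v (j + 1) $ r))"
    using krylov_in_range by blast
  from bchoice[OF this] obtain X where X: "\<forall>i\<in>{..<m}. \<forall>r<n. (A ^\<^sub>m i *\<^sub>v b) $ r = (\<Sum>j<m. X i j * (v (j + 1) $ r))"
    ..
  define T where "T = mat m m (\<lambda>(j, i). X i j)"
  have T: "T \<in> carrier_mat m m" by (simp add: T_def)
  have comb: "(\<Sum>i<m. y $ i * ((A ^\<^sub>m i *\<^sub>v b) $ r)) = (\<Sum>j<m. (T *\<^sub>v y) $ j * (v (j + 1) $ r))"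
    if y: "y \<in> carrier_vec m" and r: "r < n" for y :: "real vec" and r
  proof -
    have "(\<Sum>i<m. y $ i * ((A ^\<^sub>m i *\<^sub>v b) $ r)) = (\<Sum>i<m. \<Sum>j<m. y $ i * (X i j * (v (j + 1) $ r)))"
      using X r by (intro sum.cong refl) (simp add: sum_distrib_left)
    also have "\<dots> = (\<Sum>j<m. \<Sum>i<m. y $ i * (X i j * (v (j + 1) $ r)))" by (rule sum.swap)
    also have "\<dots> = (\<Sum>j<m. (T *\<^sub>v y) $ j * (v (j + 1) $ r))"
    proof (intro sum.cong refl)
      fix j assume j: "j \<in> {..<m}"
      have "(T *\<^sub>v y) $ j = (\<Sum>i<m. X i j * y $ i)"
        using j y by (simp add: T_def scalar_prod_def lessThan_atLeast0)
      then show "(\<Sum>i<m. y $ i * (X i j * (v (j + 1) $ r))) = (T *\<^sub>v y) $ j * (v (j + 1) $ r)"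
        by (auto simp: sum_distrib_right intro!: sum.cong)
    qed
    finally show ?thesis .
  qed
  have indep: "y = 0\<^sub>v m" if y: "y \<in> carrier_vec m" and z: "\<And>r. r < n \<Longrightarrow> (\<Sum>j<m. (T *\<^sub>v y) $ j * (v (j + 1) $ r)) = 0" for y :: "real vec"
  proof (rule eq_vecI)
    fix i assume "i < dim_vec (0\<^sub>v m :: real vec)"
    then show "y $ i = 0\<^sub>v m $ i"
      using krylov_independent[OF A b dim, of "\<lambda>i. y $ i" i] comb[OF y] z by simp
  qed (use y in auto)
  obtain S where S: "S \<in> carrier_mat m m" "T * S = 1\<^sub>m m"
    by (rule inverse_of_injective[OF T]) (use indep in auto)
  define y where "y = S *\<^sub>v x"
  have y: "y \<in> carrier_vec m" unfolding y_def using S x by simp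
  have Ty: "T *\<^sub>v y = x"
    unfolding y_def using assoc_mult_mat_vec[OF T S(1) x(1)] S(2) x(1) by simp
  have "y = 0\<^sub>v m"
  proof (rule indep[OF y])
    fix r assume r: "r < n"
    have "(basis_mat n m v *\<^sub>v x) $ r = 0" using x(2) r by simp
    then show "(\<Sum>j<m. (T *\<^sub>v y) $ j * (v (j + 1) $ r)) = 0"
      unfolding Ty using basis_mat_mult_vec[OF x(1) r] by simp
  qed
  then show ?thesis using Ty T by auto
qed

text \<open>The remainder \<open>h\<^sub>m\<^sub>+\<^sub>1\<^sub>,\<^sub>m v\<^sub>m\<^sub>+\<^sub>1 e\<^sub>m\<^sup>T\<close> of the Arnoldi-like decomposition affects only the
  last column.\<close>

lemma basis_mat_column_relation:
  assumes i: "j + 1 < m"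
  shows "col (A * basis_mat n m v) j = col (basis_mat n m v * hessenberg_mat m h) j"
proof (rule eq_vecI)
  let ?V = "basis_mat n m v" let ?H = "hessenberg_mat m h"
  have V: "?V \<in> carrier_mat n m" by (rule basis_mat_carrier)
  have H: "?H \<in> carrier_mat m m" by (simp add: hessenberg_mat_def)
  fix r assume "r < dim_vec (col (?V * ?H) j)"
  then have r: "r < n" using V by simp
  have vj: "v (j + 1) \<in> carrier_vec n" by (rule arn_v) (use i in auto)
  have "col ?V j = v (j + 1)" using V vj i by (intro eq_vecI) (auto simp: basis_mat_index)
  then have "col (A * ?V) j $ r = (A *\<^sub>v v (j + 1)) $ r" using A V r i by simp
  also have "\<dots> = (\<Sum>l<m. h (l + 1) (j + 1) * (v (l + 1) $ r))" by (rule arn_column[OF i r])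
  also have "\<dots> = (?V *\<^sub>v col ?H j) $ r"
    using i H by (subst basis_mat_mult_vec[OF _ r]) (auto simp: hessenberg_mat_def)
  also have "\<dots> = col (?V * ?H) j $ r" using V H i r by simp
  finally show "col (A * ?V) j $ r = col (?V * ?H) j $ r" .
qed (use A basis_mat_carrier in auto)

end

section \<open>The pseudoinverse of an injective matrix\<close>

lemma scalar_prod_self_eq_0:
  fixes z :: "real vec"
  assumes "z \<in> carrier_vec n" "z \<bullet> z = 0"
  shows "z = 0\<^sub>v n"
proof -
  have "(\<Sum>i<n. z $ i * z $ i) = 0" using assms by (simp add: scalar_prod_def lessThan_atLeast0)
  then have "\<forall>i\<in>{..<n}. z $ i * z $ i = 0" by (subst (asm) sum_nonneg_eq_0_iff) auto
  then show ?thesis using assms(1) by (intro eq_vecI) auto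
qed

text \<open>For injective \<open>V\<close> the matrix \<open>(V\<^sup>T V)\<^sup>-\<^sup>1 V\<^sup>T\<close> solves the Penrose equations. Any other solution \<open>Y\<close>
  is also a left inverse, and \<open>V Y\<close> is then the same orthogonal projection.\<close>

lemma pinv_left_inverse:
  fixes V :: "real mat"
  assumes V: "V \<in> carrier_mat n m" and inj: "\<And>x. x \<in> carrier_vec m \<Longrightarrow> V *\<^sub>v x = 0\<^sub>v n \<Longrightarrow> x = 0\<^sub>v m"
  shows "pinv V \<in> carrier_mat m n" "pinv V * V = 1\<^sub>m m"
proof -
  let ?Vt = "transpose_mat V"
  define G where "G = ?Vt * V"
  have Vt: "?Vt \<in> carrier_mat m n" using V by simp
  have G: "G \<in> carrier_mat m m" unfolding G_def using V by simp
  have Ginj: "x = 0\<^sub>v m" if x: "x \<in> carrier_vec m" and Gx: "G *\<^sub>v x = 0\<^sub>v m" for x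
  proof -
    let ?y = "V *\<^sub>v x"
    have y: "?y \<in> carrier_vec n" using V x by simp
    have "(?Vt *\<^sub>v ?y) \<bullet> x = ?y \<bullet> ?y" by (rule transpose_vec_mult_scalar[OF V x y])
    moreover have "?Vt *\<^sub>v ?y = 0\<^sub>v m" using Gx assoc_mult_mat_vec[OF Vt V x] by (simp add: G_def)
    ultimately have "?y \<bullet> ?y = 0" using x by simp
    then have "?y = 0\<^sub>v n" by (rule scalar_prod_self_eq_0[OF y])
    then show ?thesis by (rule inj[OF x])
  qed
  obtain S where S: "S \<in> carrier_mat m m" "G * S = 1\<^sub>m m" "S * G = 1\<^sub>m m"
    by (rule inverse_of_injective[OF G Ginj])
  have Gt: "transpose_mat G = G" unfolding G_def using transpose_mult[OF Vt V] by simp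
  have St: "transpose_mat S = S"
  proof -
    have "transpose_mat S * G = transpose_mat (G * S)" using transpose_mult[OF G S(1)] Gt by simp
    then have "transpose_mat S * G = 1\<^sub>m m" using S by simp
    have St: "transpose_mat S \<in> carrier_mat m m" using S by simp
    have "transpose_mat S = transpose_mat S * (G * S)" using S St by simp
    also have "\<dots> = (transpose_mat S * G) * S" by (rule assoc_mult_mat[symmetric, OF St G S(1)])
    also have "\<dots> = S" using \<open>transpose_mat S * G = 1\<^sub>m m\<close> S by simp
    finally show ?thesis .
  qed
  define X where "X = S * ?Vt"
  have X: "X \<in> carrier_mat m n" unfolding X_def using S Vt by simp
  have XV: "X * V = 1\<^sub>m m" unfolding X_def using assoc_mult_mat[OF S(1) Vt V] S(3) by (simp add: G_def)
  have VX: "transpose_mat (V * X) = V * X"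
  proof -
    have "transpose_mat (V * X) = transpose_mat X * ?Vt" by (rule transpose_mult[OF V X])
    also have "transpose_mat X = V * S" unfolding X_def using transpose_mult[OF S(1) Vt] St by simp
    also have "V * S * ?Vt = V * X" unfolding X_def by (rule assoc_mult_mat[OF V S(1) Vt])
    finally show ?thesis .
  qed
  have unique: "Y = X" if Y: "Y \<in> carrier_mat m n" "V * Y * V = V" "Y * V * Y = Y" "transpose_mat (V * Y) = V * Y" for Y
  proof -
    have YV: "Y * V = 1\<^sub>m m"
    proof (rule eq_matI)
      fix i j assume "i < dim_row (1\<^sub>m m :: real mat)" "j < dim_col (1\<^sub>m m :: real mat)"
      then have ij: "i < m" "j < m" by auto
      define x where "x = col (Y * V) j - unit_vec m j"
      have c: "col (Y * V) j \<in> carrier_vec m" using Y V ij by (auto intro!: carrier_vecI)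
      have x: "x \<in> carrier_vec m" unfolding x_def using c by simp
      have "V *\<^sub>v x = V *\<^sub>v col (Y * V) j - V *\<^sub>v unit_vec m j"
        unfolding x_def by (rule mult_minus_distrib_mat_vec[OF V c]) simp
      also have "V *\<^sub>v col (Y * V) j = col (V * (Y * V)) j"
        using col_mult2[OF V mult_carrier_mat[OF Y(1) V] ij(2)] by simp
      also have "V * (Y * V) = V" using Y(2) assoc_mult_mat[OF V Y(1) V] by simp
      also have "V *\<^sub>v unit_vec m j = col V j" using V ij by (intro eq_vecI) auto
      also have "col V j - col V j = 0\<^sub>v n" using V ij by (intro eq_vecI) auto
      finally have "x = 0\<^sub>v m" by (rule inj[OF x])
      then have "x $ i = 0" using ij by simp
      then show "(Y * V) $$ (i, j) = 1\<^sub>m m $$ (i, j)" using Y V ij by (auto simp: x_def)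
    qed (use Y V in auto)
    have VYc: "V * Y \<in> carrier_mat n n" and VXc: "V * X \<in> carrier_mat n n" using V X Y by auto
    have 1: "(V * Y) * (V * X) = V * X"
    proof -
      have "(V * Y) * (V * X) = V * (Y * (V * X))" by (rule assoc_mult_mat[OF V Y(1) VXc])
      also have "Y * (V * X) = (Y * V) * X" by (rule assoc_mult_mat[symmetric, OF Y(1) V X])
      finally show ?thesis using YV X by simp
    qed
    have 2: "(V * X) * (V * Y) = V * Y"
    proof -
      have "(V * X) * (V * Y) = V * (X * (V * Y))" by (rule assoc_mult_mat[OF V X VYc])
      also have "X * (V * Y) = (X * V) * Y" by (rule assoc_mult_mat[symmetric, OF X V Y(1)])
      finally show ?thesis using XV Y by simp
    qed
    have "V * X = transpose_mat ((V * Y) * (V * X))" using 1 VX by simp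
    also have "\<dots> = (V * X) * (V * Y)" using transpose_mult[OF VYc VXc] VX Y(4) by simp
    finally have VXY: "V * X = V * Y" using 2 by simp
    have "Y = (Y * V) * Y" using Y(3) by simp
    also have "\<dots> = (X * V) * Y" using YV XV by simp
    also have "\<dots> = X * (V * Y)" by (rule assoc_mult_mat[OF X V Y(1)])
    also have "\<dots> = X * (V * X)" using VXY by simp
    also have "\<dots> = (X * V) * X" by (rule assoc_mult_mat[symmetric, OF X V X])
    also have "\<dots> = X" using XV X by simp
    finally show ?thesis .
  qed
  have "pinv V = X" unfolding pinv_def
  proof (rule the_equality)
    have "V * X * V = V" using assoc_mult_mat[OF V X V] XV V by simp
    moreover have "X * V * X = X" using XV X by simp
    ultimately show "X \<in> carrier_mat (dim_col V) (dim_row V) \<and> V * X * V = V \<and> X * V * X = X \<and>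
      transpose_mat (V * X) = V * X \<and> transpose_mat (X * V) = X * V"
      using X V VX XV by auto
    show "Y = X" if "Y \<in> carrier_mat (dim_col V) (dim_row V) \<and> V * Y * V = V \<and> Y * V * Y = Y \<and>
      transpose_mat (V * Y) = V * Y \<and> transpose_mat (Y * V) = Y * V" for Y
      using that V by (intro unique) auto
  qed
  then show "pinv V \<in> carrier_mat m n" "pinv V * V = 1\<^sub>m m" using X XV by auto
qed

section \<open>The error bound\<close>

lemma poly_at_mat_pCons_mult_vec:
  fixes x :: "complex vec"
  assumes M: "M \<in> carrier_mat m m" and x: "x \<in> carrier_vec m"
  shows "poly_at_mat M (pCons a p) *\<^sub>v x = a \<cdot>\<^sub>v x + M *\<^sub>v (poly_at_mat M p *\<^sub>v x)"
proof -
  have P: "poly_at_mat M p \<in> carrier_mat m m" by (rule poly_at_mat_carrier[OF M])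
  have "poly_at_mat M (pCons a p) *\<^sub>v x = (a \<cdot>\<^sub>m 1\<^sub>m m) *\<^sub>v x + (M * poly_at_mat M p) *\<^sub>v x"
    unfolding poly_at_mat_pCons[OF M] by (rule add_mult_distrib_mat_vec[OF _ _ x]) (use M P in auto)
  then show ?thesis
    by (simp add: smult_mat_mult_vec[OF one_carrier_mat x] one_mult_mat_vec[OF x] assoc_mult_mat_vec[OF M P x])
qed

text \<open>The vector \<open>p(C) e\<^sub>1\<close> has no component beyond index \<open>degree p\<close>, since \<open>C\<close> is Hessenberg. As long as
  the degree is below \<open>m\<close>, building it up by Horner's scheme never multiplies the last column of
  \<open>C\<close>, the only one in which \<open>B\<close> differs, by a nonzero number.\<close>

lemma poly_at_mat_first_column_eq:
  fixes B C :: "complex mat"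
  assumes B: "B \<in> carrier_mat m m" and C: "C \<in> carrier_mat m m"
    and eq: "\<And>i j. i < m \<Longrightarrow> j + 1 < m \<Longrightarrow> B $$ (i, j) = C $$ (i, j)"
    and hess: "\<And>i j. i < m \<Longrightarrow> j + 1 < i \<Longrightarrow> C $$ (i, j) = 0"
    and d: "degree p \<le> d" "d < m"
  shows "poly_at_mat B p *\<^sub>v unit_vec m 0 = poly_at_mat C p *\<^sub>v unit_vec m 0 \<and>
    (\<forall>i. d < i \<and> i < m \<longrightarrow> (poly_at_mat C p *\<^sub>v unit_vec m 0) $ i = 0)"
  using d
proof (induction p arbitrary: d)
  case 0
  then show ?case using B C by simp
next
  case (pCons a p)
  have e: "unit_vec m 0 \<in> carrier_vec m" by simp
  define x where "x = poly_at_mat C p *\<^sub>v unit_vec m 0"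
  have x: "x \<in> carrier_vec m" unfolding x_def by (rule mult_mat_vec_carrier[OF poly_at_mat_carrier[OF C] e])
  show ?case
  proof (cases "p = 0")
    case True
    have "poly_at_mat B p *\<^sub>v unit_vec m 0 = x" "x = 0\<^sub>v m" using True B C by (auto simp: x_def)
    then have "B *\<^sub>v (poly_at_mat B p *\<^sub>v unit_vec m 0) = 0\<^sub>v m" "C *\<^sub>v x = 0\<^sub>v m" using B C by auto
    then show ?thesis unfolding poly_at_mat_pCons_mult_vec[OF B e] poly_at_mat_pCons_mult_vec[OF C e] x_def[symmetric] by simp
  next
    case False
    then have deg: "degree p \<le> d - 1" "d \<ge> 1" using pCons.prems by auto
    have IH: "poly_at_mat B p *\<^sub>v unit_vec m 0 = x" "\<And>i. d - 1 < i \<Longrightarrow> i < m \<Longrightarrow> x $ i = 0"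
      using pCons.IH[OF deg(1)] pCons.prems unfolding x_def by auto
    have row: "(M *\<^sub>v x) $ i = (\<Sum>j<m. M $$ (i, j) * x $ j)" if "M \<in> carrier_mat m m" "i < m" for M i
      using that x by (simp add: scalar_prod_def lessThan_atLeast0)
    have "B *\<^sub>v x = C *\<^sub>v x"
    proof (rule eq_vecI)
      fix i assume "i < dim_vec (C *\<^sub>v x)"
      then have i: "i < m" using C by simp
      have "B $$ (i, j) * x $ j = C $$ (i, j) * x $ j" if "j < m" for j
        using eq[OF i, of j] IH(2)[of j] that pCons.prems(2) deg by (cases "j + 1 < m") auto
      then show "(B *\<^sub>v x) $ i = (C *\<^sub>v x) $ i" unfolding row[OF B i] row[OF C i] by (intro sum.cong) auto
    qed (use B C in auto)
    moreover have "(C *\<^sub>v x) $ i = 0" if i: "d < i" "i < m" for i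
      unfolding row[OF C i(2)]
    proof (rule sum.neutral, rule ballI)
      fix j assume "j \<in> {..<m}"
      then show "C $$ (i, j) * x $ j = 0" using hess[OF i(2), of j] IH(2)[of j] i deg by (cases "j + 1 < i") auto
    qed
    ultimately show ?thesis
      unfolding poly_at_mat_pCons_mult_vec[OF B e] poly_at_mat_pCons_mult_vec[OF C e] x_def[symmetric] IH(1) using C x by simp
  qed
qed

text \<open>A smooth convex curve around the numerical range. It guarantees that the contour chosen in the
  definition of \<open>f(A)\<close> is a genuine one.\<close>

lemma cauchy_contour_exists:
  assumes A: "A \<in> carrier_mat n n" and n: "n \<ge> 1"
    and \<Omega>: "open \<Omega>" "f holomorphic_on \<Omega>" "numerical_range A \<subseteq> \<Omega>"
  shows "\<exists>\<gamma>. cauchy_contour f A \<gamma>"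
proof -
  obtain \<gamma> \<rho> where c: "convex_curve \<gamma> \<rho>" and reg: "numerical_range A \<subseteq> convex_curve.region \<gamma>"
    and creg: "convex_curve.closed_region \<gamma> \<subseteq> \<Omega>"
    using convex_curve_exists[OF compact_numerical_range[OF A] convex_numerical_range[OF A] numerical_range_nonempty[OF A n] \<Omega>(1,3)] .
  interpret convex_curve \<gamma> \<rho> by (rule c)
  obtain z0 where z0: "z0 \<in> region" using reg numerical_range_nonempty[OF A n] by blast
  have wind: "winding_number \<gamma> z = 1" if z: "z \<in> inside (path_image \<gamma>)" for z
  proof -
    have conn: "connected (inside (path_image \<gamma>))" using Jordan_inside_outside[OF simple_loop] by blast
    have "winding_number \<gamma> constant_on inside (path_image \<gamma>)"
      by (rule winding_number_constant[OF simple_path_imp_path[OF simple_loop(1)] simple_loop(2) conn])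
         (use inside_no_overlap in blast)
    then have "winding_number \<gamma> z = winding_number \<gamma> z0"
      using z subsetD[OF region_subset_inside z0] unfolding constant_on_def by metis
    then show ?thesis using winding_region[OF z0] by simp
  qed
  have "f analytic_on closure (inside (path_image \<gamma>))"
    using \<Omega>(1,2) closure_inside_subset_closed_region creg by (meson analytic_on_holomorphic order_trans)
  then have "cauchy_contour f A \<gamma>"
    unfolding cauchy_contour_def
    using valid_path_curve simple_loop wind spectrum_subset_numerical_range[OF A] reg region_subset_inside by blast
  then show ?thesis by blast
qed

lemma mat_fun_error_bound:
  assumes A: "A \<in> carrier_mat n n" and n: "n \<ge> 1"
    and \<Omega>: "open \<Omega>" "f holomorphic_on \<Omega>" "numerical_range A \<subseteq> \<Omega>"
    and M: "\<And>z. z \<in> numerical_range A \<Longrightarrow> cmod (f z - poly p z) \<le> M"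
    and u: "u \<in> carrier_vec n"
  shows "mat_fun f A \<in> carrier_mat n n"
    "vec_norm2 (mat_fun f A *\<^sub>v u - poly_at_mat A p *\<^sub>v u) \<le> (1 + sqrt 2) * M * vec_norm2 u"
proof -
  obtain as where as: "set as \<subseteq> spectrum A" "poly_at_mat A (roots_poly as) = 0\<^sub>m n n" using annihilating_roots_exist[OF A] .
  interpret matrix_calculus A n as by unfold_locales (use A as in auto)
  obtain \<gamma> where "cauchy_contour f A \<gamma>" using cauchy_contour_exists[OF A n \<Omega>] by blast
  then have f: "function_value f (mat_fun f A)" by (rule function_value_mat_fun)
  show F: "mat_fun f A \<in> carrier_mat n n" by (rule function_value_carrier[OF f])
  have "function_value (\<lambda>z. f z - poly p z) (mat_fun f A - poly_at_mat A p)" by (rule function_value_diff[OF f function_value_poly])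
  moreover have "(\<lambda>z. f z - poly p z) holomorphic_on \<Omega>" by (intro holomorphic_intros \<Omega>(2))
  ultimately have "vec_norm2 ((mat_fun f A - poly_at_mat A p) *\<^sub>v u) \<le> (1 + sqrt 2) * M * vec_norm2 u"
    using crouzeix_palencia[where f = "\<lambda>z. f z - poly p z" and \<Omega> = \<Omega> and X = "mat_fun f A - poly_at_mat A p"] n \<Omega> M u
    by blast
  moreover have "(mat_fun f A - poly_at_mat A p) *\<^sub>v u = mat_fun f A *\<^sub>v u - poly_at_mat A p *\<^sub>v u"
    by (rule minus_mult_distrib_mat_vec[OF F poly_at_mat_carrier[OF A] u])
  ultimately show "vec_norm2 (mat_fun f A *\<^sub>v u - poly_at_mat A p *\<^sub>v u) \<le> (1 + sqrt 2) * M * vec_norm2 u" by simp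
qed

theorem theorem6:
  fixes A :: "real mat" and b :: "real vec" and n m k :: nat
    and v :: "nat \<Rightarrow> real vec" and h :: "nat \<Rightarrow> nat \<Rightarrow> real"
    and V H :: "real mat" and B C :: "complex mat"
    and f :: "complex \<Rightarrow> complex" and \<Omega> :: "complex set"
  assumes "A \<in> carrier_mat n n" and "b \<in> carrier_vec n"
    and "k \<ge> 1" and "m \<ge> 1" and "m < n"
    and "subspace_dim n (krylov_space A b m) = m"
    and "truncated_orthogonalization A b m k v h"
  defines "V \<equiv> basis_mat n m v" and "H \<equiv> hessenberg_mat m h"
  defines "B \<equiv> map_mat complex_of_real (pinv V * A * V)" and "C \<equiv> map_mat complex_of_real H"
  assumes "open \<Omega>" and "connected \<Omega>" and "f holomorphic_on \<Omega>"
    and "numerical_range B \<subseteq> \<Omega>" and "numerical_range C \<subseteq> \<Omega>"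
  shows "\<exists>p. is_arg_min
           (\<lambda>p. sup_norm_on (numerical_range B \<union> numerical_range C) (\<lambda>z. f z - poly p z))
           (\<lambda>p. degree p \<le> m - 1) p \<and>
         vec_norm2 (mat_fun f B *\<^sub>v unit_vec m 0 - mat_fun f C *\<^sub>v unit_vec m 0)
           \<le> (2 + 2 * sqrt 2) *
             sup_norm_on (numerical_range B \<union> numerical_range C) (\<lambda>z. f z - poly p z)"
proof -
  note A = assms(1) and b = assms(2) and m = assms(4)
  have arn: "arnoldi_like A b n m v h"
    by (rule truncated_orthogonalization_arnoldi[OF A b assms(3,7)])
  have V: "V \<in> carrier_mat n m" unfolding V_def by (rule basis_mat_carrier[OF A b arn])
  have H: "H \<in> carrier_mat m m" by (simp add: H_def hessenberg_mat_def)
  have P: "pinv V \<in> carrier_mat m n" "pinv V * V = 1\<^sub>m m"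
    by (rule pinv_left_inverse[OF V]; use basis_mat_injective[OF A b arn assms(6)] V_def in blast)+
  have AV: "A * V \<in> carrier_mat n m" using A V by simp
  have Bc: "B \<in> carrier_mat m m" unfolding B_def using P A V by simp
  have Cc: "C \<in> carrier_mat m m" unfolding C_def using H by simp
  \<comment> \<open>Multiply the Arnoldi-like relation for column \<open>j\<close> from the left by the pseudoinverse.\<close>
  have BC: "B $$ (i, j) = C $$ (i, j)" if i: "i < m" and j: "j + 1 < m" for i j
  proof -
    have jm: "j < m" using j by simp
    have "(pinv V * A * V) $$ (i, j) = (pinv V * (A * V)) $$ (i, j)"
      by (simp only: assoc_mult_mat[OF P(1) A V])
    also have "\<dots> = row (pinv V) i \<bullet> col (A * V) j"
      by (rule index_mult_mat(1)) (use P AV i jm in auto)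
    also have "col (A * V) j = col (V * H) j"
      unfolding V_def H_def by (rule basis_mat_column_relation[OF A b arn j])
    also have "row (pinv V) i \<bullet> col (V * H) j = (pinv V * (V * H)) $$ (i, j)"
      by (rule index_mult_mat(1)[symmetric]) (use P V H i jm in auto)
    also have "pinv V * (V * H) = H"
      using assoc_mult_mat[OF P(1) V H] P(2) H by simp
    finally show ?thesis using P A V H i jm by (simp add: B_def C_def)
  qed
  have hess: "C $$ (i, j) = 0" if "i < m" "j + 1 < i" for i j
    using that arn_hess[OF A b arn, of "j + 1" "i + 1"] by (simp add: C_def H_def hessenberg_mat_def)
  define K where "K = numerical_range B \<union> numerical_range C"
  have Kc: "compact K" unfolding K_def by (intro compact_Un compact_numerical_range[OF Bc] compact_numerical_range[OF Cc])
  have K0: "K \<noteq> {}" unfolding K_def using numerical_range_nonempty[OF Bc m] by blast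
  have fK: "continuous_on K f"
    using \<open>f holomorphic_on \<Omega>\<close> assms(15,16) unfolding K_def
    by (intro continuous_on_subset[OF holomorphic_on_imp_continuous_on]) auto
  obtain p where p: "is_arg_min (\<lambda>p. sup_norm_on K (\<lambda>z. f z - poly p z)) (\<lambda>p. degree p \<le> m - 1) p"
    using best_approximation_exists[OF Kc K0 fK] by blast
  then have deg: "degree p \<le> m - 1" by (simp add: is_arg_min_def)
  define M where "M = sup_norm_on K (\<lambda>z. f z - poly p z)"
  have M: "cmod (f z - poly p z) \<le> M" if "z \<in> K" for z
    unfolding M_def by (rule sup_norm_on_upper[OF Kc _ that]) (intro continuous_intros fK)
  let ?e = "unit_vec m 0 :: complex vec"
  have e: "?e \<in> carrier_vec m" by simp
  have e1: "vec_norm2 ?e = 1"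
  proof -
    have "(vec_norm2 ?e)\<^sup>2 = (\<Sum>i<m. if i = 0 then 1 else 0)"
      unfolding vec_norm2_sq[OF e] by (intro sum.cong refl) auto
    then have "(vec_norm2 ?e)\<^sup>2 = 1" using m by simp
    then show ?thesis using vec_norm2_nonneg[of ?e] by (simp add: power2_eq_1_iff)
  qed
  have pe: "poly_at_mat B p *\<^sub>v ?e = poly_at_mat C p *\<^sub>v ?e"
    using poly_at_mat_first_column_eq[OF Bc Cc BC hess deg] m by simp
  note errB = mat_fun_error_bound[OF Bc m \<open>open \<Omega>\<close> \<open>f holomorphic_on \<Omega>\<close> \<open>numerical_range B \<subseteq> \<Omega>\<close> M e]
  note errC = mat_fun_error_bound[OF Cc m \<open>open \<Omega>\<close> \<open>f holomorphic_on \<Omega>\<close> \<open>numerical_range C \<subseteq> \<Omega>\<close> M e]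
  let ?x = "mat_fun f B *\<^sub>v ?e" and ?y = "mat_fun f C *\<^sub>v ?e" and ?z = "poly_at_mat C p *\<^sub>v ?e"
  have xc: "?x \<in> carrier_vec m" and yc: "?y \<in> carrier_vec m" and zc: "?z \<in> carrier_vec m"
    using mult_mat_vec_carrier[OF errB(1) e] mult_mat_vec_carrier[OF errC(1) e] mult_mat_vec_carrier[OF poly_at_mat_carrier[OF Cc] e]
    by (auto simp: K_def)
  have "x - y = (x - z) - (y - z)"
    if "x \<in> carrier_vec m" "y \<in> carrier_vec m" "z \<in> carrier_vec m" for x y z :: "complex vec"
    using that by (intro eq_vecI) auto
  from this[OF xc yc zc] have "vec_norm2 (?x - ?y) \<le> vec_norm2 (?x - ?z) + vec_norm2 (?y - ?z)"
    using vec_norm2_triangle_minus[of "?x - ?z" m "?y - ?z"] xc yc zc by simp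
  also have "\<dots> \<le> (1 + sqrt 2) * M + (1 + sqrt 2) * M"
    using errB(2) errC(2) pe e1 by (intro add_mono) (auto simp: K_def)
  finally have "vec_norm2 (?x - ?y) \<le> (2 + 2 * sqrt 2) * M" by (simp add: algebra_simps)
  then show ?thesis using p unfolding M_def K_def by blast
qed

end
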